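(* For each $k \in \{1,2,3,4\}$, the following decision problem is in $\mathrm{P}$: given a connected bridgeless block graph $G$, decide whether $\mathrm{rc}(G) = k$.
   Context: All graphs are finite, simple, undirected and connected. A block of $G$ is a maximal biconnected subgraph. A block graph is a graph in which every block is a clique. A graph is bridgeless if it has no edge whose removal disconnects it (for a block graph: no block is a $K_2$). Given a (not necessarily proper) edge-coloring of $G$, a path is rainbow if no two of its edges have the same color. An edge-colored graph is rainbow-connected if between every pair of vertices there is a rainbow path. The rainbow connection number $\mathrm{rc}(G)$ is the minimum number of colors in an edge-coloring making $G$ rainbow-connected. *)

theory Defs
  imports "HOL-Computational_Algebra.Polynomial" "Graph_Theory.Graph_Theory"
begin

section \<open>Block graphs\<close>

text \<open>
  A finite simple undirected graph is a digraph satisfying the locale predicate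
  \<^const>\<open>graph\<close>, i.e. a finite loop-free symmetric digraph without parallel arcs. An undirected
  edge is the two-element set of the ends of a pair of opposite arcs.
\<close>

definition uedge :: "('a,'b) pre_digraph \<Rightarrow> 'b \<Rightarrow> 'a set" where
  "uedge G a = {tail G a, head G a}"

definition uedges :: "('a,'b) pre_digraph \<Rightarrow> 'a set set" where
  "uedges G = uedge G ` arcs G"

definition del_uedge :: "('a,'b) pre_digraph \<Rightarrow> 'a set \<Rightarrow> ('a,'b) pre_digraph" where
  "del_uedge G e = G\<lparr> arcs := {a \<in> arcs G. uedge G a \<noteq> e} \<rparr>"

definition bridgeless :: "('a,'b) pre_digraph \<Rightarrow> bool" where
  "bridgeless G \<longleftrightarrow> (\<forall>e \<in> uedges G. Digraph_Component.connected (del_uedge G e))"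

text \<open>
  The library's notion of connectedness requires a vertex, hence the guard
  \<open>verts G \<noteq> {v}\<close>: removing the only vertex of a graph does not count as disconnecting it.
\<close>

definition cut_vertex :: "('a,'b) pre_digraph \<Rightarrow> 'a \<Rightarrow> bool" where
  "cut_vertex G v \<longleftrightarrow>
    v \<in> verts G \<and> verts G \<noteq> {v} \<and> \<not> Digraph_Component.connected (pre_digraph.del_vert G v)"

definition biconnected :: "('a,'b) pre_digraph \<Rightarrow> bool" where
  "biconnected G \<longleftrightarrow> graph G \<and> Digraph_Component.connected G \<and> (\<nexists>v. cut_vertex G v)"

definition is_block :: "('a,'b) pre_digraph \<Rightarrow> ('a,'b) pre_digraph \<Rightarrow> bool" where
  "is_block G H \<longleftrightarrow> pre_digraph.max_subgraph G biconnected H"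

definition block_graph :: "('a,'b) pre_digraph \<Rightarrow> bool" where
  "block_graph G \<longleftrightarrow> graph G \<and> (\<forall>H. is_block G H \<longrightarrow> (\<exists>m. complete_digraph m H))"


section \<open>Rainbow connection number\<close>

text \<open>An edge-coloring is a function on undirected edges, so opposite arcs get the same color.\<close>

definition rainbow_path ::
  "('a,'b) pre_digraph \<Rightarrow> ('a set \<Rightarrow> nat) \<Rightarrow> 'a \<Rightarrow> 'b awalk \<Rightarrow> 'a \<Rightarrow> bool" where
  "rainbow_path G c u p v \<longleftrightarrow> pre_digraph.apath G u p v \<and> distinct (map (c \<circ> uedge G) p)"

definition rainbow_connected :: "('a,'b) pre_digraph \<Rightarrow> ('a set \<Rightarrow> nat) \<Rightarrow> bool" where
  "rainbow_connected G c \<longleftrightarrow> (\<forall>u \<in> verts G. \<forall>v \<in> verts G. \<exists>p. rainbow_path G c u p v)"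

definition rc :: "('a,'b) pre_digraph \<Rightarrow> nat" where
  "rc G = (LEAST m. \<exists>c. rainbow_connected G c \<and> card (c ` uedges G) = m)"


section \<open>Deterministic multi-tape Turing machines\<close>

text \<open>
  States are the numbers below \<open>num_states M\<close>, tape symbols the numbers below
  \<open>num_symbols M\<close>. Symbol 0 is the blank, symbols 1 and 2 represent the input bits
  \<^const>\<open>False\<close> and \<^const>\<open>True\<close>. The tapes are infinite in both directions; the input is
  written on the first tape, starting at the initial head position 0.
\<close>

datatype move = Move_Left | Stay | Move_Right

record tm =
  num_tapes :: nat
  num_states :: nat
  num_symbols :: nat
  start_state :: nat
  accept_state :: nat
  reject_state :: nat
  delta :: "nat \<Rightarrow> nat list \<Rightarrow> nat \<times> (nat \<times> move) list"

definition wf_tm :: "tm \<Rightarrow> bool" where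
  "wf_tm M \<longleftrightarrow>
    num_tapes M \<ge> 1 \<and> num_symbols M \<ge> 3 \<and>
    start_state M < num_states M \<and> accept_state M < num_states M \<and>
    reject_state M < num_states M \<and> accept_state M \<noteq> reject_state M \<and>
    (\<forall>q ss q' as. q < num_states M \<and> length ss = num_tapes M \<and> set ss \<subseteq> {..<num_symbols M} \<and>
       delta M q ss = (q', as) \<longrightarrow>
       q' < num_states M \<and> length as = num_tapes M \<and> fst ` set as \<subseteq> {..<num_symbols M})"

type_synonym tape = "(int \<Rightarrow> nat) \<times> int"
type_synonym config = "nat \<times> tape list"

fun read_tape :: "tape \<Rightarrow> nat" where
  "read_tape (f, h) = f h"

fun offset :: "move \<Rightarrow> int" where
  "offset Move_Left = - 1"
| "offset Stay = 0"
| "offset Move_Right = 1"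

fun act_tape :: "nat \<times> move \<Rightarrow> tape \<Rightarrow> tape" where
  "act_tape (s, d) (f, h) = (f(h := s), h + offset d)"

fun tm_step :: "tm \<Rightarrow> config \<Rightarrow> config" where
  "tm_step M (q, ts) =
    (if q = accept_state M \<or> q = reject_state M then (q, ts)
     else let (q', as) = delta M q (map read_tape ts) in (q', map2 act_tape as ts))"

definition input_tape :: "bool list \<Rightarrow> tape" where
  "input_tape x =
    (\<lambda>i. if 0 \<le> i \<and> i < int (length x) then (if x ! nat i then 2 else 1) else 0, 0)"

definition init_config :: "tm \<Rightarrow> bool list \<Rightarrow> config" where
  "init_config M x = (start_state M, input_tape x # replicate (num_tapes M - 1) (input_tape []))"

definition tm_state_after :: "tm \<Rightarrow> bool list \<Rightarrow> nat \<Rightarrow> nat" where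
  "tm_state_after M x t = fst ((tm_step M ^^ t) (init_config M x))"

definition decides_in_time :: "tm \<Rightarrow> bool list set \<Rightarrow> (nat \<Rightarrow> nat) \<Rightarrow> bool" where
  "decides_in_time M L T \<longleftrightarrow>
    (\<forall>x. \<exists>t \<le> T (length x).
       tm_state_after M x t = (if x \<in> L then accept_state M else reject_state M))"

definition class_P :: "bool list set set" where
  "class_P = {L. \<exists>M (p :: nat poly). wf_tm M \<and> decides_in_time M L (poly p)}"


section \<open>The decision problem\<close>

text \<open>
  Input graphs have vertices \<open>0, \<dots>, n - 1\<close> and are given by their adjacency matrix, read row by
  row. The length \<open>n\<^sup>2\<close> determines \<open>n\<close>, so the encoding is injective.
\<close>

definition adjacency_matrix :: "nat pair_pre_digraph \<Rightarrow> bool list" where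
  "adjacency_matrix G =
    (let n = card (pverts G) in map (\<lambda>e. e \<in> parcs G) (List.product [0..<n] [0..<n]))"

text \<open>
  As usual, a decision problem is identified with the set of encodings of its yes-instances;
  strings that do not encode a connected bridgeless block graph are to be rejected.
\<close>

definition rc_problem :: "nat \<Rightarrow> bool list set" where
  "rc_problem k =
    {adjacency_matrix G | G. (\<exists>n. pverts G = {0..<n}) \<and> pair_graph G \<and>
       Digraph_Component.connected G \<and> bridgeless G \<and> block_graph G \<and> rc G = k}"

end

theory Submission
  imports Defs
begin

text \<open>
  For \<open>k \<le> 4\<close> the bridgeless block graphs with \<open>rc G \<le> k\<close> are characterized by a first-order
  sentence about adjacency, and a machine that keeps the value of each variable as a head position
  evaluates a fixed sentence on an adjacency matrix in polynomial time.

  Four colors force the diameter to be at most 4, and a block graph of diameter at most 4 has a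
  centre \<open>c\<close> within distance 2 of every vertex. Call a neighbour of \<open>c\<close> deep if it has a neighbour at
  distance 2 from \<open>c\<close>. If two deep vertices lie in different blocks, four colors leave each of them
  exactly two colors for reaching \<open>c\<close> from below, and these pairs are disjoint for different blocks.
  This allows at most two blocks with deep vertices, at most two deep vertices in each of them, and
  a single block below each deep vertex. The blocks at \<open>c\<close> without deep vertices must then
  either be large enough for a cyclic labelling or borrow help from a deep vertex that is alone in
  its block. Explicit colorings show that these conditions suffice.
\<close>

section \<open>Machines: first-order sentences on adjacency matrices in polynomial time\<close>

section \<open>While programs on several tapes\<close>

text \<open>Connectedness and the block property speak of walks of unbounded length, which a
  first-order sentence cannot follow. The centre removes this obstacle: relative to a fixed c all
  walk conditions collapse to conditions on two levels (\<open>rooted\<close>), and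
  \<open>every_edge_in_triangle\<close> does the same for bridges. The sentence for k therefore also
  recognizes the valid inputs; it states colorability with k but not with k - 1 colors. The pairs of
  colors come from counting: a vertex at distance 2 needs at least two colors to reach c, and walks
  between different blocks at c pass through c, so with four colors each side gets exactly two and
  uses the direct path. Most lower bounds then let a forced color occur twice on a walk that has to
  leave a part of the graph through a single vertex (\<open>rw_leave\<close>). A shallow vertex
  whose edge to c has a forced color must take a two-step walk in the complementary pair, through a
  helper whose own edge to c lies in that pair. Iterating this yields the four vertices that the
  cyclic labelling needs.\<close>

datatype com =
    Mv nat move
  | Wr nat nat
  | Seq com com (infixr \<open>;;\<close> 60)
  | Cond nat "nat set" com com
  | While nat "nat set" com

type_synonym state = "nat \<Rightarrow> tape"

abbreviation rd :: "state \<Rightarrow> nat \<Rightarrow> nat" where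
  "rd s i \<equiv> read_tape (s i)"

text \<open>The time is the exact number of steps of the compiled machine.\<close>

inductive exec :: "com \<Rightarrow> state \<Rightarrow> nat \<Rightarrow> state \<Rightarrow> bool" where
  Mv: "exec (Mv i d) s 1 (s(i := (fst (s i), snd (s i) + offset d)))"
| Wr: "exec (Wr i x) s 1 (s(i := ((fst (s i))(snd (s i) := x), snd (s i))))"
| Seq: "exec c s t s' \<Longrightarrow> exec c' s' t' s'' \<Longrightarrow> exec (c ;; c') s (t + t') s''"
| IfT: "rd s i \<in> A \<Longrightarrow> exec c s t s' \<Longrightarrow> exec (Cond i A c c') s (t + 2) s'"
| IfF: "rd s i \<notin> A \<Longrightarrow> exec c' s t s' \<Longrightarrow> exec (Cond i A c c') s (t + 1) s'"
| WhileF: "rd s i \<notin> A \<Longrightarrow> exec (While i A c) s 1 s"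
| WhileT: "rd s i \<in> A \<Longrightarrow> exec c s t s' \<Longrightarrow> exec (While i A c) s' t' s'' \<Longrightarrow>
    exec (While i A c) s (t + 2 + t') s''"

fun wf_com :: "nat \<Rightarrow> nat \<Rightarrow> com \<Rightarrow> bool" where
  "wf_com k m (Mv i d) \<longleftrightarrow> i < k"
| "wf_com k m (Wr i x) \<longleftrightarrow> i < k \<and> x < m"
| "wf_com k m (c ;; c') \<longleftrightarrow> wf_com k m c \<and> wf_com k m c'"
| "wf_com k m (Cond i A c c') \<longleftrightarrow> i < k \<and> wf_com k m c \<and> wf_com k m c'"
| "wf_com k m (While i A c) \<longleftrightarrow> i < k \<and> wf_com k m c"


section \<open>Compilation to Turing machines\<close>

type_synonym instr = "nat list \<Rightarrow> nat \<times> (nat \<times> move) list"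

definition idle :: "nat list \<Rightarrow> (nat \<times> move) list" where
  "idle ss = map (\<lambda>x. (x, Stay)) ss"

fun len :: "com \<Rightarrow> nat" where
  "len (Mv i d) = 1"
| "len (Wr i x) = 1"
| "len (c ;; c') = len c + len c'"
| "len (Cond i A c c') = len c + len c' + 2"
| "len (While i A c) = len c + 2"

text \<open>\<open>p\<close> is the absolute address of the first instruction, so jump targets are
  final. The then-branch ends with a jump over the else-branch and a loop body with a jump back to
  its test; these jumps explain why \<open>IfT\<close> and \<open>WhileT\<close> cost two extra
  steps where \<open>IfF\<close> and \<open>WhileF\<close> cost one.\<close>

fun compile :: "com \<Rightarrow> nat \<Rightarrow> instr list" where
  "compile (Mv i d) p = [\<lambda>ss. (p + 1, (idle ss)[i := (ss ! i, d)])]"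
| "compile (Wr i x) p = [\<lambda>ss. (p + 1, (idle ss)[i := (x, Stay)])]"
| "compile (c ;; c') p = compile c p @ compile c' (p + len c)"
| "compile (Cond i A c c') p =
    [\<lambda>ss. (if ss ! i \<in> A then p + 1 else p + len c + 2, idle ss)] @
    compile c (p + 1) @
    [\<lambda>ss. (p + len c + len c' + 2, idle ss)] @
    compile c' (p + len c + 2)"
| "compile (While i A c) p =
    [\<lambda>ss. (if ss ! i \<in> A then p + 1 else p + len c + 2, idle ss)] @
    compile c (p + 1) @
    [\<lambda>ss. (p, idle ss)]"

lemma length_compile [simp]: "length (compile c p) = len c"
  by (induction c arbitrary: p) auto

text \<open>Jumps go at most to the address just behind the fragment; this keeps the states of
  \<open>machine\<close> in range.\<close>

lemma compile_target:
  assumes "I \<in> set (compile c p)"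
  shows "fst (I ss) \<le> p + len c"
  using assms
proof (induction c arbitrary: p)
  case (Seq c1 c2)
  show ?case
    using Seq.prems by (auto dest!: Seq.IH)
next
  case (Cond i A c1 c2)
  show ?case
    using Cond.prems by (auto dest!: Cond.IH)
next
  case (While i A c)
  show ?case
    using While.prems by (auto dest!: While.IH)
qed auto

lemma compile_actions:
  assumes "I \<in> set (compile c p)" "wf_com k m c" "length ss = k" "set ss \<subseteq> {..<m}"
  shows "length (snd (I ss)) = k \<and> fst ` set (snd (I ss)) \<subseteq> {..<m}"
proof -
  have 1: "fst ` set ((idle ss)[i := (x, d)]) \<subseteq> {..<m}" if "x < m" for i x d
    using set_update_subset_insert[of "idle ss" i "(x, d)"] that assms(4)
    by (fastforce simp: idle_def)
  have 2: "ss ! i < m" if "i < k" for i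
    using that assms(3,4) by (meson lessThan_iff nth_mem subsetD)
  have 3: "x < m" if "(x, d) \<in> set (idle ss)" for x d
    using that assms(4) by (auto simp: idle_def)
  have 4: "length (idle ss) = k"
    using assms(3) by (simp add: idle_def)
  show ?thesis
    using assms(1,2) by (induction c arbitrary: p) (use 1 2 4 in \<open>auto dest: 3\<close>)
qed

definition code_at :: "instr list \<Rightarrow> nat \<Rightarrow> instr list \<Rightarrow> bool" where
  "code_at P p xs \<longleftrightarrow> (\<exists>as bs. P = as @ xs @ bs \<and> length as = p)"

lemma code_at_append:
  "code_at P p (xs @ ys) \<Longrightarrow> code_at P p xs \<and> code_at P (p + length xs) ys"
  unfolding code_at_def
proof (elim exE conjE)
  fix as bs
  assume *: "P = as @ (xs @ ys) @ bs" "length as = p"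
  have "P = as @ xs @ (ys @ bs)" "P = (as @ xs) @ ys @ bs" "length (as @ xs) = p + length xs"
    using * by auto
  then show "(\<exists>as bs. P = as @ xs @ bs \<and> length as = p) \<and>
      (\<exists>as bs. P = as @ ys @ bs \<and> length as = p + length xs)"
    using *(2) by blast
qed

lemma code_at_Cons:
  "code_at P p (x # ys) \<Longrightarrow> p < length P \<and> P ! p = x \<and> code_at P (p + 1) ys"
proof (intro conjI)
  assume *: "code_at P p (x # ys)"
  then obtain as bs where "P = as @ (x # ys) @ bs" "length as = p"
    unfolding code_at_def by blast
  then show "p < length P" "P ! p = x"
    by auto
  show "code_at P (p + 1) ys"
    using code_at_append[of P p "[x]" ys] * by simp
qed

text \<open>The last instruction enters one of the two halting states according to the result tape 1.\<close>

definition program :: "com \<Rightarrow> instr list" where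
  "program c = compile c 0 @ [\<lambda>ss. (if ss ! 1 = 2 then len c + 1 else len c + 2, idle ss)]"

text \<open>States below \<open>len c\<close> are the addresses of the compiled program,
  \<open>len c\<close> is the final test, and the last two states halt. Among these states, the idle
  case of \<open>delta\<close> concerns only the halting ones.\<close>

definition machine :: "nat \<Rightarrow> nat \<Rightarrow> com \<Rightarrow> tm" where
  "machine k m c = \<lparr> num_tapes = k, num_states = len c + 3, num_symbols = m, start_state = 0,
     accept_state = len c + 1, reject_state = len c + 2,
     delta = (\<lambda>q ss. if q < length (program c) then (program c ! q) ss else (q, idle ss)) \<rparr>"

lemma wf_machine:
  assumes "wf_com k m c" "k \<ge> 1" "m \<ge> 3"
  shows "wf_tm (machine k m c)"
  unfolding wf_tm_def
proof (intro conjI allI impI; (elim conjE)?)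
  fix q ss q' as
  assume q: "q < num_states (machine k m c)" and ss: "length ss = num_tapes (machine k m c)"
    "set ss \<subseteq> {..<num_symbols (machine k m c)}" and d: "delta (machine k m c) q ss = (q', as)"
  have idle: "length (idle ss) = k" "fst ` set (idle ss) \<subseteq> {..<m}"
    using ss by (auto simp: idle_def machine_def)
  have "q' < len c + 3 \<and> length as = k \<and> fst ` set as \<subseteq> {..<m}"
  proof (cases "q < len c")
    case True
    then have I: "program c ! q \<in> set (compile c 0)"
      by (simp add: program_def nth_append)
    have "(q', as) = (program c ! q) ss"
      using d True by (simp add: machine_def program_def)
    then show ?thesis
      using compile_target[OF I, of ss] compile_actions[OF I assms(1), of ss] ss
      by (simp add: machine_def prod_eq_iff)
  next
    case False
    then show ?thesis
      using d q idle
      by (auto simp: machine_def program_def nth_append split: if_splits)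
  qed
  then show "q' < num_states (machine k m c)" "length as = num_tapes (machine k m c)"
    "fst ` set as \<subseteq> {..<num_symbols (machine k m c)}"
    by (simp_all add: machine_def)
qed (use assms in \<open>simp_all add: machine_def\<close>)

definition conf :: "nat \<Rightarrow> nat \<Rightarrow> state \<Rightarrow> config" where
  "conf k q s = (q, map s [0..<k])"

lemma map2_act_idle:
  "map2 act_tape (idle (map (rd s) [0..<k])) (map s [0..<k]) = map s [0..<k]"
proof -
  have "act_tape (read_tape t, Stay) t = t" for t
    by (cases t) simp
  then show ?thesis
    by (intro nth_equalityI) (auto simp: idle_def)
qed

lemma map2_act_update:
  assumes "i < k"
  shows "map2 act_tape ((idle (map (rd s) [0..<k]))[i := (x, d)]) (map s [0..<k]) =
    map (s(i := ((fst (s i))(snd (s i) := x), snd (s i) + offset d))) [0..<k]"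
proof (rule nth_equalityI)
  fix j
  assume "j < length (map2 act_tape ((idle (map (rd s) [0..<k]))[i := (x, d)])
    (map s [0..<k]))"
  then have j: "j < k"
    by (simp add: idle_def)
  have "act_tape (read_tape t, Stay) t = t" for t
    by (cases t) simp
  moreover have "act_tape (x, d) t = ((fst t)(snd t := x), snd t + offset d)" for t
    by (cases t) simp
  ultimately show "map2 act_tape ((idle (map (rd s) [0..<k]))[i := (x, d)])
      (map s [0..<k]) ! j =
    map (s(i := ((fst (s i))(snd (s i) := x), snd (s i) + offset d))) [0..<k] ! j"
    using j assms by (cases "i = j") (simp_all add: idle_def)
qed (simp add: idle_def)

lemma tm_step_machine:
  assumes "q < len c + 1" "(program c ! q) (map (rd s) [0..<k]) = (q', as)"
    "map2 act_tape as (map s [0..<k]) = map s' [0..<k]"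
  shows "tm_step (machine k m c) (conf k q s) = conf k q' s'"
  using assms by (simp add: conf_def machine_def program_def comp_def)

text \<open>Simulation by induction on the execution. The fragment has to be located inside the
  whole program because jump targets are absolute, and the bound by \<open>len c\<close> keeps its
  addresses apart from the halting states.\<close>

lemma exec_machine:
  assumes "exec c0 s t s'" "code_at (program c) p (compile c0 p)" "wf_com k m c0"
    "p + len c0 \<le> len c"
  shows "(tm_step (machine k m' c) ^^ t) (conf k p s) = conf k (p + len c0) s'"
  using assms
proof (induction arbitrary: p rule: exec.induct)
  case (Mv i d s)
  have eq: "program c ! p = (\<lambda>ss. (p + 1, (idle ss)[i := (ss ! i, d)]))"
    using Mv code_at_Cons by fastforce
  have "tm_step (machine k m' c) (conf k p s) =
      conf k (p + 1) (s(i := ((fst (s i))(snd (s i) := rd s i), snd (s i) + offset d)))"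
    by (rule tm_step_machine[OF _ _ map2_act_update]) (use Mv.prems eq in auto)
  moreover have "(fst (s i))(snd (s i) := rd s i) = fst (s i)"
    by (cases "s i") simp
  ultimately have "tm_step (machine k m' c) (conf k p s) =
      conf k (p + 1) (s(i := (fst (s i), snd (s i) + offset d)))"
    by metis
  then show ?case
    by (simp add: fun_upd_def)
next
  case (Wr i x s)
  have eq: "program c ! p = (\<lambda>ss. (p + 1, (idle ss)[i := (x, Stay)]))"
    using Wr code_at_Cons by fastforce
  have "tm_step (machine k m' c) (conf k p s) =
      conf k (p + 1) (s(i := ((fst (s i))(snd (s i) := x), snd (s i) + offset Stay)))"
    by (rule tm_step_machine[OF _ _ map2_act_update]) (use Wr.prems eq in auto)
  then show ?case
    by (simp add: fun_upd_def)
next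
  case (Seq c1 s t s' c2 t' s'')
  have "code_at (program c) p (compile c1 p)" "code_at (program c) (p + len c1) (compile c2 (p + len c1))"
    using Seq.prems(1) code_at_append[of _ p "compile c1 p"] by auto
  then have "(tm_step (machine k m' c) ^^ t) (conf k p s) = conf k (p + len c1) s'"
    "(tm_step (machine k m' c) ^^ t') (conf k (p + len c1) s') = conf k (p + len c1 + len c2) s''"
    using Seq.IH Seq.prems by auto
  then show ?case
    by (simp add: add.commute[of t] funpow_add add.assoc)
next
  case (IfT s i A c1 t s' c2)
  have 1: "program c ! p = (\<lambda>ss. (if ss ! i \<in> A then p + 1 else p + len c1 + 2, idle ss))"
    and 2: "code_at (program c) (p + 1) (compile c1 (p + 1))"
    and 3: "program c ! (p + 1 + len c1) = (\<lambda>ss. (p + len c1 + len c2 + 2, idle ss))"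
    using IfT.prems(1) by (auto dest!: code_at_Cons code_at_append)
  have "tm_step (machine k m' c) (conf k p s) = conf k (p + 1) s"
    by (rule tm_step_machine[OF _ _ map2_act_idle]) (use IfT 1 in auto)
  moreover have "(tm_step (machine k m' c) ^^ t) (conf k (p + 1) s) = conf k (p + 1 + len c1) s'"
    using IfT 2 by simp
  moreover have "tm_step (machine k m' c) (conf k (p + 1 + len c1) s') =
      conf k (p + len c1 + len c2 + 2) s'"
    by (rule tm_step_machine[OF _ _ map2_act_idle]) (use IfT 3 in auto)
  ultimately have "(tm_step (machine k m' c) ^^ (1 + (t + 1))) (conf k p s) =
      conf k (p + len c1 + len c2 + 2) s'"
    unfolding funpow_add by simp
  moreover have "p + len (Cond i A c1 c2) = p + len c1 + len c2 + 2" "t + 2 = 1 + (t + 1)"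
    by simp_all
  ultimately show ?case
    by (simp only:)
next
  case (IfF s i A c2 t s' c1)
  have 1: "program c ! p = (\<lambda>ss. (if ss ! i \<in> A then p + 1 else p + len c1 + 2, idle ss))"
    and 2: "code_at (program c) (p + len c1 + 2) (compile c2 (p + len c1 + 2))"
    using IfF.prems(1) by (auto dest!: code_at_Cons code_at_append simp: add.commute add.left_commute)
  have "tm_step (machine k m' c) (conf k p s) = conf k (p + len c1 + 2) s"
    by (rule tm_step_machine[OF _ _ map2_act_idle]) (use IfF 1 in auto)
  moreover have "(tm_step (machine k m' c) ^^ t) (conf k (p + len c1 + 2) s) =
      conf k (p + len c1 + 2 + len c2) s'"
    using IfF 2 by simp
  ultimately have "(tm_step (machine k m' c) ^^ (t + 1)) (conf k p s) =
      conf k (p + len c1 + 2 + len c2) s'"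
    unfolding funpow_add by simp
  moreover have "p + len (Cond i A c1 c2) = p + len c1 + 2 + len c2"
    by simp
  ultimately show ?case
    by (simp only:)
next
  case (WhileF s i A c1)
  have 1: "program c ! p = (\<lambda>ss. (if ss ! i \<in> A then p + 1 else p + len c1 + 2, idle ss))"
    using WhileF.prems(1) by (auto dest!: code_at_Cons)
  have "tm_step (machine k m' c) (conf k p s) = conf k (p + len c1 + 2) s"
    by (rule tm_step_machine[OF _ _ map2_act_idle]) (use WhileF 1 in auto)
  then show ?case
    by simp
next
  case (WhileT s i A c1 t s' t' s'')
  have 1: "program c ! p = (\<lambda>ss. (if ss ! i \<in> A then p + 1 else p + len c1 + 2, idle ss))"
    and 2: "code_at (program c) (p + 1) (compile c1 (p + 1))"
    and 3: "program c ! (p + 1 + len c1) = (\<lambda>ss. (p, idle ss))"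
    using WhileT.prems(1) by (auto dest!: code_at_Cons code_at_append)
  have "tm_step (machine k m' c) (conf k p s) = conf k (p + 1) s"
    by (rule tm_step_machine[OF _ _ map2_act_idle]) (use WhileT 1 in auto)
  moreover have "(tm_step (machine k m' c) ^^ t) (conf k (p + 1) s) = conf k (p + 1 + len c1) s'"
    using WhileT 2 by simp
  moreover have "tm_step (machine k m' c) (conf k (p + 1 + len c1) s') = conf k p s'"
    by (rule tm_step_machine[OF _ _ map2_act_idle]) (use WhileT 3 in auto)
  moreover have "(tm_step (machine k m' c) ^^ t') (conf k p s') = conf k (p + len c1 + 2) s''"
    using WhileT by simp
  ultimately have "(tm_step (machine k m' c) ^^ (t' + (1 + (t + 1)))) (conf k p s) =
      conf k (p + len c1 + 2) s''"
    unfolding funpow_add by simp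
  moreover have "p + len (While i A c1) = p + len c1 + 2" "t + 2 + t' = t' + (1 + (t + 1))"
    by simp_all
  ultimately show ?case
    by (simp only:)
qed

definition init_state :: "bool list \<Rightarrow> state" where
  "init_state x = (\<lambda>_. input_tape [])(0 := input_tape x)"

text \<open>Tape 1 carries the result, hence two tapes; blank and input bits make three symbols. The
  final test costs one step more than the program, which turns \<open>p\<close> into
  \<open>p + 1\<close>.\<close>

lemma in_class_P_if_exec:
  fixes p :: "nat poly"
  assumes "wf_com k m c" "k \<ge> 2" "m \<ge> 3"
    and run: "\<And>x. \<exists>t s. exec c (init_state x) t s \<and> t \<le> poly p (length x) \<and> (rd s 1 = 2 \<longleftrightarrow> x \<in> L)"
  shows "L \<in> class_P"
proof -
  let ?M = "machine k m c"
  have "\<exists>t \<le> poly (p + 1) (length x).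
      tm_state_after ?M x t = (if x \<in> L then accept_state ?M else reject_state ?M)" for x
  proof -
    obtain t s where ts: "exec c (init_state x) t s" "t \<le> poly p (length x)" "rd s 1 = 2 \<longleftrightarrow> x \<in> L"
      using run by blast
    have "[0..<k] = 0 # [1..<k]"
      using \<open>k \<ge> 2\<close> by (simp add: upt_conv_Cons)
    then have "init_config ?M x = conf k 0 (init_state x)"
      by (simp add: init_config_def conf_def machine_def init_state_def map_replicate_const)
    moreover have "code_at (program c) 0 (compile c 0)"
      unfolding code_at_def program_def by (intro exI[of _ "[]"] exI conjI) simp_all
    ultimately have 1: "(tm_step ?M ^^ t) (init_config ?M x) = conf k (len c) s"
      using exec_machine[OF ts(1), of c 0 k m] assms(1) by simp
    have 2: "tm_step ?M (conf k (len c) s) = conf k (if rd s 1 = 2 then len c + 1 else len c + 2) s"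
      by (rule tm_step_machine[OF _ _ map2_act_idle])
        (use \<open>k \<ge> 2\<close> in \<open>auto simp: program_def nth_append\<close>)
    have "(tm_step ?M ^^ (t + 1)) (init_config ?M x) =
        conf k (if rd s 1 = 2 then len c + 1 else len c + 2) s"
      using 1 2 by simp
    then have "tm_state_after ?M x (t + 1) = (if x \<in> L then accept_state ?M else reject_state ?M)"
      using ts(3) by (simp add: tm_state_after_def conf_def machine_def)
    then show ?thesis
      using ts(2) by (intro exI[of _ "t + 1"] conjI) (simp_all only: poly_add poly_1)
  qed
  then have "decides_in_time ?M L (poly (p + 1))"
    unfolding decides_in_time_def ..
  moreover have "wf_tm ?M"
    using wf_machine assms by simp
  ultimately show ?thesis
    unfolding class_P_def by (intro CollectI exI conjI)
qed


section \<open>First-order formulas\<close>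

datatype fo = Adj nat nat | Equ nat nat | Neg fo | Cnj fo fo | Exi nat fo

primrec sat :: "(nat \<Rightarrow> nat \<Rightarrow> bool) \<Rightarrow> nat \<Rightarrow> (nat \<Rightarrow> nat) \<Rightarrow> fo \<Rightarrow> bool" where
  "sat E n \<sigma> (Adj i j) \<longleftrightarrow> E (\<sigma> i) (\<sigma> j)"
| "sat E n \<sigma> (Equ i j) \<longleftrightarrow> \<sigma> i = \<sigma> j"
| "sat E n \<sigma> (Neg \<phi>) \<longleftrightarrow> \<not> sat E n \<sigma> \<phi>"
| "sat E n \<sigma> (Cnj \<phi> \<psi>) \<longleftrightarrow> sat E n \<sigma> \<phi> \<and> sat E n \<sigma> \<psi>"
| "sat E n \<sigma> (Exi k \<phi>) \<longleftrightarrow> (\<exists>v<n. sat E n (\<sigma>(k := v)) \<phi>)"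

primrec bvars :: "fo \<Rightarrow> nat set" where
  "bvars (Adj i j) = {}"
| "bvars (Equ i j) = {}"
| "bvars (Neg \<phi>) = bvars \<phi>"
| "bvars (Cnj \<phi> \<psi>) = bvars \<phi> \<union> bvars \<psi>"
| "bvars (Exi k \<phi>) = insert k (bvars \<phi>)"

text \<open>The value of a variable is the head position of its tape, so an inner quantifier for the same
  variable would overwrite it.\<close>

primrec wf_fo :: "nat \<Rightarrow> fo \<Rightarrow> bool" where
  "wf_fo d (Adj i j) \<longleftrightarrow> i < d \<and> j < d"
| "wf_fo d (Equ i j) \<longleftrightarrow> i < d \<and> j < d"
| "wf_fo d (Neg \<phi>) \<longleftrightarrow> wf_fo d \<phi>"
| "wf_fo d (Cnj \<phi> \<psi>) \<longleftrightarrow> wf_fo d \<phi> \<and> wf_fo d \<psi>"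
| "wf_fo d (Exi k \<phi>) \<longleftrightarrow> k < d \<and> k \<notin> bvars \<phi> \<and> wf_fo d \<phi>"


section \<open>Running times\<close>

text \<open>Exact times depend on the branches taken; upper bounds compose uniformly and are all
  that \<open>class_P\<close> asks for.\<close>

definition run :: "com \<Rightarrow> state \<Rightarrow> nat \<Rightarrow> state \<Rightarrow> bool" where
  "run c s T s' \<longleftrightarrow> (\<exists>t\<le>T. exec c s t s')"

lemma run_mono: "run c s T s' \<Longrightarrow> T \<le> T' \<Longrightarrow> run c s T' s'"
  unfolding run_def by (meson le_trans)

lemma run_Mv: "s' = s(i := (fst (s i), snd (s i) + offset d)) \<Longrightarrow> run (Mv i d) s 1 s'"
  unfolding run_def using exec.Mv by blast

lemma run_Wr: "s' = s(i := ((fst (s i))(snd (s i) := x), snd (s i))) \<Longrightarrow> run (Wr i x) s 1 s'"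
  unfolding run_def using exec.Wr by blast

lemma run_Seq: "run c s T s' \<Longrightarrow> run c' s' T' s'' \<Longrightarrow> run (c ;; c') s (T + T') s''"
  unfolding run_def by (meson add_le_mono exec.Seq)

lemma run_CondT: "rd s i \<in> A \<Longrightarrow> run c s T s' \<Longrightarrow> run (Cond i A c c') s (T + 2) s'"
  unfolding run_def by (meson add_le_mono exec.IfT order_refl)

lemma run_CondF: "rd s i \<notin> A \<Longrightarrow> run c' s T s' \<Longrightarrow> run (Cond i A c c') s (T + 2) s'"
  unfolding run_def by (meson add_le_mono exec.IfF one_le_numeral)

text \<open>\<open>S j\<close> is the state after j rounds. Each round pays 2 for the test and the
  jump back, and the final 1 is the failing test.\<close>

lemma run_While:
  assumes "\<And>j. j < m \<Longrightarrow> rd (S j) i \<in> A \<and> run c (S j) B (S (Suc j))" "rd (S m) i \<notin> A" "m \<le> M"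
  shows "run (While i A c) (S 0) (M * (B + 2) + 1) (S m)"
proof -
  have "run (While i A c) (S 0) (m * (B + 2) + 1) (S m)"
    using assms(1,2)
  proof (induction m arbitrary: S)
    case 0
    then show ?case
      unfolding run_def using exec.WhileF by fastforce
  next
    case (Suc m)
    have "run (While i A c) (S (Suc 0)) (m * (B + 2) + 1) (S (Suc m))"
      using Suc.IH[of "\<lambda>j. S (Suc j)"] Suc.prems by auto
    then obtain t' where t': "t' \<le> m * (B + 2) + 1" "exec (While i A c) (S (Suc 0)) t' (S (Suc m))"
      unfolding run_def by blast
    obtain t where t: "t \<le> B" "exec c (S 0) t (S (Suc 0))"
      using Suc.prems(1)[of 0] unfolding run_def by blast
    have "exec (While i A c) (S 0) (t + 2 + t') (S (Suc m))"
      using exec.WhileT t(2) t'(2) Suc.prems(1)[of 0] by blast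
    then show ?case
      unfolding run_def using t(1) t'(1) by (intro exI[of _ "t + 2 + t'"]) auto
  qed
  then show ?thesis
    by (rule run_mono) (use mult_le_mono1[OF assms(3), of "B + 2"] in simp)
qed


section \<open>Tape subroutines\<close>

text \<open>The initial step to the left allows the head to stand on the blank just behind the word;
  the loop stops on the blank cell -1.\<close>

definition rewind :: "nat \<Rightarrow> com" where
  "rewind i = Mv i Move_Left ;; While i (- {0}) (Mv i Move_Left) ;; Mv i Move_Right"

lemma run_rewind:
  assumes "s i = (f, int h)" "f (-1) = 0" "\<And>j. j < h \<Longrightarrow> f (int j) \<noteq> 0" "h \<le> M"
  shows "run (rewind i) s (3 * M + 3) (s(i := (f, 0)))"
proof -
  let ?S = "\<lambda>j. s(i := (f, int h - int j - 1))"
  have "run (Mv i Move_Left) s 1 (?S 0)"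
    by (rule run_Mv) (simp add: assms(1))
  moreover have "run (While i (- {0}) (Mv i Move_Left)) (?S 0) (M * (1 + 2) + 1) (?S h)"
  proof (rule run_While)
    fix j
    assume "j < h"
    then have "f (int h - int j - 1) \<noteq> 0"
      using assms(3)[of "h - j - 1"] by (simp add: of_nat_diff algebra_simps)
    moreover have "run (Mv i Move_Left) (?S j) 1 (?S (Suc j))"
      by (rule run_Mv) (simp add: algebra_simps)
    ultimately show "rd (?S j) i \<in> - {0} \<and> run (Mv i Move_Left) (?S j) 1 (?S (Suc j))"
      by simp
  qed (use assms in simp_all)
  moreover have "run (Mv i Move_Right) (?S h) 1 (s(i := (f, 0)))"
    by (rule run_Mv) simp
  ultimately have "run (rewind i) s (1 + ((M * (1 + 2) + 1) + 1)) (s(i := (f, 0)))"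
    unfolding rewind_def by (intro run_Seq)
  then show ?thesis
    by (rule run_mono) simp
qed

text \<open>The number \<open>n\<close> in unary. Such a tape serves as a counter up to
  \<open>n\<close>, and its head position can store any value below \<open>n\<close>.\<close>

definition marks :: "nat \<Rightarrow> int \<Rightarrow> nat" where
  "marks n = (\<lambda>i. if 0 \<le> i \<and> i < int n then 1 else 0)"

lemma marks_simps [simp]: "i < n \<Longrightarrow> marks n (int i) = 1" "marks n (int n) = 0" "marks n (-1) = 0"
  "marks (Suc n) (1 + int n) = 0"
  by (auto simp: marks_def)

definition advance :: "nat \<Rightarrow> nat \<Rightarrow> com" where
  "advance i j = While i {1} (Mv i Move_Right ;; Mv j Move_Right) ;; rewind i"

lemma run_advance:
  assumes "s i = (marks n, 0)" "s j = (f, h)" "i \<noteq> j" "n \<le> M"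
  shows "run (advance i j) s (7 * M + 4) (s(j := (f, h + int n)))"
proof -
  let ?S = "\<lambda>k. s(i := (marks n, int k), j := (f, h + int k))"
  have "run (While i {1} (Mv i Move_Right ;; Mv j Move_Right)) (?S 0) (M * ((1 + 1) + 2) + 1) (?S n)"
  proof (rule run_While)
    fix k
    assume "k < n"
    have "run (Mv i Move_Right ;; Mv j Move_Right) (?S k) (1 + 1) (?S (Suc k))"
    proof (rule run_Seq)
      show "run (Mv i Move_Right) (?S k) 1 (s(i := (marks n, int (Suc k)), j := (f, h + int k)))"
        by (rule run_Mv) (use \<open>i \<noteq> j\<close> in \<open>auto simp: fun_eq_iff\<close>)
      show "run (Mv j Move_Right) (s(i := (marks n, int (Suc k)), j := (f, h + int k))) 1 (?S (Suc k))"
        by (rule run_Mv) (use \<open>i \<noteq> j\<close> in \<open>auto simp: fun_eq_iff\<close>)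
    qed
    then show "rd (?S k) i \<in> {1} \<and> run (Mv i Move_Right ;; Mv j Move_Right) (?S k) (1 + 1) (?S (Suc k))"
      using \<open>k < n\<close> \<open>i \<noteq> j\<close> by simp
  qed (use assms in simp_all)
  moreover have "run (rewind i) (?S n) (3 * M + 3) ((?S n)(i := (marks n, 0)))"
    by (rule run_rewind) (use \<open>i \<noteq> j\<close> \<open>n \<le> M\<close> in simp_all)
  moreover have "?S 0 = s" "(?S n)(i := (marks n, 0)) = s(j := (f, h + int n))"
    using assms by (auto simp: fun_eq_iff)
  ultimately have "run (advance i j) s ((M * ((1 + 1) + 2) + 1) + (3 * M + 3)) (s(j := (f, h + int n)))"
    unfolding advance_def using run_Seq by metis
  then show ?thesis
    by (rule run_mono) simp
qed


text \<open>While \<open>c\<close> is running, a mark 2 remembers the number of repetitions, which is the initial head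
  position of tape \<open>i\<close>.\<close>

definition repeat :: "nat \<Rightarrow> com \<Rightarrow> com" where
  "repeat i c = Wr i 2 ;; rewind i ;; While i {1} (c ;; Mv i Move_Right) ;; Wr i 1"

text \<open>\<open>R k\<close> is the state after k rounds. The body is required to work for every
  content \<open>f\<close> of tape \<open>i\<close>, since the temporary mark 2 stands there while
  it runs.\<close>

lemma run_repeat:
  assumes "s i = (marks n, int a)" "a < n" "n \<le> M" "R 0 = s" "\<And>k. R k i = s i"
    and "\<And>k f. k < a \<Longrightarrow> run c ((R k)(i := (f, int k))) B ((R (Suc k))(i := (f, int k)))"
  shows "run (repeat i c) s (M * (B + 6) + 6) (R a)"
proof -
  let ?f = "(marks n)(int a := 2)"
  let ?S = "\<lambda>k. (R k)(i := (?f, int k))"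
  have "run (Wr i 2) s 1 (s(i := (?f, int a)))"
    by (rule run_Wr) (simp add: assms(1))
  moreover have "run (rewind i) (s(i := (?f, int a))) (3 * M + 3) ((s(i := (?f, int a)))(i := (?f, 0)))"
    by (rule run_rewind[where h = a]) (use assms(2,3) in auto)
  moreover have "(s(i := (?f, int a)))(i := (?f, 0)) = ?S 0"
    by (simp add: assms(4))
  moreover have "run (While i {1} (c ;; Mv i Move_Right)) (?S 0) (M * ((B + 1) + 2) + 1) (?S a)"
  proof (rule run_While)
    fix k
    assume "k < a"
    have "run (c ;; Mv i Move_Right) (?S k) (B + 1) (?S (Suc k))"
    proof (rule run_Seq)
      show "run c (?S k) B ((R (Suc k))(i := (?f, int k)))"
        using assms(6) \<open>k < a\<close> by blast
      show "run (Mv i Move_Right) ((R (Suc k))(i := (?f, int k))) 1 (?S (Suc k))"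
        by (rule run_Mv) (simp add: add.commute)
    qed
    then show "rd (?S k) i \<in> {1} \<and> run (c ;; Mv i Move_Right) (?S k) (B + 1) (?S (Suc k))"
      using \<open>k < a\<close> \<open>a < n\<close> by simp
  qed (use assms(2,3) in simp_all)
  moreover have "run (Wr i 1) (?S a) 1 (R a)"
  proof (rule run_Wr)
    have "?f(int a := 1) = marks n"
      using \<open>a < n\<close> by (auto simp: fun_eq_iff)
    then have "(R a)(i := (?f(int a := 1), int a)) = R a"
      using assms(1) assms(5)[of a] by (metis fun_upd_triv)
    then show "R a = (?S a)(i := ((fst (?S a i))(snd (?S a i) := 1), snd (?S a i)))"
      by simp
  qed
  ultimately have "run (repeat i c) s (1 + ((3 * M + 3) + ((M * ((B + 1) + 2) + 1) + 1))) (R a)"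
    unfolding repeat_def by (metis run_Seq)
  then show ?thesis
    by (rule run_mono) (simp add: algebra_simps)
qed


section \<open>Evaluating formulas\<close>

text \<open>Tape 0 holds the matrix, tape 1 the truth value, tape 2 a unary copy of
  \<open>n\<close>, and tape 3 + i the variable i. For \<open>Adj\<close> the input head moves to
  cell a * n + b, where a and b are the values of the variables. For \<open>Equ\<close> the first
  value is left as a mark 2 on tape 2, looked up with the second value, and erased again. For
  \<open>Exi\<close> the head of the variable sweeps over all positions, and the body is skipped
  once the result is true.\<close>

primrec eval_fo :: "fo \<Rightarrow> com" where
  "eval_fo (Adj i j) =
    repeat (3 + i) (advance 2 0) ;; repeat (3 + j) (Mv 0 Move_Right) ;;
    Cond 0 {2} (Wr 1 2) (Wr 1 1) ;; rewind 0"
| "eval_fo (Equ i j) =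
    (repeat (3 + i) (Mv 2 Move_Right) ;; Wr 2 2 ;; rewind 2) ;;
    repeat (3 + j) (Mv 2 Move_Right) ;; Cond 2 {2} (Wr 1 2) (Wr 1 1) ;; rewind 2 ;;
    repeat (3 + i) (Mv 2 Move_Right) ;; Wr 2 1 ;; rewind 2"
| "eval_fo (Neg \<phi>) = eval_fo \<phi> ;; Cond 1 {2} (Wr 1 1) (Wr 1 2)"
| "eval_fo (Cnj \<phi> \<psi>) = eval_fo \<phi> ;; Cond 1 {2} (eval_fo \<psi>) (Wr 1 1)"
| "eval_fo (Exi k \<phi>) =
    Wr 1 1 ;; While (3 + k) {1} (Cond 1 {2} (Wr 1 2) (eval_fo \<phi>) ;; Mv (3 + k) Move_Right) ;;
    rewind (3 + k)"

text \<open>The sums are bracketed as \<open>run_Seq\<close> and the conditional rules produce them,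
  so that the bounds match syntactically.\<close>

primrec time_fo :: "nat \<Rightarrow> fo \<Rightarrow> nat" where
  "time_fo n (Adj i j) = (n * ((7 * n + 4) + 6) + 6) + ((n * (1 + 6) + 6) + ((1 + 2) + (3 * (n * n) + 3)))"
| "time_fo n (Equ i j) = ((n * (1 + 6) + 6) + (1 + (3 * n + 3))) + ((n * (1 + 6) + 6) +
    ((1 + 2) + ((3 * n + 3) + ((n * (1 + 6) + 6) + (1 + (3 * n + 3))))))"
| "time_fo n (Neg \<phi>) = time_fo n \<phi> + (1 + 2)"
| "time_fo n (Cnj \<phi> \<psi>) = time_fo n \<phi> + ((time_fo n \<psi> + 1) + 2)"
| "time_fo n (Exi k \<phi>) = 1 + ((n * ((((time_fo n \<phi> + 1) + 2) + 1) + 2) + 1) + (3 * n + 3))"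

definition set_result :: "bool \<Rightarrow> state \<Rightarrow> state" where
  "set_result b s = s(1 := ((fst (s 1))(snd (s 1) := if b then 2 else 1), snd (s 1)))"

lemma set_result_simps [simp]:
  "i \<noteq> 1 \<Longrightarrow> set_result b s i = s i"
  "set_result b (set_result b' s) = set_result b s"
  "rd (set_result b s) (Suc 0) = (if b then 2 else 1)"
  "i \<noteq> 1 \<Longrightarrow> (set_result b s)(i := t) = set_result b (s(i := t))"
  by (auto simp: set_result_def fun_eq_iff)

lemma run_set_result: "x = (if b then 2 else 1) \<Longrightarrow> run (Wr 1 x) s 1 (set_result b s)"
  by (rule run_Wr) (simp add: set_result_def)

definition represents :: "bool list \<Rightarrow> nat \<Rightarrow> nat \<Rightarrow> (nat \<Rightarrow> nat) \<Rightarrow> state \<Rightarrow> bool" where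
  "represents x n d \<sigma> s \<longleftrightarrow> s 0 = input_tape x \<and> s 2 = (marks n, 0) \<and>
     (\<forall>i<d. s (3 + i) = (marks n, int (\<sigma> i)) \<and> \<sigma> i < n)"

definition matrix :: "bool list \<Rightarrow> nat \<Rightarrow> nat \<Rightarrow> nat \<Rightarrow> bool" where
  "matrix x n i j \<longleftrightarrow> x ! (i * n + j)"

lemma fst_input_tape [simp]:
  "k < length x \<Longrightarrow> fst (input_tape x) (int k) = (if x ! k then 2 else 1)"
  "int (length x) \<le> p \<Longrightarrow> fst (input_tape x) p = 0"
  "fst (input_tape x) (-1) = 0"
  and snd_input_tape [simp]: "snd (input_tape x) = 0"
  by (auto simp: input_tape_def)

lemma run_eval_Adj:
  assumes "represents x n d \<sigma> s" "length x = n * n" "i < d" "j < d"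
  shows "run (eval_fo (Adj i j)) s (time_fo n (Adj i j)) (set_result (matrix x n (\<sigma> i) (\<sigma> j)) s)"
proof -
  let ?f = "fst (input_tape x)"
  let ?S = "\<lambda>h::nat. s(0 := (?f, int h))"
  note s = assms(1)[unfolded represents_def]
  have s0: "s 0 = (?f, 0)"
    using s by (metis prod.collapse snd_input_tape)
  have si: "s (3 + i) = (marks n, int (\<sigma> i))" "\<sigma> i < n"
    and sj: "s (3 + j) = (marks n, int (\<sigma> j))" "\<sigma> j < n"
    using s assms(3,4) by auto
  let ?h = "\<sigma> i * n + \<sigma> j"
  have "\<sigma> i * n + \<sigma> j < (\<sigma> i + 1) * n"
    using sj(2) by simp
  also have "\<dots> \<le> n * n"
    using si(2) by (intro mult_le_mono1) simp
  finally have h: "?h < n * n" .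
  have "run (repeat (3 + i) (advance 2 0)) s (n * ((7 * n + 4) + 6) + 6) (?S (\<sigma> i * n))"
  proof (rule run_repeat[where R = "\<lambda>k. ?S (k * n)"])
    fix k f
    have "((?S (k * n))(3 + i := (f, int k)))(0 := (?f, int (k * n) + int n)) =
        (?S (Suc k * n))(3 + i := (f, int k))"
      by (rule ext) (simp add: add.commute)
    moreover have "run (advance 2 0) ((?S (k * n))(3 + i := (f, int k))) (7 * n + 4)
      (((?S (k * n))(3 + i := (f, int k)))(0 := (?f, int (k * n) + int n)))"
      by (rule run_advance) (use s in auto)
    ultimately show "run (advance 2 0) ((?S (k * n))(3 + i := (f, int k))) (7 * n + 4)
        ((?S (Suc k * n))(3 + i := (f, int k)))"
      by metis
  qed (use s0 si in \<open>auto simp: fun_eq_iff\<close>)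
  moreover have "run (repeat (3 + j) (Mv 0 Move_Right)) (?S (\<sigma> i * n)) (n * (1 + 6) + 6) (?S ?h)"
  proof (rule run_repeat[where R = "\<lambda>k. ?S (\<sigma> i * n + k)"])
    show "run (Mv 0 Move_Right) ((?S (\<sigma> i * n + k))(3 + j := (f, int k))) 1
        ((?S (\<sigma> i * n + Suc k))(3 + j := (f, int k)))" for k f
      by (rule run_Mv) (auto simp: fun_eq_iff)
  qed (use sj in auto)
  moreover have rd: "rd (?S ?h) 0 = (if x ! ?h then 2 else 1)"
    using fst_input_tape(1)[of ?h x] h assms(2) by simp
  moreover have "run (Cond 0 {2} (Wr 1 2) (Wr 1 1)) (?S ?h) (1 + 2)
      (set_result (matrix x n (\<sigma> i) (\<sigma> j)) (?S ?h))"
  proof (cases "x ! ?h")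
    case True
    show ?thesis
      by (intro run_CondT run_set_result; simp only: rd True matrix_def; simp)
  next
    case False
    show ?thesis
      by (intro run_CondF run_set_result; simp only: rd False matrix_def; simp)
  qed
  moreover have "run (rewind 0) (set_result (matrix x n (\<sigma> i) (\<sigma> j)) (?S ?h)) (3 * (n * n) + 3)
      ((set_result (matrix x n (\<sigma> i) (\<sigma> j)) (?S ?h))(0 := (?f, 0)))"
    by (rule run_rewind[where h = ?h]) (use h assms(2) in auto)
  moreover have eq: "(set_result (matrix x n (\<sigma> i) (\<sigma> j)) (?S ?h))(0 := (?f, 0)) =
      set_result (matrix x n (\<sigma> i) (\<sigma> j)) s"
    using s0 by (simp add: fun_upd_idem)
  ultimately have "run (eval_fo (Adj i j)) s (time_fo n (Adj i j))
      ((set_result (matrix x n (\<sigma> i) (\<sigma> j)) (?S ?h))(0 := (?f, 0)))"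
    unfolding eval_fo.simps time_fo.simps by (intro run_Seq)
  then show ?thesis
    using eq by (simp only:)
qed

lemma run_eval_Equ:
  assumes "represents x n d \<sigma> s" "i < d" "j < d"
  shows "run (eval_fo (Equ i j)) s (time_fo n (Equ i j)) (set_result (\<sigma> i = \<sigma> j) s)"
proof -
  note s = assms(1)[unfolded represents_def]
  have s2: "s 2 = (marks n, 0)"
    using s by auto
  have si: "s (3 + i) = (marks n, int (\<sigma> i))" "\<sigma> i < n"
    and sj: "s (3 + j) = (marks n, int (\<sigma> j))" "\<sigma> j < n"
    using s assms(2,3) by auto
  have step: "run (repeat (3 + l) (Mv 2 Move_Right)) (s'(2 := (f, 0))) (n * (1 + 6) + 6) (s'(2 := (f, int (\<sigma> l))))"
    if "s' (3 + l) = (marks n, int (\<sigma> l))" "\<sigma> l < n" for l f s'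
  proof -
    have "run (repeat (3 + l) (Mv 2 Move_Right)) (s'(2 := (f, 0))) (n * (1 + 6) + 6)
        ((\<lambda>k. s'(2 := (f, int k))) (\<sigma> l))"
    proof (rule run_repeat)
      show "run (Mv 2 Move_Right) ((s'(2 := (f, int k)))(3 + l := (g, int k))) 1
          ((s'(2 := (f, int (Suc k))))(3 + l := (g, int k)))" for k g
        by (rule run_Mv) (auto simp: fun_eq_iff)
    qed (use that in auto)
    then show ?thesis .
  qed
  let ?f = "(marks n)(int (\<sigma> i) := 2)"
  let ?R = "set_result (\<sigma> i = \<sigma> j)"
  have "run (repeat (3 + i) (Mv 2 Move_Right)) s (n * (1 + 6) + 6) (s(2 := (marks n, int (\<sigma> i))))"
    using step[of s i "marks n"] si s2 by (simp add: fun_upd_idem)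
  moreover have "run (Wr 2 2) (s(2 := (marks n, int (\<sigma> i)))) 1 (s(2 := (?f, int (\<sigma> i))))"
    by (rule run_Wr) simp
  moreover have "run (rewind 2) (s(2 := (?f, int (\<sigma> i)))) (3 * n + 3) ((s(2 := (?f, int (\<sigma> i))))(2 := (?f, 0)))"
    by (rule run_rewind[where h = "\<sigma> i"]) (use si in auto)
  ultimately have "run (repeat (3 + i) (Mv 2 Move_Right) ;; Wr 2 2 ;; rewind 2) s
      ((n * (1 + 6) + 6) + (1 + (3 * n + 3))) ((s(2 := (?f, int (\<sigma> i))))(2 := (?f, 0)))"
    by (intro run_Seq)
  then have 1: "run (repeat (3 + i) (Mv 2 Move_Right) ;; Wr 2 2 ;; rewind 2) s
      ((n * (1 + 6) + 6) + (1 + (3 * n + 3))) (s(2 := (?f, 0)))"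
    by simp
  have 2: "run (repeat (3 + j) (Mv 2 Move_Right)) (s(2 := (?f, 0))) (n * (1 + 6) + 6) (s(2 := (?f, int (\<sigma> j))))"
    using step sj by blast
  have 3: "run (Cond 2 {2} (Wr 1 2) (Wr 1 1)) (s(2 := (?f, int (\<sigma> j)))) (1 + 2) (?R (s(2 := (?f, int (\<sigma> j)))))"
  proof (cases "\<sigma> i = \<sigma> j")
    case True
    then show ?thesis
      by (intro run_CondT run_set_result) auto
  next
    case False
    then show ?thesis
      using sj by (intro run_CondF run_set_result) auto
  qed
  have 4: "run (rewind 2) (?R (s(2 := (?f, int (\<sigma> j))))) (3 * n + 3) ((?R (s(2 := (?f, int (\<sigma> j)))))(2 := (?f, 0)))"
    by (rule run_rewind[where h = "\<sigma> j"]) (use sj in auto)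
  have 5: "run (repeat (3 + i) (Mv 2 Move_Right)) ((?R s)(2 := (?f, 0))) (n * (1 + 6) + 6) ((?R s)(2 := (?f, int (\<sigma> i))))"
    by (rule step) (use si in auto)
  have 6: "run (Wr 2 1) ((?R s)(2 := (?f, int (\<sigma> i)))) 1 ((?R s)(2 := (marks n, int (\<sigma> i))))"
  proof (rule run_Wr)
    have "?f(int (\<sigma> i) := 1) = marks n"
      using si(2) by (auto simp: fun_eq_iff)
    then show "(?R s)(2 := (marks n, int (\<sigma> i))) = ((?R s)(2 := (?f, int (\<sigma> i))))
        (2 := ((fst (((?R s)(2 := (?f, int (\<sigma> i)))) 2))(snd (((?R s)(2 := (?f, int (\<sigma> i)))) 2) := 1),
          snd (((?R s)(2 := (?f, int (\<sigma> i)))) 2)))"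
      by simp
  qed
  have 7: "run (rewind 2) ((?R s)(2 := (marks n, int (\<sigma> i)))) (3 * n + 3)
      (((?R s)(2 := (marks n, int (\<sigma> i))))(2 := (marks n, 0)))"
    by (rule run_rewind[where h = "\<sigma> i"]) (use si in auto)
  have eq: "(?R (s(2 := (?f, int (\<sigma> j)))))(2 := (?f, 0)) = (?R s)(2 := (?f, 0))"
    "((?R s)(2 := (marks n, int (\<sigma> i))))(2 := (marks n, 0)) = ?R s"
    using s2 by (simp_all add: fun_upd_idem)
  show ?thesis
    unfolding eval_fo.simps time_fo.simps
    by (intro run_Seq[OF 1] run_Seq[OF 2] run_Seq[OF 3] run_Seq[OF 4[unfolded eq]]
      run_Seq[OF 5] run_Seq[OF 6] 7[unfolded eq])
qed

lemma represents_set_result [simp]: "represents x n d \<sigma> (set_result b s) = represents x n d \<sigma> s"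
  by (simp add: represents_def)

text \<open>Bound variables must be 0 at the start because the loop for a quantifier sweeps from the
  current head position. Rewinding restores 0 afterwards, so the hypothesis survives repeated
  evaluation.\<close>

lemma run_eval_fo:
  assumes "represents x n d \<sigma> s" "length x = n * n" "wf_fo d \<phi>" "\<And>k. k \<in> bvars \<phi> \<Longrightarrow> \<sigma> k = 0"
  shows "run (eval_fo \<phi>) s (time_fo n \<phi>) (set_result (sat (matrix x n) n \<sigma> \<phi>) s)"
  using assms(1,3,4)
proof (induction \<phi> arbitrary: \<sigma> s)
  case (Adj i j)
  then show ?case
    using run_eval_Adj[OF Adj.prems(1) assms(2)] by simp
next
  case (Equ i j)
  then show ?case
    using run_eval_Equ[OF Equ.prems(1)] by simp
next
  case (Neg \<phi>)
  let ?b = "sat (matrix x n) n \<sigma> \<phi>"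
  have "run (Cond 1 {2} (Wr 1 1) (Wr 1 2)) (set_result ?b s) (1 + 2) (set_result (\<not> ?b) (set_result ?b s))"
  proof (cases ?b)
    case True
    then show ?thesis
      by (intro run_CondT run_set_result) auto
  next
    case False
    then show ?thesis
      by (intro run_CondF run_set_result) auto
  qed
  moreover have "run (eval_fo \<phi>) s (time_fo n \<phi>) (set_result ?b s)"
    using Neg by simp
  ultimately show ?case
    unfolding eval_fo.simps time_fo.simps sat.simps using run_Seq by fastforce
next
  case (Cnj \<phi> \<psi>)
  let ?b = "sat (matrix x n) n \<sigma> \<phi>" and ?c = "sat (matrix x n) n \<sigma> \<psi>"
  have c: "run (eval_fo \<psi>) (set_result ?b s) (time_fo n \<psi>) (set_result ?c (set_result ?b s))"
    using Cnj.IH(2)[of \<sigma> "set_result ?b s"] Cnj.prems by simp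
  have "run (Cond 1 {2} (eval_fo \<psi>) (Wr 1 1)) (set_result ?b s) ((time_fo n \<psi> + 1) + 2)
    (set_result (?b \<and> ?c) (set_result ?b s))"
  proof (cases ?b)
    case True
    then show ?thesis
      using c by (intro run_CondT) (auto intro: run_mono)
  next
    case False
    then show ?thesis
      using run_mono[OF run_set_result[of 1 False "set_result False s"], of "time_fo n \<psi> + 1"]
      by (intro run_CondF) auto
  qed
  moreover have "run (eval_fo \<phi>) s (time_fo n \<phi>) (set_result ?b s)"
    using Cnj by simp
  ultimately show ?case
    unfolding eval_fo.simps time_fo.simps sat.simps using run_Seq by fastforce
next
  case (Exi k \<phi>)
  let ?t = "3 + k"
  let ?b = "\<lambda>v. \<exists>w<v. sat (matrix x n) n (\<sigma>(k := w)) \<phi>"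
  let ?S = "\<lambda>v. set_result (?b v) (s(?t := (marks n, int v)))"
  have k: "k < d" "k \<notin> bvars \<phi>" "wf_fo d \<phi>" "\<sigma> k = 0"
    using Exi.prems by auto
  then have st: "s ?t = (marks n, 0)"
    using Exi.prems(1) by (auto simp: represents_def)
  let ?c = "Cond 1 {2} (Wr 1 2) (eval_fo \<phi>)"
  have "run (Wr 1 1) s 1 (?S 0)"
    using st run_set_result[of 1 False s] by (simp add: fun_upd_idem)
  moreover have "run (While ?t {1} (?c ;; Mv ?t Move_Right)) (?S 0)
      (n * ((((time_fo n \<phi> + 1) + 2) + 1) + 2) + 1) (?S n)"
  proof (rule run_While)
    fix v
    assume "v < n"
    have IH: "run (eval_fo \<phi>) (?S v) (time_fo n \<phi>)
        (set_result (sat (matrix x n) n (\<sigma>(k := v)) \<phi>) (?S v))"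
    proof (rule Exi.IH)
      show "represents x n d (\<sigma>(k := v)) (?S v)"
        using Exi.prems(1) \<open>v < n\<close> by (auto simp: represents_def)
    qed (use k Exi.prems in auto)
    have "run ?c (?S v) ((time_fo n \<phi> + 1) + 2) (set_result (?b (Suc v)) (?S v))"
    proof (cases "?b v")
      case True
      then have "?b (Suc v)"
        using less_Suc_eq by blast
      moreover have "run (Wr 1 2) (?S v) (time_fo n \<phi> + 1) (set_result True (?S v))"
        by (rule run_mono[OF run_set_result]) simp_all
      ultimately show ?thesis
        using True by (intro run_CondT) simp_all
    next
      case False
      then have "?b (Suc v) = sat (matrix x n) n (\<sigma>(k := v)) \<phi>"
        using less_Suc_eq by auto
      then show ?thesis
        using False IH by (intro run_CondF) (auto intro: run_mono)
    qed
    moreover have "run (Mv ?t Move_Right) (set_result (?b (Suc v)) (?S v)) 1 (?S (Suc v))"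
      by (rule run_Mv) (simp add: algebra_simps)
    ultimately have "run (?c ;; Mv ?t Move_Right) (?S v) (((time_fo n \<phi> + 1) + 2) + 1) (?S (Suc v))"
      by (rule run_Seq)
    then show "rd (?S v) ?t \<in> {1} \<and>
        run (?c ;; Mv ?t Move_Right) (?S v) (((time_fo n \<phi> + 1) + 2) + 1) (?S (Suc v))"
      using \<open>v < n\<close> by simp
  qed simp_all
  moreover have "run (rewind ?t) (?S n) (3 * n + 3) ((?S n)(?t := (marks n, 0)))"
    by (rule run_rewind[where h = n]) auto
  ultimately have "run (eval_fo (Exi k \<phi>)) s (time_fo n (Exi k \<phi>)) ((?S n)(?t := (marks n, 0)))"
    unfolding eval_fo.simps time_fo.simps by (intro run_Seq)
  moreover have "(?S n)(?t := (marks n, 0)) = set_result (sat (matrix x n) n \<sigma> (Exi k \<phi>)) s"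
    using st by (simp add: fun_upd_idem)
  ultimately show ?case
    by (simp only:)
qed


section \<open>Recovering the number of vertices\<close>

definition append_mark :: "nat \<Rightarrow> com" where
  "append_mark i = While i {1} (Mv i Move_Right) ;; Wr i 1 ;; rewind i"

lemma run_append_mark:
  assumes "s i = (marks m, 0)" "m \<le> M"
  shows "run (append_mark i) s (6 * M + 5) (s(i := (marks (Suc m), 0)))"
proof -
  let ?S = "\<lambda>k. s(i := (marks m, int k))"
  have "run (While i {1} (Mv i Move_Right)) (?S 0) (M * (1 + 2) + 1) (?S m)"
  proof (rule run_While)
    fix k
    assume "k < m"
    moreover have "run (Mv i Move_Right) (?S k) 1 (?S (Suc k))"
      by (rule run_Mv) (simp add: add.commute)
    ultimately show "rd (?S k) i \<in> {1} \<and> run (Mv i Move_Right) (?S k) 1 (?S (Suc k))"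
      by simp
  qed (use assms in simp_all)
  moreover have "?S 0 = s"
    using assms(1) by (simp add: fun_upd_idem)
  moreover have "run (Wr i 1) (?S m) 1 (s(i := (marks (Suc m), int m)))"
  proof (rule run_Wr)
    have "(marks m)(int m := 1) = marks (Suc m)"
      by (auto simp: fun_eq_iff marks_def)
    then show "s(i := (marks (Suc m), int m)) =
        (?S m)(i := ((fst (?S m i))(snd (?S m i) := 1), snd (?S m i)))"
      by simp
  qed
  moreover have "run (rewind i) (s(i := (marks (Suc m), int m))) (3 * M + 3)
      ((s(i := (marks (Suc m), int m)))(i := (marks (Suc m), 0)))"
    by (rule run_rewind[where h = m]) (use assms(2) in simp_all)
  ultimately have "run (append_mark i) s ((M * (1 + 2) + 1) + (1 + (3 * M + 3)))
      ((s(i := (marks (Suc m), int m)))(i := (marks (Suc m), 0)))"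
    unfolding append_mark_def by (simp only: run_Seq)
  then show ?thesis
    by (simp add: run_mono)
qed

primrec append_marks :: "nat \<Rightarrow> com" where
  "append_marks 0 = append_mark 2"
| "append_marks (Suc d) = append_marks d ;; append_mark (3 + d)"

definition marked :: "bool list \<Rightarrow> nat \<Rightarrow> nat \<Rightarrow> nat \<Rightarrow> state" where
  "marked x d m h = (\<lambda>i. if i = 0 then (fst (input_tape x), int h)
     else if 2 \<le> i \<and> i < 3 + d then (marks m, 0) else input_tape [])"

lemma run_append_marks:
  assumes "\<And>i. 2 \<le> i \<Longrightarrow> i < 3 + d \<Longrightarrow> s i = (marks m, 0)" "m \<le> M"
  shows "run (append_marks d) s (Suc d * (6 * M + 5))
    (\<lambda>i. if 2 \<le> i \<and> i < 3 + d then (marks (Suc m), 0) else s i)"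
  using assms(1)
proof (induction d)
  case 0
  have "(\<lambda>i. if 2 \<le> i \<and> i < 3 + 0 then (marks (Suc m), 0) else s i) = s(2 := (marks (Suc m), 0))"
    by (auto simp: fun_eq_iff)
  moreover have "run (append_mark 2) s (6 * M + 5) (s(2 := (marks (Suc m), 0)))"
    using 0 assms(2) by (intro run_append_mark) simp_all
  ultimately show ?case
    by simp
next
  case (Suc d)
  let ?S = "\<lambda>d i. if 2 \<le> i \<and> i < 3 + d then (marks (Suc m), 0) else s i"
  have "run (append_marks d) s (Suc d * (6 * M + 5)) (?S d)"
    using Suc by simp
  moreover have "run (append_mark (3 + d)) (?S d) (6 * M + 5) ((?S d)(3 + d := (marks (Suc m), 0)))"
    by (rule run_append_mark) (use Suc.prems assms(2) in auto)
  moreover have "(?S d)(3 + d := (marks (Suc m), 0)) = ?S (Suc d)"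
    by (auto simp: fun_eq_iff)
  ultimately have "run (append_marks (Suc d)) s (Suc d * (6 * M + 5) + (6 * M + 5)) (?S (Suc d))"
    unfolding append_marks.simps by (simp only: run_Seq)
  moreover have "Suc d * (6 * M + 5) + (6 * M + 5) = Suc (Suc d) * (6 * M + 5)"
    by simp
  ultimately show ?case
    by (simp only:)
qed

text \<open>A round increments \<open>m\<close>, the number of marks, and then advances the input head \<open>m\<close> times by \<open>m\<close>
  from cell 0. Rounds are repeated until the head reaches a blank; the input has square length iff
  this is the first blank.\<close>

definition square_round :: "nat \<Rightarrow> com" where
  "square_round d = append_marks d ;; rewind 0 ;;
     While 3 {1} (advance 2 0 ;; Mv 3 Move_Right) ;; rewind 3"

text \<open>Tape 3, the tape of variable 0, also counts the m + 1 repetitions, which is where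
  \<open>0 < d\<close> enters. During the round all counters hold m + 1, hence the bounds in M +
  1.\<close>

lemma run_square_round:
  assumes "m * m < length x" "0 < d" "m \<le> M" "M = length x"
  shows "run (square_round d) (marked x d m (m * m))
    (Suc d * (6 * M + 5) + (3 * M + 3) + ((M + 1) * (7 * (M + 1) + 7) + 1) + (3 * (M + 1) + 3))
    (marked x d (Suc m) (Suc m * Suc m))"
proof -
  let ?s = "\<lambda>h. marked x d (Suc m) h"
  let ?S = "\<lambda>k. (?s (k * Suc m))(3 := (marks (Suc m), int k))"
  have "(\<lambda>i. if 2 \<le> i \<and> i < 3 + d then (marks (Suc m), 0) else marked x d m (m * m) i) = ?s (m * m)"
    by (auto simp: marked_def fun_eq_iff)
  moreover have "run (append_marks d) (marked x d m (m * m)) (Suc d * (6 * M + 5))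
    (\<lambda>i. if 2 \<le> i \<and> i < 3 + d then (marks (Suc m), 0) else marked x d m (m * m) i)"
    by (rule run_append_marks) (use assms(3) in \<open>auto simp: marked_def\<close>)
  ultimately have 1: "run (append_marks d) (marked x d m (m * m)) (Suc d * (6 * M + 5)) (?s (m * m))"
    by simp
  have "run (rewind 0) (?s (m * m)) (3 * M + 3) ((?s (m * m))(0 := (fst (input_tape x), 0)))"
    by (rule run_rewind[where h = "m * m"]) (use assms in \<open>auto simp: marked_def\<close>)
  moreover have "(?s (m * m))(0 := (fst (input_tape x), 0)) = ?S 0"
    using \<open>0 < d\<close> by (auto simp: marked_def fun_eq_iff)
  ultimately have 2: "run (rewind 0) (?s (m * m)) (3 * M + 3) (?S 0)"
    by simp
  have 3: "run (While 3 {1} (advance 2 0 ;; Mv 3 Move_Right)) (?S 0)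
    ((M + 1) * (((7 * (M + 1) + 4) + 1) + 2) + 1) (?S (Suc m))"
  proof (rule run_While[where S = ?S])
    fix k
    assume k: "k < Suc m"
    have "run (advance 2 0) (?S k) (7 * (M + 1) + 4)
        ((?S k)(0 := (fst (input_tape x), int (k * Suc m) + int (Suc m))))"
      by (rule run_advance) (use assms(3) in \<open>auto simp: marked_def\<close>)
    moreover have "run (Mv 3 Move_Right)
        ((?S k)(0 := (fst (input_tape x), int (k * Suc m) + int (Suc m)))) 1 (?S (Suc k))"
      by (rule run_Mv) (rule ext, simp add: marked_def algebra_simps)
    ultimately have "run (advance 2 0 ;; Mv 3 Move_Right) (?S k) ((7 * (M + 1) + 4) + 1) (?S (Suc k))"
      by (rule run_Seq)
    then show "rd (?S k) 3 \<in> {1} \<and>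
        run (advance 2 0 ;; Mv 3 Move_Right) (?S k) ((7 * (M + 1) + 4) + 1) (?S (Suc k))"
      using k by simp
  qed (use assms(3) in simp_all)
  have "run (rewind 3) (?S (Suc m)) (3 * (M + 1) + 3) ((?S (Suc m))(3 := (marks (Suc m), 0)))"
    by (rule run_rewind[where h = "Suc m"]) (use assms(3) in simp_all)
  moreover have "(?S (Suc m))(3 := (marks (Suc m), 0)) = ?s (Suc m * Suc m)"
    using \<open>0 < d\<close> by (auto simp: marked_def fun_eq_iff)
  ultimately have 4: "run (rewind 3) (?S (Suc m)) (3 * (M + 1) + 3) (?s (Suc m * Suc m))"
    by simp
  show ?thesis
    unfolding square_round_def
    by (rule run_mono[OF run_Seq[OF 1 run_Seq[OF 2 run_Seq[OF 3 4]]]]) (simp add: algebra_simps)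
qed

text \<open>After the loop the head is on cell m * m, where m is the least number whose square is at
  least the length. The cell to its left is blank exactly if the length is not a positive square;
  for the empty input this is cell -1.\<close>

definition decider :: "nat \<Rightarrow> fo \<Rightarrow> com" where
  "decider d \<phi> = While 0 (- {0}) (square_round d) ;; Mv 0 Move_Left ;;
     Cond 0 {0} (Wr 1 1) (Mv 0 Move_Right ;; rewind 0 ;; eval_fo \<phi>)"

definition time_decider :: "nat \<Rightarrow> fo \<Rightarrow> nat \<Rightarrow> nat" where
  "time_decider d \<phi> M = (M * ((Suc d * (6 * M + 5) + (3 * M + 3) +
     ((M + 1) * (7 * (M + 1) + 7) + 1) + (3 * (M + 1) + 3)) + 2) + 1) +
     (1 + ((1 + (3 * M + 3) + time_fo M \<phi>) + 2))"

lemma time_fo_mono: "m \<le> n \<Longrightarrow> time_fo m \<phi> \<le> time_fo n \<phi>"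
  by (induction \<phi>) (auto intro!: add_mono mult_mono)

definition adjacency_language :: "((nat \<Rightarrow> nat \<Rightarrow> bool) \<Rightarrow> nat \<Rightarrow> bool) \<Rightarrow> bool list set" where
  "adjacency_language P = {x. \<exists>n>0. length x = n * n \<and> P (matrix x n) n}"

lemma run_decider:
  assumes "wf_fo d \<phi>" "0 < d"
  obtains s where "run (decider d \<phi>) (init_state x) (time_decider d \<phi> (length x)) s"
    "rd s 1 = 2 \<longleftrightarrow> x \<in> adjacency_language (\<lambda>E n. sat E n (\<lambda>_. 0) \<phi>)"
proof -
  let ?M = "length x"
  let ?B = "Suc d * (6 * ?M + 5) + (3 * ?M + 3) +
     ((?M + 1) * (7 * (?M + 1) + 7) + 1) + (3 * (?M + 1) + 3)"
  define m where "m = (LEAST m. ?M \<le> m * m)"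
  have "?M \<le> ?M * ?M"
    by (cases ?M) auto
  then have m: "?M \<le> m * m" "m \<le> ?M"
    unfolding m_def by (rule LeastI, rule Least_le)
  have less: "j * j < ?M" if "j < m" for j
    using that not_less_Least unfolding m_def by fastforce
  let ?S = "\<lambda>j. marked x d j (j * j)"
  have init: "init_state x = ?S 0"
    by (auto simp: init_state_def marked_def fun_eq_iff input_tape_def marks_def)
  have 1: "run (While 0 (- {0}) (square_round d)) (?S 0) (?M * (?B + 2) + 1) (?S m)"
  proof (rule run_While)
    fix j
    assume j: "j < m"
    have "fst (input_tape x) (int (j * j)) \<noteq> 0"
      using fst_input_tape(1)[OF less[OF j]] by simp
    then have "rd (?S j) 0 \<in> - {0}"
      by (simp add: marked_def)
    moreover have "run (square_round d) (?S j) ?B (?S (Suc j))"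
      by (rule run_square_round) (use less j m(2) assms(2) in auto)
    ultimately show "rd (?S j) 0 \<in> - {0} \<and> run (square_round d) (?S j) ?B (?S (Suc j))"
      by blast
  next
    have "fst (input_tape x) (int (m * m)) = 0"
      by (rule fst_input_tape(2)) (use m(1) in linarith)
    then show "rd (?S m) 0 \<notin> - {0}"
      by (simp add: marked_def)
  qed (rule m(2))
  let ?s = "(?S m)(0 := (fst (input_tape x), int (m * m) - 1))"
  have 2: "run (Mv 0 Move_Left) (?S m) 1 ?s"
    by (rule run_Mv) (simp add: marked_def)
  let ?L = "adjacency_language (\<lambda>E n. sat E n (\<lambda>_. 0) \<phi>)"
  let ?c = "Cond 0 {0} (Wr 1 1) (Mv 0 Move_Right ;; rewind 0 ;; eval_fo \<phi>)"
  let ?T = "1 + (3 * ?M + 3) + time_fo ?M \<phi>"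
  have "\<exists>s. run ?c ?s (?T + 2) s \<and> (rd s 1 = 2 \<longleftrightarrow> x \<in> ?L)"
  proof (cases "?M = m * m \<and> 0 < m")
    case True
    have "int (m * m) - 1 = int (m * m - 1)"
      using True by simp
    moreover have "fst (input_tape x) (int (m * m - 1)) \<noteq> 0"
      using fst_input_tape(1)[of "m * m - 1" x] True by simp
    ultimately have rd: "rd ?s 0 \<notin> {0}"
      by simp
    let ?b = "sat (matrix x m) m (\<lambda>_. 0) \<phi>"
    have "run (Mv 0 Move_Right) ?s 1 (?S m)"
      by (rule run_Mv) (simp add: marked_def fun_eq_iff)
    moreover have "run (rewind 0) (?S m) (3 * ?M + 3) ((?S m)(0 := (fst (input_tape x), 0)))"
      by (rule run_rewind[where h = "m * m"]) (use True in \<open>auto simp: marked_def\<close>)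
    moreover have "run (eval_fo \<phi>) ((?S m)(0 := (fst (input_tape x), 0))) (time_fo m \<phi>)
        (set_result ?b ((?S m)(0 := (fst (input_tape x), 0))))"
      by (rule run_eval_fo)
        (use True assms(1) in \<open>auto simp: represents_def marked_def prod_eq_iff\<close>)
    ultimately have "run (Mv 0 Move_Right ;; rewind 0 ;; eval_fo \<phi>) ?s
        (1 + ((3 * ?M + 3) + time_fo m \<phi>)) (set_result ?b ((?S m)(0 := (fst (input_tape x), 0))))"
      by (intro run_Seq)
    then have "run (Mv 0 Move_Right ;; rewind 0 ;; eval_fo \<phi>) ?s ?T
        (set_result ?b ((?S m)(0 := (fst (input_tape x), 0))))"
      by (rule run_mono) (use time_fo_mono[OF m(2), of \<phi>] in simp)
    then have "run ?c ?s (?T + 2) (set_result ?b ((?S m)(0 := (fst (input_tape x), 0))))"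
      using rd by (intro run_CondF)
    moreover have "x \<in> ?L \<longleftrightarrow> ?b"
    proof -
      have "n = m" if "length x = n * n" for n
        using that True by (metis power2_eq_square power_inject_base le_eq_less_or_eq not_le
            power2_nat_le_eq_le)
      then show ?thesis
        using True by (auto simp: adjacency_language_def)
    qed
    ultimately show ?thesis
      by (intro exI conjI) auto
  next
    case False
    have "x \<notin> ?L"
    proof
      assume "x \<in> ?L"
      then obtain n where n: "0 < n" "?M = n * n"
        by (auto simp: adjacency_language_def)
      then have "m \<le> n"
        unfolding m_def by (intro Least_le) simp
      moreover have "n \<le> m"
        using n(2) m(1) by (metis power2_eq_square power2_nat_le_eq_le)
      ultimately show False
        using False n by simp
    qed
    have "rd ?s 0 = 0"
    proof (cases "m = 0")
      case True
      then show ?thesis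
        by simp
    next
      case nz: False
      then have "?M < m * m"
        using False m(1) by simp
      then have "int ?M \<le> int (m * m) - 1"
        by linarith
      then have "fst (input_tape x) (int (m * m) - 1) = 0"
        by (rule fst_input_tape(2))
      then show ?thesis
        by simp
    qed
    then have "run ?c ?s (1 + 2) (set_result False ?s)"
      by (intro run_CondT run_set_result) auto
    then have "run ?c ?s (?T + 2) (set_result False ?s)"
      by (rule run_mono) simp
    then show ?thesis
      using \<open>x \<notin> ?L\<close> by (intro exI[of _ "set_result False ?s"] conjI) auto
  qed
  then obtain s where s: "run ?c ?s (?T + 2) s" "rd s 1 = 2 \<longleftrightarrow> x \<in> ?L"
    by blast
  have "run (decider d \<phi>) (init_state x) (time_decider d \<phi> ?M) s"
    unfolding decider_def time_decider_def init using 1 2 s(1) by (intro run_Seq)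
  then show thesis
    using s(2) by (rule that)
qed


section \<open>First-order definable problems are in P\<close>

text \<open>Equality with a polynomial can be asked for instead of domination, as all time bounds
  are explicit sums and products.\<close>

definition polynomially_bounded :: "(nat \<Rightarrow> nat) \<Rightarrow> bool" where
  "polynomially_bounded f \<longleftrightarrow> (\<exists>p. f = poly p)"

lemma polynomially_bounded_intros:
  "polynomially_bounded (\<lambda>n. c)"
  "polynomially_bounded (\<lambda>n. n)"
  "polynomially_bounded f \<Longrightarrow> polynomially_bounded g \<Longrightarrow> polynomially_bounded (\<lambda>n. f n + g n)"
  "polynomially_bounded f \<Longrightarrow> polynomially_bounded g \<Longrightarrow> polynomially_bounded (\<lambda>n. f n * g n)"
proof -
  show "polynomially_bounded (\<lambda>n. c)"
    unfolding polynomially_bounded_def by (rule exI[of _ "[:c:]"]) auto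
  show "polynomially_bounded (\<lambda>n. n)"
    unfolding polynomially_bounded_def by (rule exI[of _ "[:0, 1:]"]) auto
  assume "polynomially_bounded f" "polynomially_bounded g"
  then obtain p q where "f = poly p" "g = poly q"
    unfolding polynomially_bounded_def by blast
  then show "polynomially_bounded (\<lambda>n. f n + g n)" "polynomially_bounded (\<lambda>n. f n * g n)"
    unfolding polynomially_bounded_def
    by (auto intro: exI[of _ "p + q"] exI[of _ "p * q"] simp: fun_eq_iff)
qed

lemma polynomially_bounded_time_fo: "polynomially_bounded (\<lambda>n. time_fo n \<phi>)"
  by (induction \<phi>) (simp_all only: time_fo.simps, (intro polynomially_bounded_intros | assumption)+)

lemma wf_com_repeat: "wf_com k 3 c \<Longrightarrow> i < k \<Longrightarrow> wf_com k 3 (repeat i c)"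
  by (simp add: repeat_def rewind_def)

lemma wf_com_eval_fo: "wf_fo d \<phi> \<Longrightarrow> wf_com (3 + d) 3 (eval_fo \<phi>)"
  by (induction \<phi>) (auto simp: advance_def rewind_def intro!: wf_com_repeat)

lemma wf_com_append_marks: "d \<le> d' \<Longrightarrow> wf_com (3 + d') 3 (append_marks d)"
  by (induction d) (auto simp: append_mark_def rewind_def)

lemma wf_com_decider: "wf_fo d \<phi> \<Longrightarrow> 0 < d \<Longrightarrow> wf_com (3 + d) 3 (decider d \<phi>)"
  using wf_com_eval_fo[of d \<phi>] wf_com_append_marks[of d d]
  by (simp add: decider_def square_round_def advance_def rewind_def)

text \<open>The sentence is fixed, so its variables contribute a constant number 3 + d of tapes, and
  its nesting of quantifiers affects only the degree of the polynomial.\<close>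

theorem adjacency_language_in_P:
  assumes "wf_fo d \<phi>" "0 < d" "\<And>E n. 0 < n \<Longrightarrow> P E n \<longleftrightarrow> sat E n (\<lambda>_. 0) \<phi>"
  shows "adjacency_language P \<in> class_P"
proof -
  have "polynomially_bounded (time_decider d \<phi>)"
    unfolding time_decider_def[abs_def]
    by (intro polynomially_bounded_intros polynomially_bounded_time_fo)
  then obtain p where p: "time_decider d \<phi> = poly p"
    unfolding polynomially_bounded_def by blast
  have "adjacency_language P = adjacency_language (\<lambda>E n. sat E n (\<lambda>_. 0) \<phi>)"
    using assms(3) by (auto simp: adjacency_language_def)
  moreover have "adjacency_language (\<lambda>E n. sat E n (\<lambda>_. 0) \<phi>) \<in> class_P"
  proof (rule in_class_P_if_exec)
    show "wf_com (3 + d) 3 (decider d \<phi>)"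
      using wf_com_decider assms(1,2) .
    show "\<exists>t s. exec (decider d \<phi>) (init_state x) t s \<and> t \<le> poly p (length x) \<and>
        (rd s 1 = 2 \<longleftrightarrow> x \<in> adjacency_language (\<lambda>E n. sat E n (\<lambda>_. 0) \<phi>))" for x
      using run_decider[OF assms(1,2), of x] unfolding run_def p by metis
  qed auto
  ultimately show ?thesis
    by simp
qed


section \<open>Graph structure: blocks, bridges, rainbow walks and centres in terms of
  adjacency\<close>

section \<open>Adjacency, connectedness and local separation\<close>

definition adj :: "('a,'b) pre_digraph \<Rightarrow> 'a \<Rightarrow> 'a \<Rightarrow> bool" where
  "adj G u v \<longleftrightarrow> (u, v) \<in> arcs_ends G"

definition conn :: "('a \<Rightarrow> 'a \<Rightarrow> bool) \<Rightarrow> 'a set \<Rightarrow> bool" where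
  "conn R S \<longleftrightarrow> (\<forall>u\<in>S. \<forall>v\<in>S. (\<lambda>x y. R x y \<and> x \<in> S \<and> y \<in> S)\<^sup>*\<^sup>* u v)"

definition avoids :: "('a \<Rightarrow> 'a \<Rightarrow> bool) \<Rightarrow> 'a \<Rightarrow> 'a \<Rightarrow> 'a \<Rightarrow> bool" where
  "avoids R p = (\<lambda>x y. R x y \<and> x \<noteq> p \<and> y \<noteq> p)\<^sup>*\<^sup>*"

text \<open>Adjacency form of the block property: nonadjacent neighbours of p fall into different
  components once p is removed. Only pairs with a common neighbour are inspected, which suits
  arguments about two levels around a centre.\<close>

definition locally_separated :: "('a \<Rightarrow> 'a \<Rightarrow> bool) \<Rightarrow> bool" where
  "locally_separated R \<longleftrightarrow> (\<forall>x p y. R x p \<longrightarrow> R p y \<longrightarrow> x \<noteq> y \<longrightarrow> \<not> R x y \<longrightarrow> \<not> avoids R p x y)"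

lemma rtranclp_distinct_path:
  assumes "R\<^sup>*\<^sup>* x y"
  obtains zs where "successively R (x # zs)" "distinct (x # zs)" "last (x # zs) = y"
proof -
  have "\<exists>zs. successively R (x # zs) \<and> distinct (x # zs) \<and> last (x # zs) = y"
    using assms
  proof (induction rule: converse_rtranclp_induct)
    case base
    then show ?case
      by (intro exI[of _ "[]"]) simp
  next
    case (step x z)
    then obtain zs where zs: "successively R (z # zs)" "distinct (z # zs)" "last (z # zs) = y"
      by blast
    show ?case
    proof (cases "x \<in> set (z # zs)")
      case True
      then obtain as bs where ab: "z # zs = as @ x # bs"
        by (meson split_list)
      then have "successively R (x # bs)" "distinct (x # bs)" "last (x # bs) = y"
        using zs by (auto simp: successively_append_iff)
      then show ?thesis
        by blast
    next
      case False
      then show ?thesis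
        using zs step(1) by (intro exI[of _ "z # zs"]) auto
    qed
  qed
  then show thesis
    using that by blast
qed

lemma successively_rtranclp:
  assumes "successively R (x # zs)" "v \<in> set (x # zs)" "set (x # zs) \<subseteq> S"
  shows "(\<lambda>a b. R a b \<and> a \<in> S \<and> b \<in> S)\<^sup>*\<^sup>* x v"
  using assms
proof (induction zs arbitrary: x)
  case (Cons z zs)
  show ?case
  proof (cases "v = x")
    case False
    then have "(\<lambda>a b. R a b \<and> a \<in> S \<and> b \<in> S)\<^sup>*\<^sup>* z v"
      using Cons by auto
    then show ?thesis
      using Cons.prems by (intro converse_rtranclp_into_rtranclp[of _ x z]) auto
  qed simp
qed auto

lemma rtranclp_symp:
  assumes "symp R" "R\<^sup>*\<^sup>* x y"
  shows "R\<^sup>*\<^sup>* y x"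
  using assms(2,1) by (induction rule: rtranclp_induct) (auto intro: converse_rtranclp_into_rtranclp dest: sympD)

lemma connI:
  assumes "symp R" "\<And>u. u \<in> S \<Longrightarrow> (\<lambda>x y. R x y \<and> x \<in> S \<and> y \<in> S)\<^sup>*\<^sup>* r u"
  shows "conn R S"
  unfolding conn_def
proof (intro ballI)
  let ?R = "\<lambda>x y. R x y \<and> x \<in> S \<and> y \<in> S"
  fix u v
  assume uv: "u \<in> S" "v \<in> S"
  have "symp ?R"
    using assms(1) by (auto simp: symp_def)
  then have "?R\<^sup>*\<^sup>* u r"
    using assms(2)[OF uv(1)] by (rule rtranclp_symp)
  then show "?R\<^sup>*\<^sup>* u v"
    using assms(2)[OF uv(2)] by (rule rtranclp_trans)
qed

lemma rtranclp_weaken: "R\<^sup>*\<^sup>* x y \<Longrightarrow> (\<And>a b. R a b \<Longrightarrow> R' a b) \<Longrightarrow> R'\<^sup>*\<^sup>* x y"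
  by (rule rtranclp_mono[THEN predicate2D, rotated]) auto

lemma conn_mono:
  assumes "conn R S" "\<And>x y. R x y \<Longrightarrow> R' x y"
  shows "conn R' S"
  unfolding conn_def
proof (intro ballI)
  fix u v
  assume "u \<in> S" "v \<in> S"
  then have "(\<lambda>x y. R x y \<and> x \<in> S \<and> y \<in> S)\<^sup>*\<^sup>* u v"
    using assms(1) by (simp add: conn_def)
  then show "(\<lambda>x y. R' x y \<and> x \<in> S \<and> y \<in> S)\<^sup>*\<^sup>* u v"
    by (rule rtranclp_weaken) (use assms(2) in auto)
qed

lemma conn_clique:
  assumes "\<And>x y. x \<in> S \<Longrightarrow> y \<in> S \<Longrightarrow> x \<noteq> y \<Longrightarrow> R x y"
  shows "conn R S"
  unfolding conn_def
proof (intro ballI)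
  fix u v
  assume "u \<in> S" "v \<in> S"
  then show "(\<lambda>x y. R x y \<and> x \<in> S \<and> y \<in> S)\<^sup>*\<^sup>* u v"
    using assms by (cases "u = v") (auto intro: r_into_rtranclp)
qed

lemma symp_adj: "graph G \<Longrightarrow> symp (adj G)"
  by (auto simp: symp_def adj_def intro: sym_digraph.graph_symmetric
      simp: graph_def pseudo_graph_def)

lemma adj_verts: "wf_digraph G \<Longrightarrow> adj G u v \<Longrightarrow> u \<in> verts G \<and> v \<in> verts G"
  unfolding adj_def by (auto simp: wf_digraph_def arcs_ends_conv)

lemma connected_iff_conn:
  assumes "wf_digraph G" "symp (adj G)"
  shows "Digraph_Component.connected G \<longleftrightarrow> verts G \<noteq> {} \<and> conn (adj G) (verts G)"
proof -
  have "symcl (arcs_ends G) = arcs_ends G"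
    using assms(2) by (auto simp: symcl_def symp_def adj_def)
  moreover have "(u, v) \<in> rtrancl_on (verts G) (arcs_ends G) \<longleftrightarrow>
      (\<lambda>x y. adj G x y \<and> x \<in> verts G \<and> y \<in> verts G)\<^sup>*\<^sup>* u v" if "u \<in> verts G" for u v
  proof
    assume "(u, v) \<in> rtrancl_on (verts G) (arcs_ends G)"
    then show "(\<lambda>x y. adj G x y \<and> x \<in> verts G \<and> y \<in> verts G)\<^sup>*\<^sup>* u v"
      by induction (auto simp: adj_def intro: converse_rtranclp_into_rtranclp)
  next
    assume "(\<lambda>x y. adj G x y \<and> x \<in> verts G \<and> y \<in> verts G)\<^sup>*\<^sup>* u v"
    then show "(u, v) \<in> rtrancl_on (verts G) (arcs_ends G)"
      by induction (use that in \<open>auto simp: adj_def intro: rtrancl_on.intros\<close>)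
  qed
  ultimately show ?thesis
    unfolding connected_conv conn_def by auto
qed

lemma wf_digraph_graph: "graph G \<Longrightarrow> wf_digraph G"
  by (simp add: graph_def digraph_def fin_digraph_def)


section \<open>Blocks\<close>

lemma cut_vertex_iff:
  assumes "graph G"
  shows "cut_vertex G v \<longleftrightarrow> v \<in> verts G \<and> verts G \<noteq> {v} \<and> \<not> conn (adj G) (verts G - {v})"
proof -
  let ?H = "pre_digraph.del_vert G v"
  interpret graph G
    by (rule assms)
  have adj: "adj ?H x y \<longleftrightarrow> adj G x y \<and> x \<noteq> v \<and> y \<noteq> v" for x y
    by (auto simp: adj_def arcs_ends_conv del_vert_simps)
  then have "symp (adj ?H)"
    using symp_adj[OF assms] by (auto simp: symp_def)
  then have "Digraph_Component.connected ?H \<longleftrightarrow> verts ?H \<noteq> {} \<and> conn (adj ?H) (verts ?H)"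
    by (intro connected_iff_conn wf_digraph_del_vert)
  moreover have "conn (adj ?H) (verts G - {v}) \<longleftrightarrow> conn (adj G) (verts G - {v})"
  proof -
    have "(\<lambda>x y. adj ?H x y \<and> x \<in> verts G - {v} \<and> y \<in> verts G - {v}) =
        (\<lambda>x y. adj G x y \<and> x \<in> verts G - {v} \<and> y \<in> verts G - {v})"
      by (auto simp: adj fun_eq_iff)
    then show ?thesis
      by (simp only: conn_def)
  qed
  ultimately show ?thesis
    by (auto simp: cut_vertex_def del_vert_simps)
qed

lemma biconnected_iff:
  "biconnected G \<longleftrightarrow> graph G \<and> verts G \<noteq> {} \<and> conn (adj G) (verts G) \<and>
     (\<forall>v\<in>verts G. verts G = {v} \<or> conn (adj G) (verts G - {v}))"
  using cut_vertex_iff[of G] connected_iff_conn[OF wf_digraph_graph symp_adj, of G]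
  by (auto simp: biconnected_def)

lemma graph_induce:
  assumes "graph G" "S \<subseteq> verts G"
  shows "graph (G \<restriction> S)" "subgraph (G \<restriction> S) G"
    "adj (G \<restriction> S) x y \<longleftrightarrow> adj G x y \<and> x \<in> S \<and> y \<in> S"
proof -
  interpret graph G
    by (rule assms)
  have ind: "induced_subgraph (G \<restriction> S) G"
    using assms(2) by (rule induced_induce)
  show "graph (G \<restriction> S)"
    by (rule digraph.graphI[OF digraphI_induced[OF ind]])
      (rule induced_graph_imp_symmetric[OF sym_arcs ind])
  show "subgraph (G \<restriction> S) G"
    using assms(2) by (rule subgraph_induce_subgraphI)
  show "adj (G \<restriction> S) x y \<longleftrightarrow> adj G x y \<and> x \<in> S \<and> y \<in> S"
    by (auto simp: adj_def arcs_ends_conv induce_subgraph_def)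
qed

lemma conn_induce:
  assumes "graph G" "S \<subseteq> verts G" "T \<subseteq> S"
  shows "conn (adj (G \<restriction> S)) T \<longleftrightarrow> conn (adj G) T"
proof -
  have "(\<lambda>x y. (adj G x y \<and> x \<in> S \<and> y \<in> S) \<and> x \<in> T \<and> y \<in> T) = (\<lambda>x y. adj G x y \<and> x \<in> T \<and> y \<in> T)"
    using assms(3) by (auto simp: fun_eq_iff)
  then show ?thesis
    by (simp add: conn_def graph_induce(3)[OF assms(1,2)])
qed

lemma biconnected_induce:
  assumes "graph G" "S \<subseteq> verts G"
  shows "biconnected (G \<restriction> S) \<longleftrightarrow> S \<noteq> {} \<and> conn (adj G) S \<and>
    (\<forall>v\<in>S. S = {v} \<or> conn (adj G) (S - {v}))"
  using assms graph_induce(1)[OF assms] conn_induce[OF assms]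
  by (auto simp: biconnected_iff)

text \<open>Among the biconnected subgraphs containing H0, one with the largest number of vertices
  plus arcs is maximal for the subgraph order.\<close>

lemma ex_block_above:
  assumes "graph G" "subgraph H0 G" "biconnected H0"
  shows "\<exists>H. is_block G H \<and> verts H0 \<subseteq> verts H"
proof -
  interpret graph G
    by (rule assms)
  let ?P = "\<lambda>H. biconnected H \<and> subgraph H G \<and> subgraph H0 H"
  let ?f = "\<lambda>H. card (verts H) + card (arcs H)"
  have bound: "?f H < Suc (card (verts G) + card (arcs G))" if "?P H" for H
    using that by (auto simp: subgraph_def less_Suc_eq_le intro!: add_mono card_mono)
  have "?P H0"
    using assms by (auto simp: subgraph_def compatible_def)
  then obtain H where H: "?P H" "\<And>H'. ?P H' \<Longrightarrow> ?f H' \<le> ?f H"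
    using ex_has_greatest_nat[of ?P H0 ?f] bound by (metis less_Suc_eq_le)
  have "\<not> (subgraph H' G \<and> biconnected H')" if "H' \<noteq> H" "subgraph H H'" for H'
  proof
    assume *: "subgraph H' G \<and> biconnected H'"
    have fin: "finite (verts H')" "finite (arcs H')"
      using * finite_subset[OF _ finite_verts] finite_subset[OF _ finite_arcs]
      by (auto simp: subgraph_def)
    have sub: "verts H \<subseteq> verts H'" "arcs H \<subseteq> arcs H'" "tail H = tail H'" "head H = head H'"
      using that(2) by (auto simp: subgraph_def compatible_def)
    have "?P H'"
      using * H(1) that(2) subgraph_trans by blast
    then have "?f H' \<le> ?f H"
      by (rule H(2))
    moreover have "card (verts H) \<le> card (verts H')" "card (arcs H) \<le> card (arcs H')"
      using sub fin by (auto intro: card_mono)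
    ultimately have "card (verts H) = card (verts H')" "card (arcs H) = card (arcs H')"
      by auto
    then have "verts H = verts H'" "arcs H = arcs H'"
      using sub fin card_subset_eq by metis+
    then show False
      using sub that(1) by (auto intro: pre_digraph.equality)
  qed
  then have "is_block G H"
    using H(1) unfolding is_block_def max_subgraph_def by blast
  then show ?thesis
    using H(1) by (auto simp: subgraph_def)
qed

text \<open>A walk from x to y that avoids p can be made a path and then closes through p to a
  cycle. A cycle is biconnected, so it lies in a block; this block is a clique, which makes x and y
  adjacent.\<close>

lemma block_graph_imp_locally_separated:
  assumes "block_graph G"
  shows "locally_separated (adj G)"
  unfolding locally_separated_def
proof (intro allI impI notI)
  fix x p y
  assume *: "adj G x p" "adj G p y" "x \<noteq> y" "\<not> adj G x y" "avoids (adj G) p x y"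
  have G: "graph G"
    using assms by (simp add: block_graph_def)
  note sym = symp_adj[OF G]
  let ?R = "\<lambda>x y. adj G x y \<and> x \<noteq> p \<and> y \<noteq> p"
  obtain zs where zs: "successively ?R (x # zs)" "distinct (x # zs)" "last (x # zs) = y"
    using *(5) unfolding avoids_def by (rule rtranclp_distinct_path)
  have path: "successively (adj G) (x # zs)"
    by (rule successively_mono[OF zs(1)]) simp
  have p: "p \<notin> set (x # zs)"
  proof -
    have "v \<noteq> p" if "successively ?R (a # as)" "v \<in> set as" for a as v
      using that by (induction as arbitrary: a) auto
    from this[OF zs(1)] have "p \<notin> set zs"
      by blast
    moreover have "x \<noteq> p"
      using *(2,4) by blast
    ultimately show ?thesis
      by simp
  qed
  let ?S = "insert p (set (x # zs))"
  have "set (a # as) \<subseteq> verts G" if "successively (adj G) (a # as)" "a \<in> verts G" for a as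
    using that by (induction as arbitrary: a) (auto dest: adj_verts[OF wf_digraph_graph[OF G]])
  then have S: "?S \<subseteq> verts G"
    using path adj_verts[OF wf_digraph_graph[OF G] *(1)] by auto
  let ?T = "\<lambda>T a b. adj G a b \<and> a \<in> T \<and> b \<in> T"
  have py: "adj G p x" "adj G p y"
    using * sympD[OF sym] by blast+
  have whole: "conn (adj G) (set (x # zs))"
    by (rule connI[OF sym successively_rtranclp]) (use path in auto)
  \<comment> \<open>Deleting q splits the path into \<open>as\<close> and \<open>bs\<close>. The
    former is still attached to p through its first vertex x, the latter through its last vertex y,
    which is why \<open>bs\<close> is traversed backwards.\<close>
  have p_conn: "conn (adj G) (?S - {q})" if q: "q \<in> set (x # zs)" for q
  proof (rule connI[OF sym])
    fix u
    assume u: "u \<in> ?S - {q}"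
    obtain as bs where ab: "x # zs = as @ q # bs"
      using q by (meson split_list)
    then have d: "q \<notin> set as" "q \<notin> set bs"
      using zs(2) by auto
    consider "u = p" | "u \<in> set as" | "u \<in> set bs"
      using u unfolding ab by auto
    then show "(?T (?S - {q}))\<^sup>*\<^sup>* p u"
    proof cases
      case 2
      then obtain as' where as': "as = x # as'"
        using ab by (cases as) auto
      have "successively (adj G) (x # as')"
        using path unfolding ab as' successively_append_iff by blast
      then have "(?T (?S - {q}))\<^sup>*\<^sup>* x u"
        by (rule successively_rtranclp) (use 2 as' ab d in auto)
      moreover have "?T (?S - {q}) p x"
        using py p ab d as' by auto
      ultimately show ?thesis
        by (rule converse_rtranclp_into_rtranclp[rotated])
    next
      case 3
      have "successively (adj G) bs"
        using path unfolding ab by (auto simp: successively_append_iff successively_Cons)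
      then have "successively (adj G) (rev bs)"
        unfolding successively_rev by (rule successively_mono) (rule sympD[OF sym])
      moreover obtain cs where cs: "rev bs = y # cs"
        using zs(3) ab 3 by (cases bs rule: rev_cases) auto
      ultimately have path': "successively (adj G) (y # cs)"
        by simp
      have sb: "set (y # cs) = set bs"
        using cs by (metis set_rev)
      have "(?T (?S - {q}))\<^sup>*\<^sup>* y u"
      proof (rule successively_rtranclp[OF path'])
        show "set (y # cs) \<subseteq> ?S - {q}"
          unfolding sb ab using d by auto
      qed (use 3 sb in auto)
      moreover have "?T (?S - {q}) p y"
        using py p q ab d sb by auto
      ultimately show ?thesis
        by (rule converse_rtranclp_into_rtranclp[rotated])
    qed simp
  qed
  have "conn (adj G) (?S - {v})" if "v \<in> ?S" for v
  proof (cases "v = p")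
    case True
    then show ?thesis
      using whole p by simp
  next
    case False
    then show ?thesis
      using that p_conn by blast
  qed
  moreover have "conn (adj G) ?S"
  proof (rule connI[OF sym])
    fix u
    assume "u \<in> ?S"
    moreover have "(?T ?S)\<^sup>*\<^sup>* x u" if "u \<in> set (x # zs)"
      by (rule successively_rtranclp) (use path that in auto)
    moreover have "?T ?S x p"
      using * by auto
    ultimately show "(?T ?S)\<^sup>*\<^sup>* x u"
      by auto
  qed
  ultimately have "biconnected (G \<restriction> ?S)"
    by (subst biconnected_induce[OF G S]) simp
  then obtain H where H: "is_block G H" "?S \<subseteq> verts H"
    using ex_block_above[OF G graph_induce(2)[OF G S]] by auto
  then obtain m where "complete_digraph m H"
    using assms by (auto simp: block_graph_def)
  moreover have "y \<in> ?S"
    using zs(3) by (metis insertCI last_in_set list.distinct(1))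
  ultimately have "adj H x y"
    using H(2) *(3) by (auto simp: complete_digraph_def adj_def)
  moreover have "subgraph H G"
    using H(1) by (simp add: is_block_def pre_digraph.max_subgraph_def)
  ultimately show False
    using *(4) by (auto simp: adj_def arcs_ends_conv subgraph_def compatible_def)
qed

text \<open>Deleting p from a block leaves it connected, so two neighbours of p inside the block are
  joined by a walk avoiding p and hence equal or adjacent. Shortening walks in this way shows that
  any two vertices of the block are adjacent in G.\<close>

lemma locally_separated_imp_block_graph:
  assumes G: "graph G" and sep: "locally_separated (adj G)"
  shows "block_graph G"
  unfolding block_graph_def
proof (intro conjI allI impI)
  fix H
  assume "is_block G H"
  then have H: "biconnected H" "subgraph H G"
    and max: "\<And>H'. H' \<noteq> H \<Longrightarrow> subgraph H H' \<Longrightarrow> \<not> (subgraph H' G \<and> biconnected H')"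
    by (auto simp: is_block_def pre_digraph.max_subgraph_def)
  let ?S = "verts H"
  have S: "?S \<subseteq> verts G"
    using H(2) by (simp add: subgraph_def)
  have adj: "adj H x y \<Longrightarrow> adj G x y" for x y
    using H(2) by (auto simp: adj_def arcs_ends_conv subgraph_def compatible_def)
  have clique: "adj G x y" if "x \<in> ?S" "y \<in> ?S" "x \<noteq> y" for x y
  proof -
    let ?R = "\<lambda>x y. adj G x y \<and> x \<in> ?S \<and> y \<in> ?S"
    have step: "a = b \<or> adj G a b" if "?R a p" "?R p b" for a p b
    proof (rule ccontr)
      assume ab: "\<not> (a = b \<or> adj G a b)"
      then have "?S \<noteq> {p}"
        using that by auto
      then have "conn (adj H) (?S - {p})"
        using H(1) that by (auto simp: biconnected_iff)
      then have "conn (adj G) (?S - {p})"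
        by (rule conn_mono) (rule adj)
      moreover have "a \<noteq> p" "b \<noteq> p"
        using ab that by auto
      ultimately have "(\<lambda>x y. adj G x y \<and> x \<in> ?S - {p} \<and> y \<in> ?S - {p})\<^sup>*\<^sup>* a b"
        using that by (auto simp: conn_def)
      then have "avoids (adj G) p a b"
        unfolding avoids_def by (rule rtranclp_weaken) auto
      then show False
        using sep ab that unfolding locally_separated_def by blast
    qed
    have "?R\<^sup>*\<^sup>* x y"
    proof -
      have "conn (adj H) ?S"
        using H(1) by (simp add: biconnected_iff)
      then have "conn (adj G) ?S"
        by (rule conn_mono) (rule adj)
      then show ?thesis
        using that by (simp add: conn_def)
    qed
    then have "x = y \<or> ?R x y"
      by (induction rule: rtranclp_induct) (use step in blast)+
    then show ?thesis
      using that by simp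
  qed
  have nonempty: "?S \<noteq> {}"
    using H(1) by (simp add: biconnected_iff)
  \<comment> \<open>The induced subgraph on a clique is biconnected as well; maximality identifies
    it with H, so no arc of the clique is missing in H.\<close>
  have "biconnected (G \<restriction> ?S)"
    unfolding biconnected_induce[OF G S] using nonempty clique by (auto intro!: conn_clique)
  moreover have "subgraph H (G \<restriction> ?S)"
    using H(2) by (rule subgraph_induce_subgraphI2)
  ultimately have eq: "G \<restriction> ?S = H"
    using max graph_induce(2)[OF G S] by blast
  have "adj H x y \<longleftrightarrow> x \<in> ?S \<and> y \<in> ?S \<and> x \<noteq> y" for x y
  proof -
    have "loopfree_digraph H"
      using H(1) by (simp add: biconnected_iff graph_def digraph_def)
    then have "\<not> adj H x x"
      unfolding adj_def by (meson loopfree_digraph.adj_not_same)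
    then show ?thesis
      using graph_induce(3)[OF G S, of x y] clique unfolding eq by blast
  qed
  then have "complete_digraph (card ?S) H"
    using H(1) by (auto simp: complete_digraph_def biconnected_iff adj_def)
  then show "\<exists>m. complete_digraph m H"
    by blast
qed (rule G)


section \<open>Bridges\<close>

text \<open>First-order substitute for bridgelessness: in a block graph, an edge on a cycle lies in
  a clique that has a third vertex.\<close>

definition every_edge_in_triangle :: "('a \<Rightarrow> 'a \<Rightarrow> bool) \<Rightarrow> bool" where
  "every_edge_in_triangle R \<longleftrightarrow> (\<forall>x y. R x y \<longrightarrow> (\<exists>z. R x z \<and> R y z))"

lemma bridgeless_iff:
  assumes G: "graph G"
  shows "bridgeless G \<longleftrightarrow> (\<forall>x y. adj G x y \<longrightarrow>
    (\<forall>u\<in>verts G. \<forall>v\<in>verts G. (\<lambda>a b. adj G a b \<and> {a, b} \<noteq> {x, y})\<^sup>*\<^sup>* u v))"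
proof -
  interpret graph G
    by (rule G)
  have *: "Digraph_Component.connected (del_uedge G e) \<longleftrightarrow> verts G \<noteq> {} \<and>
      (\<forall>u\<in>verts G. \<forall>v\<in>verts G. (\<lambda>a b. adj G a b \<and> {a, b} \<noteq> e)\<^sup>*\<^sup>* u v)" for e
  proof -
    have adj: "adj (del_uedge G e) a b \<longleftrightarrow> adj G a b \<and> {a, b} \<noteq> e" for a b
      by (auto simp: adj_def arcs_ends_conv del_uedge_def uedge_def)
    have wf: "wf_digraph (del_uedge G e)"
      by unfold_locales (auto simp: del_uedge_def)
    have "symp (adj (del_uedge G e))"
      using symp_adj[OF G] by (auto simp: symp_def adj insert_commute)
    then have "Digraph_Component.connected (del_uedge G e) \<longleftrightarrow> verts (del_uedge G e) \<noteq> {} \<and>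
        conn (adj (del_uedge G e)) (verts (del_uedge G e))"
      by (rule connected_iff_conn[OF wf])
    moreover have "(\<lambda>a b. adj (del_uedge G e) a b \<and> a \<in> verts G \<and> b \<in> verts G) =
        (\<lambda>a b. adj G a b \<and> {a, b} \<noteq> e)"
      using adj_verts[OF wf_digraph_axioms] by (auto simp: fun_eq_iff adj)
    moreover have "verts (del_uedge G e) = verts G"
      by (simp add: del_uedge_def)
    ultimately show ?thesis
      by (simp add: conn_def)
  qed
  have edges: "e \<in> uedges G \<longleftrightarrow> (\<exists>x y. adj G x y \<and> e = {x, y})" for e
    by (auto simp: uedges_def uedge_def adj_def arcs_ends_conv)
  have all_edges: "(\<forall>e\<in>uedges G. Q e) \<longleftrightarrow> (\<forall>x y. adj G x y \<longrightarrow> Q {x, y})" for Q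
    unfolding Ball_def edges by blast
  have "verts G \<noteq> {}" if "adj G x y" for x y
    using adj_verts[OF wf_digraph_axioms that] by auto
  then show ?thesis
    unfolding bridgeless_def * all_edges by (simp cong: imp_cong)
qed

text \<open>A path from x to y without the edge xy starts with a step to some z other than y and
  never returns to x. So z and y are neighbours of x joined off x, and local separation makes them
  adjacent.\<close>

lemma bridgeless_imp_every_edge_in_triangle:
  assumes G: "graph G" and "bridgeless G" "locally_separated (adj G)"
  shows "every_edge_in_triangle (adj G)"
  unfolding every_edge_in_triangle_def
proof (intro allI impI)
  fix x y
  assume xy: "adj G x y"
  note sym = sympD[OF symp_adj[OF G]]
  let ?R = "\<lambda>a b. adj G a b \<and> {a, b} \<noteq> {x, y}"
  have ne: "x \<noteq> y"
  proof -
    have "loopfree_digraph G"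
      using G by (simp add: graph_def digraph_def)
    then show ?thesis
      using xy unfolding adj_def by (meson loopfree_digraph.adj_not_same)
  qed
  have "?R\<^sup>*\<^sup>* x y"
    using assms(2) xy adj_verts[OF wf_digraph_graph[OF G] xy] unfolding bridgeless_iff[OF G] by blast
  then obtain zs where zs: "successively ?R (x # zs)" "distinct (x # zs)" "last (x # zs) = y"
    by (rule rtranclp_distinct_path)
  obtain z as where z: "zs = z # as"
    using zs(3) ne by (cases zs) auto
  have xz: "adj G x z" "z \<noteq> y"
    using zs(1) z by auto
  show "\<exists>z. adj G x z \<and> adj G y z"
  proof (cases "adj G z y")
    case True
    then show ?thesis
      using xz sym by blast
  next
    case False
    have "successively (\<lambda>a b. adj G a b \<and> a \<noteq> x \<and> b \<noteq> x) (z # as)"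
    proof -
      have "successively (\<lambda>a b. adj G a b \<and> a \<noteq> x \<and> b \<noteq> x) bs" if "successively ?R bs" "x \<notin> set bs" for bs
        using that by (induction bs rule: induct_list012) auto
      then show ?thesis
        using zs(1,2) z by simp
    qed
    from successively_rtranclp[OF this, of y UNIV] have "avoids (adj G) x z y"
      using zs(3) z last_in_set[of "z # as"] by (simp add: avoids_def)
    then show ?thesis
      using assms(3) sym[OF xz(1)] xy xz(2) False unfolding locally_separated_def by blast
  qed
qed

text \<open>A deleted edge on a connecting walk is bypassed through the third vertex of its
  triangle.\<close>

lemma every_edge_in_triangle_imp_bridgeless:
  assumes G: "graph G" and "Digraph_Component.connected G" "every_edge_in_triangle (adj G)"
  shows "bridgeless G"
  unfolding bridgeless_iff[OF G]
proof (intro allI impI ballI)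
  fix x y u v
  assume xy: "adj G x y" and uv: "u \<in> verts G" "v \<in> verts G"
  note sym = sympD[OF symp_adj[OF G]]
  let ?R = "\<lambda>a b. adj G a b \<and> {a, b} \<noteq> {x, y}"
  have step: "?R\<^sup>*\<^sup>* a b" if ab: "adj G a b" for a b
  proof (cases "{a, b} = {x, y}")
    case True
    obtain z where z: "adj G a z" "adj G b z"
      using assms(3) ab unfolding every_edge_in_triangle_def by blast
    have "loopfree_digraph G"
      using G by (simp add: graph_def digraph_def)
    then have "\<not> adj G w w" for w
      unfolding adj_def by (meson loopfree_digraph.adj_not_same)
    then have "a \<noteq> z" "b \<noteq> z"
      using z by auto
    then have "?R a z" "?R z b"
      using z sym True by (auto simp: doubleton_eq_iff)
    then show ?thesis
      by (rule converse_rtranclp_into_rtranclp[of ?R, OF _ r_into_rtranclp])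
  next
    case False
    then show ?thesis
      using ab by (intro r_into_rtranclp) simp
  qed
  have "(\<lambda>a b. adj G a b \<and> a \<in> verts G \<and> b \<in> verts G)\<^sup>*\<^sup>* u v"
    using assms(2) uv connected_iff_conn[OF wf_digraph_graph[OF G] symp_adj[OF G]]
    by (simp add: conn_def)
  then show "?R\<^sup>*\<^sup>* u v"
  proof induction
    case (step b c)
    then show ?case
      using \<open>\<And>a b. adj G a b \<Longrightarrow> ?R\<^sup>*\<^sup>* a b\<close> by (meson rtranclp_trans)
  qed simp
qed


section \<open>Rainbow walks\<close>

text \<open>Colors are distinct but vertices may repeat. Carrying the color set as an index reduces
  concatenation to disjointness of sets, and its cardinality is the length of the walk.\<close>

inductive rwalk :: "('a \<Rightarrow> 'a \<Rightarrow> bool) \<Rightarrow> ('a set \<Rightarrow> nat) \<Rightarrow> 'a \<Rightarrow> nat set \<Rightarrow> 'a \<Rightarrow> bool"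
  for R :: "'a \<Rightarrow> 'a \<Rightarrow> bool" and \<chi> :: "'a set \<Rightarrow> nat" where
  nil: "rwalk R \<chi> u {} u"
| step: "R u v \<Longrightarrow> rwalk R \<chi> v S w \<Longrightarrow> \<chi> {u, v} \<notin> S \<Longrightarrow> rwalk R \<chi> u (insert (\<chi> {u, v}) S) w"

lemma rwalk_if_rainbow_path:
  assumes "wf_digraph G" "rainbow_path G \<chi> u p v"
  shows "\<exists>S. rwalk (adj G) \<chi> u S v"
proof -
  have "rwalk (adj G) \<chi> u ((\<chi> \<circ> uedge G) ` set p) v"
    if "pre_digraph.cas G u p v" "set p \<subseteq> arcs G" "distinct (map (\<chi> \<circ> uedge G) p)" for u
    using that
  proof (induction p arbitrary: u)
    case Nil
    then show ?case
      by (simp add: pre_digraph.cas.simps rwalk.nil)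
  next
    case (Cons a p)
    have "adj G u (head G a)" "tail G a = u"
      using Cons.prems by (auto simp: pre_digraph.cas.simps adj_def arcs_ends_conv)
    moreover have "rwalk (adj G) \<chi> (head G a) ((\<chi> \<circ> uedge G) ` set p) v"
      using Cons by (simp add: pre_digraph.cas.simps)
    ultimately show ?case
      using Cons.prems(3) rwalk.step[of "adj G" u "head G a"] by (simp add: uedge_def)
  qed
  then show ?thesis
    using assms(2) by (auto simp: rainbow_path_def pre_digraph.apath_def pre_digraph.awalk_def)
qed

text \<open>Passing from a walk to a path inside it only drops arcs, so the colors stay
  distinct.\<close>

lemma rainbow_path_if_rwalk:
  assumes "wf_digraph G" "rwalk (adj G) \<chi> u S v" "u \<in> verts G"
  shows "\<exists>p. rainbow_path G \<chi> u p v"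
proof -
  interpret wf_digraph G
    by (rule assms)
  have "\<exists>p. awalk u p v \<and> distinct (map (\<chi> \<circ> uedge G) p) \<and> (\<chi> \<circ> uedge G) ` set p = S"
    using assms(2,3)
  proof induction
    case (nil u)
    then show ?case
      by (intro exI[of _ "[]"]) (simp add: awalk_Nil_iff)
  next
    case (step u v S w)
    obtain a where a: "a \<in> arcs G" "tail G a = u" "head G a = v"
      using step(1) by (auto simp: adj_def arcs_ends_conv)
    have "v \<in> verts G"
      using a by auto
    then obtain p where "awalk v p w" "distinct (map (\<chi> \<circ> uedge G) p)" "(\<chi> \<circ> uedge G) ` set p = S"
      using step.IH by blast
    then show ?case
      using a step(3) by (intro exI[of _ "a # p"]) (auto simp: awalk_Cons_iff uedge_def comp_def)
  qed
  then obtain p where p: "awalk u p v" "distinct (map (\<chi> \<circ> uedge G) p)"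
    by blast
  let ?q = "awalk_to_apath p"
  have q: "apath u ?q v" "set ?q \<subseteq> set p"
    using apath_awalk_to_apath[OF p(1)] awalk_to_apath_subset[OF p(1)] by auto
  then have "distinct ?q"
    by (auto simp: apath_def awalk_def intro: distinct_verts_imp_distinct)
  then have "distinct (map (\<chi> \<circ> uedge G) ?q)"
    using p(2) q(2) by (auto simp: distinct_map intro: inj_on_subset)
  then show ?thesis
    using q(1) by (auto simp: rainbow_path_def)
qed

lemma rainbow_connected_iff:
  assumes "wf_digraph G"
  shows "rainbow_connected G \<chi> \<longleftrightarrow> (\<forall>u\<in>verts G. \<forall>v\<in>verts G. \<exists>S. rwalk (adj G) \<chi> u S v)"
  using rwalk_if_rainbow_path[OF assms] rainbow_path_if_rwalk[OF assms]
  unfolding rainbow_connected_def by blast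

lemma rainbow_connected_if_inj:
  assumes G: "graph G" and "Digraph_Component.connected G" "inj_on \<chi> (uedges G)"
  shows "rainbow_connected G \<chi>"
  unfolding rainbow_connected_iff[OF wf_digraph_graph[OF G]]
proof (intro ballI)
  fix u v
  assume "u \<in> verts G" "v \<in> verts G"
  then have "(\<lambda>a b. adj G a b \<and> a \<in> verts G \<and> b \<in> verts G)\<^sup>*\<^sup>* u v"
    using assms(2) connected_iff_conn[OF wf_digraph_graph[OF G] symp_adj[OF G]]
    by (simp add: conn_def)
  then have "(adj G)\<^sup>*\<^sup>* u v"
    by (rule rtranclp_weaken) simp
  then obtain zs where zs: "successively (adj G) (u # zs)" "distinct (u # zs)" "last (u # zs) = v"
    by (rule rtranclp_distinct_path)
  have edge: "{a, b} \<in> uedges G" if "adj G a b" for a b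
    using that by (auto simp: adj_def arcs_ends_conv uedges_def uedge_def)
  \<comment> \<open>The colors used stem from edges inside the remaining path. The edge to a new
    vertex u is none of these, so injectivity makes its color fresh.\<close>
  have "\<exists>S. rwalk (adj G) \<chi> u S v \<and> S \<subseteq> \<chi> ` {e \<in> uedges G. e \<subseteq> set (u # zs)}"
    using zs
  proof (induction zs arbitrary: u)
    case Nil
    then show ?case
      by (auto intro: rwalk.nil)
  next
    case (Cons z zs)
    have "successively (adj G) (z # zs)" "distinct (z # zs)" "last (z # zs) = v"
      using Cons.prems by auto
    then obtain S where S: "rwalk (adj G) \<chi> z S v" "S \<subseteq> \<chi> ` {e \<in> uedges G. e \<subseteq> set (z # zs)}"
      using Cons.IH by blast
    have uz: "adj G u z" "u \<notin> set (z # zs)"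
      using Cons.prems by auto
    have "\<chi> {u, z} \<notin> S"
    proof
      assume "\<chi> {u, z} \<in> S"
      then obtain e where e: "e \<in> uedges G" "e \<subseteq> set (z # zs)" "\<chi> {u, z} = \<chi> e"
        using S(2) by auto
      then have "e = {u, z}"
        using assms(3) edge[OF uz(1)] by (auto dest: inj_onD)
      then show False
        using e(2) uz(2) by auto
    qed
    with uz(1) S(1) have "rwalk (adj G) \<chi> u (insert (\<chi> {u, z}) S) v"
      by (rule rwalk.step)
    moreover have "insert (\<chi> {u, z}) S \<subseteq> \<chi> ` {e \<in> uedges G. e \<subseteq> set (u # z # zs)}"
    proof -
      have "\<chi> ` {e \<in> uedges G. e \<subseteq> set (z # zs)} \<subseteq> \<chi> ` {e \<in> uedges G. e \<subseteq> set (u # z # zs)}"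
        by (rule image_mono) auto
      then show ?thesis
        using S(2) edge[OF uz(1)] by auto
    qed
    ultimately show ?case
      by blast
  qed
  then show "\<exists>S. rwalk (adj G) \<chi> u S v"
    by blast
qed

text \<open>Connectedness makes every injective coloring rainbow, so the set of attainable numbers
  is nonempty and the \<open>LEAST\<close> in \<open>rc\<close> is attained.\<close>

lemma rc_le_iff:
  assumes G: "graph G" and "Digraph_Component.connected G"
  shows "rc G \<le> k \<longleftrightarrow> (\<exists>\<chi>. card (\<chi> ` uedges G) \<le> k \<and> rainbow_connected G \<chi>)"
proof -
  let ?P = "\<lambda>m. \<exists>\<chi>. rainbow_connected G \<chi> \<and> card (\<chi> ` uedges G) = m"
  have "finite (uedges G)"
    using G by (simp add: uedges_def graph_def digraph_def fin_digraph.finite_arcs)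
  then obtain \<chi> :: "'a set \<Rightarrow> nat" where "inj_on \<chi> (uedges G)"
    using finite_imp_inj_to_nat_seg[of "uedges G"] by auto
  then have "rainbow_connected G \<chi>"
    by (rule rainbow_connected_if_inj[OF assms])
  then have "?P (card (\<chi> ` uedges G))"
    by auto
  then have least: "?P (rc G)"
    unfolding rc_def by (rule LeastI[of ?P])
  show ?thesis
  proof
    assume "rc G \<le> k"
    moreover obtain \<chi> where "rainbow_connected G \<chi>" "card (\<chi> ` uedges G) = rc G"
      using least by auto
    ultimately show "\<exists>\<chi>. card (\<chi> ` uedges G) \<le> k \<and> rainbow_connected G \<chi>"
      by (intro exI[of _ \<chi>]) simp
  next
    assume "\<exists>\<chi>. card (\<chi> ` uedges G) \<le> k \<and> rainbow_connected G \<chi>"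
    then obtain \<chi> where \<chi>: "card (\<chi> ` uedges G) \<le> k" "rainbow_connected G \<chi>"
      by auto
    have "rc G \<le> card (\<chi> ` uedges G)"
      unfolding rc_def by (rule Least_le) (use \<chi>(2) in auto)
    then show "rc G \<le> k"
      using \<chi>(1) by simp
  qed
qed


section \<open>Block graphs of radius two\<close>

locale sgraph =
  fixes n :: nat and E :: "nat \<Rightarrow> nat \<Rightarrow> bool"
  assumes E_less: "E u v \<Longrightarrow> u < n \<and> v < n"
    and E_sym: "E u v \<Longrightarrow> E v u"
    and E_irrefl: "\<not> E v v"

text \<open>Around a root, this is an equivalence relation on the neighbours of the root
  (\<open>near_trans\<close>) and on the far vertices (\<open>far_trans\<close>). Its classes are
  the blocks without their vertex nearest to the root.\<close>

definition same_block :: "(nat \<Rightarrow> nat \<Rightarrow> bool) \<Rightarrow> nat \<Rightarrow> nat \<Rightarrow> bool" where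
  "same_block E x y \<longleftrightarrow> x = y \<or> E x y"

definition far :: "(nat \<Rightarrow> nat \<Rightarrow> bool) \<Rightarrow> nat \<Rightarrow> nat \<Rightarrow> bool" where
  "far E c w \<longleftrightarrow> w \<noteq> c \<and> \<not> E c w"

text \<open>First-order description of a connected block graph with all vertices within distance 2
  of c: the walks in \<open>locally_separated\<close> are replaced by closure conditions on two
  levels. The two directions are \<open>rooted_if_within_two\<close> and the lemma
  \<open>locally_separated\<close> of the locale below. Bounded quantifiers let the definition match
  a formula literally.\<close>

definition rooted :: "(nat \<Rightarrow> nat \<Rightarrow> bool) \<Rightarrow> nat \<Rightarrow> nat \<Rightarrow> bool" where
  "rooted E n c \<longleftrightarrow>
    (\<forall>w<n. far E c w \<longrightarrow> (\<exists>p<n. E c p \<and> E p w)) \<and>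
    (\<forall>w<n. \<forall>p<n. \<forall>p'<n. far E c w \<longrightarrow> E c p \<longrightarrow> E p w \<longrightarrow> E c p' \<longrightarrow> E p' w \<longrightarrow> p = p') \<and>
    (\<forall>x<n. \<forall>y<n. \<forall>z<n. E c x \<longrightarrow> E c y \<longrightarrow> E c z \<longrightarrow> E x y \<longrightarrow> E y z \<longrightarrow> same_block E x z) \<and>
    (\<forall>w<n. \<forall>w'<n. \<forall>p<n. far E c w \<longrightarrow> far E c w' \<longrightarrow> E w w' \<longrightarrow> E c p \<longrightarrow> E p w \<longrightarrow> E p w') \<and>
    (\<forall>x<n. \<forall>y<n. \<forall>z<n. far E c x \<longrightarrow> far E c y \<longrightarrow> far E c z \<longrightarrow> E x y \<longrightarrow> E y z \<longrightarrow> same_block E x z)"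

lemma same_block_refl [simp]: "same_block E x x"
  by (simp add: same_block_def)

locale rooted_graph = sgraph +
  fixes c :: nat
  assumes c_less: "c < n"
    and rooted: "rooted E n c"
begin

definition par :: "nat \<Rightarrow> nat" where
  "par w = (THE p. E c p \<and> E p w)"

lemma ex_par: "w < n \<Longrightarrow> far E c w \<Longrightarrow> \<exists>p. E c p \<and> E p w"
  using rooted[unfolded rooted_def, THEN conjunct1] by blast

lemma unique_par: "far E c w \<Longrightarrow> E c p \<Longrightarrow> E p w \<Longrightarrow> E c p' \<Longrightarrow> E p' w \<Longrightarrow> p = p'"
  using rooted[unfolded rooted_def, THEN conjunct2, THEN conjunct1] E_less by blast

lemma near_trans':
  "E c x \<Longrightarrow> E c y \<Longrightarrow> E c z \<Longrightarrow> E x y \<Longrightarrow> E y z \<Longrightarrow> same_block E x z"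
  using rooted[unfolded rooted_def, THEN conjunct2, THEN conjunct2, THEN conjunct1] E_less by blast

lemma par_nbr: "far E c w \<Longrightarrow> far E c w' \<Longrightarrow> E w w' \<Longrightarrow> E c p \<Longrightarrow> E p w \<Longrightarrow> E p w'"
  using rooted[unfolded rooted_def, THEN conjunct2, THEN conjunct2, THEN conjunct2, THEN conjunct1]
    E_less by blast

lemma far_trans':
  "far E c x \<Longrightarrow> far E c y \<Longrightarrow> far E c z \<Longrightarrow> E x y \<Longrightarrow> E y z \<Longrightarrow> same_block E x z"
  using rooted[unfolded rooted_def, THEN conjunct2, THEN conjunct2, THEN conjunct2, THEN conjunct2]
    E_less by blast

lemma near_trans:
  "E c x \<Longrightarrow> E c y \<Longrightarrow> E c z \<Longrightarrow> same_block E x y \<Longrightarrow> same_block E y z \<Longrightarrow> same_block E x z"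
  using near_trans' unfolding same_block_def by blast

lemma far_trans:
  "far E c x \<Longrightarrow> far E c y \<Longrightarrow> far E c z \<Longrightarrow> same_block E x y \<Longrightarrow> same_block E y z \<Longrightarrow> same_block E x z"
  using far_trans' unfolding same_block_def by blast

lemma par_unique: "far E c w \<Longrightarrow> E c p \<Longrightarrow> E p w \<Longrightarrow> par w = p"
  unfolding par_def using unique_par by (intro the_equality) auto

lemma par:
  assumes "w < n" "far E c w"
  shows "E c (par w)" "E (par w) w"
proof -
  obtain p where "E c p" "E p w"
    using ex_par assms by blast
  then show "E c (par w)" "E (par w) w"
    using par_unique[OF assms(2)] by auto
qed

lemma same_block_sym: "same_block E x y \<Longrightarrow> same_block E y x"
  using E_sym unfolding same_block_def by blast

lemma par_eq: "far E c w \<Longrightarrow> far E c w' \<Longrightarrow> E w w' \<Longrightarrow> par w = par w'"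
proof -
  assume a: "far E c w" "far E c w'" "E w w'"
  then have l: "w < n" "w' < n"
    using E_less by auto
  then have "E (par w) w'"
    using par_nbr[OF a] par[OF l(1) a(1)] by blast
  then show ?thesis
    using par_unique[OF a(2)] par[OF l(1) a(1)] by simp
qed

text \<open>Hence the vertices below a neighbour p of the root can be left only through p, which all
  later arguments about leaving a branch rely on.\<close>

lemma far_nbr: "far E c w \<Longrightarrow> E w x \<Longrightarrow> x = par w \<or> far E c x \<and> par x = par w"
  using par_eq par_unique E_less E_sym unfolding far_def by metis

text \<open>The cases are the level of p. For each, an invariant confines the walk that avoids p to
  a region in which all neighbours of p belong to one block.\<close>

lemma locally_separated: "locally_separated E"
  unfolding locally_separated_def
proof (intro allI impI notI)
  \<comment> \<open>From a far vertex below p, a walk that avoids p never leaves the block of that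
    vertex.\<close>
  have far_case: False if "E x p" "E p y" "x \<noteq> y" "\<not> E x y" "avoids E p y x" "far E c y" "E c p" for x p y
  proof -
    have "far E c a \<and> same_block E y a" if "avoids E p y a" for a
      using that unfolding avoids_def
    proof (induction rule: rtranclp_induct)
      case base
      then show ?case
        using \<open>far E c y\<close> by simp
    next
      case (step a b)
      have "par y = p"
        using par_unique \<open>far E c y\<close> \<open>E c p\<close> \<open>E p y\<close> by blast
      then have "par a = p"
        using step.IH \<open>far E c y\<close> par_eq unfolding same_block_def by metis
      then have "far E c b"
        using far_nbr step by blast
      then show ?case
        using far_trans \<open>far E c y\<close> step unfolding same_block_def by blast
    qed
    then show False
      using that E_sym unfolding same_block_def by blast
  qed
  fix x p y
  assume *: "E x p" "E p y" "x \<noteq> y" "\<not> E x y" "avoids E p x y"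
  have sep': "avoids E p y x"
  proof -
    have "symp (\<lambda>a b. E a b \<and> a \<noteq> p \<and> b \<noteq> p)"
      using E_sym by (auto simp: symp_def)
    then show ?thesis
      using *(5) unfolding avoids_def by (rule rtranclp_symp)
  qed
  consider "p = c" | "E c p" | "far E c p"
    unfolding far_def by blast
  then show False
  proof cases
    case 1
    \<comment> \<open>Invariant for p = c: the walk stays in the branch of x, that is, each of its
      vertices or the parent of that vertex lies in the block of x.\<close>
    define br where "br a \<longleftrightarrow> E c a \<and> same_block E x a \<or> far E c a \<and> same_block E x (par a)" for a
    have "br a" if "avoids E p x a" for a
      using that unfolding avoids_def
    proof (induction rule: rtranclp_induct)
      case base
      then show ?case
        using * 1 E_sym by (simp add: br_def)
    next
      case (step a b)
      have cx: "E c x"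
        using * 1 E_sym by blast
      have ab: "E a b" "a \<noteq> c" "b \<noteq> c"
        using step 1 by auto
      show ?case
      proof (cases "far E c a")
        case True
        then have "same_block E x (par a)"
          using step.IH by (auto simp: br_def far_def)
        then show ?thesis
          using far_nbr[OF True ab(1)] par(1)[OF _ True] E_less ab(1) by (auto simp: br_def)
      next
        case False
        then have ca: "E c a"
          using ab by (auto simp: far_def)
        then have xa: "same_block E x a"
          using step.IH False by (auto simp: br_def)
        show ?thesis
        proof (cases "far E c b")
          case True
          then have "par b = a"
            using par_unique True ca ab(1) by blast
          then show ?thesis
            using True xa by (simp add: br_def)
        next
          case False
          then have "E c b"
            using ab by (auto simp: far_def)
          then show ?thesis
            using near_trans[OF cx ca _ xa] ab(1) by (auto simp: br_def same_block_def)
        qed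
      qed
    qed
    then have "br y"
      using *(5) by blast
    then show False
      using *(2,3,4) 1 by (auto simp: br_def far_def same_block_def)
  next
    case 2
    show False
    proof (cases "far E c y")
      case True
      then show False
        using far_case[OF *(1-4) sep' _ 2] by blast
    next
      case False
      then have "far E c x"
        using * 2 near_trans[of x p y] E_sym E_irrefl unfolding far_def same_block_def by metis
      then show False
        using far_case[of y p x] * E_sym 2 by blast
    qed
  next
    case 3
    have "x = par p \<or> far E c x \<and> par x = par p" "y = par p \<or> far E c y \<and> par y = par p"
      using far_nbr 3 * E_sym by blast+
    then show False
      using * far_trans[of x p y] par(2) 3 E_sym E_less unfolding same_block_def by metis
  qed
qed

end

definition within_two :: "(nat \<Rightarrow> nat \<Rightarrow> bool) \<Rightarrow> nat \<Rightarrow> nat \<Rightarrow> bool" where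
  "within_two E n c \<longleftrightarrow> (\<forall>w<n. far E c w \<longrightarrow> (\<exists>p. E c p \<and> E p w))"

context sgraph
begin

lemma avoids_step: "E a b \<Longrightarrow> a \<noteq> p \<Longrightarrow> b \<noteq> p \<Longrightarrow> avoids E p a b"
  unfolding avoids_def by (rule r_into_rtranclp) simp

lemma avoids_trans: "avoids E p a b \<Longrightarrow> avoids E p b d \<Longrightarrow> avoids E p a d"
  unfolding avoids_def by (rule rtranclp_trans)

lemma separatedD:
  assumes "locally_separated E" "avoids E p x y" "E x p" "E p y" "x \<noteq> y"
  shows "E x y"
  using assms unfolding locally_separated_def by blast

text \<open>A failing clause would produce two nonadjacent neighbours of one vertex that are joined
  off that vertex, by a detour over c or over a parent.\<close>

lemma rooted_if_within_two:
  assumes sep: "locally_separated E" and c: "c < n" and two: "within_two E n c"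
  shows "rooted E n c"
proof -
  have uniq: "p = p'" if "far E c w" "E c p" "E p w" "E c p'" "E p' w" for w p p'
  proof (rule ccontr)
    assume "p \<noteq> p'"
    then have "avoids E p w p'" "avoids E p p' c"
      using that E_sym E_irrefl by (auto intro!: avoids_step)
    then have "E w c"
      using separatedD[OF sep avoids_trans, of p w p' c] that E_sym unfolding far_def by blast
    then show False
      using that E_sym unfolding far_def by blast
  qed
  have near: "same_block E x z" if "E c x" "E c y" "E c z" "E x y" "E y z" for x y z
  proof -
    have "avoids E y x c" "avoids E y c z"
      using that E_sym E_irrefl by (auto intro!: avoids_step)
    then show ?thesis
      using separatedD[OF sep avoids_trans, of y x c z] that unfolding same_block_def by blast
  qed
  have same: "E p w'" if "far E c w" "far E c w'" "E w w'" "E c p" "E p w" for w w' p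
  proof (rule ccontr)
    assume no: "\<not> E p w'"
    obtain p' where p': "E c p'" "E p' w'"
      using two \<open>far E c w'\<close> \<open>E w w'\<close> E_less unfolding within_two_def by blast
    have "p \<noteq> p'"
      using no p' by auto
    have ne: "p \<noteq> w" "p \<noteq> w'" "p \<noteq> c"
      using that E_irrefl unfolding far_def by auto
    have "avoids E p w w'" "avoids E p w' p'" "avoids E p p' c"
      using that p' ne \<open>p \<noteq> p'\<close> E_sym by (auto intro!: avoids_step)
    then have "avoids E p w c"
      using avoids_trans by blast
    then have "E w c"
      using separatedD[OF sep, of p w c] that E_sym unfolding far_def by blast
    then show False
      using that E_sym unfolding far_def by blast
  qed
  have far: "same_block E x z" if "far E c x" "far E c y" "far E c z" "E x y" "E y z" for x y z
  proof -
    obtain p where p: "E c p" "E p x"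
      using two \<open>far E c x\<close> \<open>E x y\<close> E_less unfolding within_two_def by blast
    then have "E p y" "E p z"
      using same that by blast+
    moreover have "p \<noteq> y"
      using p that unfolding far_def by auto
    ultimately have "avoids E y x p" "avoids E y p z"
      using p that E_sym E_irrefl by (auto intro!: avoids_step)
    then show ?thesis
      using separatedD[OF sep avoids_trans, of y x p z] that unfolding same_block_def by blast
  qed
  have ex: "\<exists>p<n. E c p \<and> E p w" if "w < n" "far E c w" for w
    using two that E_less unfolding within_two_def by blast
  show ?thesis
    unfolding rooted_def
    apply (intro conjI allI impI)
    subgoal using ex by blast
    subgoal using uniq by blast
    subgoal using near by blast
    subgoal using same by blast
    subgoal using far by blast
    done
qed

lemma walk_through_or_avoids:
  assumes "(E ^^ k) z x" "z \<noteq> c" "x \<noteq> c"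
  shows "avoids E c z x \<or> (\<exists>i j. i + j = k \<and> (E ^^ i) z c \<and> (E ^^ j) c x)"
  using assms
proof (induction k arbitrary: x)
  case 0
  then show ?case
    by (simp add: avoids_def)
next
  case (Suc k)
  then obtain y where y: "(E ^^ k) z y" "E y x"
    by auto
  show ?case
  proof (cases "y = c")
    case True
    then show ?thesis
      using y by (intro disjI2 exI[of _ k] exI[of _ 1]) auto
  next
    case False
    then consider "avoids E c z y" | i j where "i + j = k" "(E ^^ i) z c" "(E ^^ j) c y"
      using Suc y by blast
    then show ?thesis
    proof cases
      case 1
      then show ?thesis
        using avoids_trans avoids_step y(2) False Suc.prems by blast
    next
      case 2
      then show ?thesis
        using y(2) by (intro disjI2 exI[of _ i] exI[of _ "Suc j"]) auto
    qed
  qed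
qed

definition walks_le :: "nat \<Rightarrow> nat \<Rightarrow> nat \<Rightarrow> bool" where
  "walks_le k u v \<longleftrightarrow> (\<exists>i\<le>k. (E ^^ i) u v)"

lemma walks_le_sym: "walks_le k u v \<Longrightarrow> walks_le k v u"
proof -
  have "(E ^^ i) v u" if "(E ^^ i) u v" for i u v
    using that
  proof (induction i arbitrary: v)
    case (Suc i)
    then obtain w where "(E ^^ i) u w" "E w v"
      by auto
    then show ?case
      using Suc.IH E_sym by (metis relpowp_Suc_I2)
  qed simp
  then show "walks_le k u v \<Longrightarrow> walks_le k v u"
    unfolding walks_le_def by blast
qed

lemma walks_le_Suc: "walks_le (Suc k) u v \<longleftrightarrow> walks_le k u v \<or> (\<exists>w. walks_le k u w \<and> E w v)"
proof
  assume "walks_le (Suc k) u v"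
  then obtain i where i: "i \<le> Suc k" "(E ^^ i) u v"
    unfolding walks_le_def by blast
  show "walks_le k u v \<or> (\<exists>w. walks_le k u w \<and> E w v)"
  proof (cases "i \<le> k")
    case True
    then show ?thesis
      using i unfolding walks_le_def by blast
  next
    case False
    then have "(E ^^ Suc k) u v"
      using i le_Suc_eq by blast
    then show ?thesis
      unfolding walks_le_def by auto
  qed
next
  assume "walks_le k u v \<or> (\<exists>w. walks_le k u w \<and> E w v)"
  then show "walks_le (Suc k) u v"
  proof
    assume "walks_le k u v"
    then show ?thesis
      unfolding walks_le_def using le_SucI by blast
  next
    assume "\<exists>w. walks_le k u w \<and> E w v"
    then obtain i w where "i \<le> k" "(E ^^ i) u w" "E w v"
      unfolding walks_le_def by blast
    then have "(E ^^ Suc i) u v" "Suc i \<le> Suc k"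
      by auto
    then show ?thesis
      unfolding walks_le_def by blast
  qed
qed

lemma walks_le_0: "walks_le 0 u v \<longleftrightarrow> u = v"
  by (simp add: walks_le_def)

lemma walks_le_mono: "walks_le k u v \<Longrightarrow> k \<le> l \<Longrightarrow> walks_le l u v"
  unfolding walks_le_def using le_trans by blast

text \<open>The third vertex of a longest geodesic is a centre: a vertex at distance more than 2 from it
  would be separated by it from one of the two ends and hence be too far from that end.\<close>

lemma ex_center:
  assumes sep: "locally_separated E" and "0 < n"
    and diam: "\<And>u v. u < n \<Longrightarrow> v < n \<Longrightarrow> walks_le 4 u v"
  shows "\<exists>c<n. within_two E n c"
proof (cases "\<forall>v<n. walks_le 2 0 v")
  case True
  have "within_two E n 0"
    unfolding within_two_def
  proof (intro allI impI)
    fix w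
    assume "w < n" "far E 0 w"
    then have "walks_le (Suc (Suc 0)) 0 w" "w \<noteq> 0" "\<not> E 0 w"
      using True by (simp_all add: numeral_2_eq_2 far_def)
    then show "\<exists>p. E 0 p \<and> E p w"
      unfolding walks_le_Suc walks_le_0 by blast
  qed
  then show ?thesis
    using \<open>0 < n\<close> by blast
next
  case False
  have two: "within_two E n c" if "\<And>w. w < n \<Longrightarrow> walks_le 2 c w" for c
    unfolding within_two_def
  proof (intro allI impI)
    fix w
    assume "w < n" "far E c w"
    then have "walks_le (Suc (Suc 0)) c w" "w \<noteq> c" "\<not> E c w"
      using that by (simp_all add: numeral_2_eq_2 far_def)
    then show "\<exists>p. E c p \<and> E p w"
      unfolding walks_le_Suc walks_le_0 by blast
  qed
  \<comment> \<open>\<open>D\<close> is the diameter, which is 3 or 4 in this case, and x, y are at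
    distance \<open>D\<close>. On a geodesic, c will be at distance 2 from x and
    \<open>D - 2\<close> from y.\<close>
  define D where "D = (if \<exists>u<n. \<exists>v<n. \<not> walks_le 3 u v then 4 else 3 :: nat)"
  have D: "D = 3 \<or> D = 4"
    by (simp add: D_def)
  have diam': "walks_le D u v" if "u < n" "v < n" for u v
    using diam that by (auto simp: D_def)
  obtain x y where xy: "x < n" "y < n" "\<not> walks_le (D - 1) x y"
  proof (cases "\<exists>u<n. \<exists>v<n. \<not> walks_le 3 u v")
    case True
    then show ?thesis
      using that by (auto simp: D_def)
  next
    case no: False
    then have "D - 1 = 2"
      by (simp add: D_def)
    then show ?thesis
      using that[of 0] False \<open>0 < n\<close> by auto
  qed
  let ?k = "D - 3"
  have D1: "D - 1 = Suc (Suc ?k)" and D2: "D - 2 = Suc ?k"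
    using D by auto
  have nyx: "\<not> walks_le (Suc (Suc ?k)) y x"
    using xy walks_le_sym unfolding D1 by blast
  moreover have "walks_le (Suc (Suc (Suc ?k))) y x"
  proof -
    have "Suc (Suc (Suc ?k)) = D"
      using D by auto
    then show ?thesis
      using diam'[OF xy(2,1)] by simp
  qed
  ultimately obtain a where a: "walks_le (Suc (Suc ?k)) y a" "E a x"
    unfolding walks_le_Suc[of "Suc (Suc ?k)"] by blast
  have nya: "\<not> walks_le (Suc ?k) y a"
    using nyx a(2) unfolding walks_le_Suc[of "Suc ?k"] by blast
  then obtain c where c: "walks_le (Suc ?k) y c" "E c a"
    using a(1) unfolding walks_le_Suc[of "Suc ?k"] by blast
  have nyc: "\<not> walks_le ?k y c"
    using nya c(2) unfolding walks_le_Suc[of ?k] by blast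
  then obtain b where b: "walks_le ?k y b" "E b c"
    using c(1) unfolding walks_le_Suc[of ?k] by blast
  note abc = b c(2) a(2)
  have bc: "walks_le (D - 2) y c"
    unfolding D2 by (rule c(1))
  have "\<not> E b a"
    using nya b(1) unfolding walks_le_Suc[of ?k] by blast
  have "a \<noteq> b"
    using nya b(1) unfolding walks_le_Suc[of ?k] by blast
  have c_less: "c < n"
    using abc E_less by blast
  have ncx: "\<not> walks_le 1 c x"
  proof
    assume "walks_le 1 c x"
    then have "c = x \<or> E c x"
      using walks_le_Suc[of 0] walks_le_0 by auto
    then show False
      using nyx c(1) unfolding walks_le_Suc[of "Suc ?k"] by blast
  qed
  have ne: "x \<noteq> c" "y \<noteq> c" "a \<noteq> c" "b \<noteq> c"
    using ncx nyc abc E_irrefl unfolding walks_le_def by (auto intro: exI[of _ 0])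
  \<comment> \<open>If z were more than 2 away from c, a walk over c from z to x would have length
    at least 3 + 2, and one to y at least 3 + (D - 2), both above D. So x and y are joined off c,
    and with them the geodesic neighbours a and b of c, which are not adjacent.\<close>
  have "walks_le 2 c z" if z: "z < n" for z
  proof (rule ccontr)
    assume no: "\<not> walks_le 2 c z"
    have zc: "z \<noteq> c"
      using no unfolding walks_le_def by auto
    have no': "3 \<le> i" if "(E ^^ i) z c" for i
    proof (rule ccontr)
      assume "\<not> 3 \<le> i"
      then have "walks_le 2 z c"
        using that unfolding walks_le_def by (intro exI[of _ i]) simp
      then show False
        using no walks_le_sym by blast
    qed
    have zx: "avoids E c z x"
    proof -
      obtain k where k: "k \<le> D" "(E ^^ k) z x"
        using diam'[OF z xy(1)] unfolding walks_le_def by blast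
      have "\<not> (\<exists>i j. i + j = k \<and> (E ^^ i) z c \<and> (E ^^ j) c x)"
      proof
        assume "\<exists>i j. i + j = k \<and> (E ^^ i) z c \<and> (E ^^ j) c x"
        then obtain i j where ij: "i + j = k" "(E ^^ i) z c" "(E ^^ j) c x"
          by blast
        have "\<not> j \<le> 1"
          using ij(3) ncx unfolding walks_le_def by blast
        then show False
          using no'[OF ij(2)] ij(1) k(1) D by auto
      qed
      then show ?thesis
        using walk_through_or_avoids[OF k(2) zc ne(1)] by blast
    qed
    have zy: "avoids E c z y"
    proof -
      obtain k where k: "k \<le> D" "(E ^^ k) z y"
        using diam'[OF z xy(2)] unfolding walks_le_def by blast
      have "\<not> (\<exists>i j. i + j = k \<and> (E ^^ i) z c \<and> (E ^^ j) c y)"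
      proof
        assume "\<exists>i j. i + j = k \<and> (E ^^ i) z c \<and> (E ^^ j) c y"
        then obtain i j where ij: "i + j = k" "(E ^^ i) z c" "(E ^^ j) c y"
          by blast
        have "\<not> j \<le> D - 3"
          using ij(3) nyc walks_le_sym[of "D - 3" c y] unfolding walks_le_def by blast
        then show False
          using no'[OF ij(2)] ij(1) k(1) by auto
      qed
      then show ?thesis
        using walk_through_or_avoids[OF k(2) zc ne(2)] by blast
    qed
    have yz: "avoids E c y z"
    proof -
      have "symp (\<lambda>a b. E a b \<and> a \<noteq> c \<and> b \<noteq> c)"
        using E_sym by (auto simp: symp_def)
      then show ?thesis
        using zy unfolding avoids_def by (rule rtranclp_symp)
    qed
    have xa: "avoids E c x a"
      using abc ne E_sym by (auto intro!: avoids_step)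
    have "avoids E c b y"
    proof -
      have "walks_le (D - 3) b y"
        using abc(1) walks_le_sym by blast
      then have "b = y \<or> E b y"
        using D walks_le_0 walks_le_Suc[of 0] by auto
      then show ?thesis
        using avoids_step[OF _ ne(4,2)] by (auto simp: avoids_def)
    qed
    then have "avoids E c b a"
      by (rule avoids_trans[OF _ avoids_trans[OF yz avoids_trans[OF zx xa]]])
    then show False
      using separatedD[OF sep] abc \<open>\<not> E b a\<close> \<open>a \<noteq> b\<close> by blast
  qed
  then show ?thesis
    using two c_less by blast
qed

end


section \<open>Upper bounds: explicit colorings\<close>

section \<open>Rainbow colorings\<close>

lemma rwalk_single: "R u v \<Longrightarrow> rwalk R \<chi> u {\<chi> {u, v}} v"
  using rwalk.step[OF _ rwalk.nil, of R u v \<chi>] by simp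

lemma rwalk_append:
  assumes "rwalk R \<chi> u S v" "rwalk R \<chi> v T w" "S \<inter> T = {}"
  shows "rwalk R \<chi> u (S \<union> T) w"
  using assms
proof (induction)
  case (step u v S w')
  then have "rwalk R \<chi> u (insert (\<chi> {u, v}) (S \<union> T)) w"
    by (intro rwalk.step) auto
  then show ?case
    by simp
qed simp

lemma rwalk_rev:
  assumes "\<And>x y. R x y \<Longrightarrow> R y x" "rwalk R \<chi> u S v"
  shows "rwalk R \<chi> v S u"
  using assms(2)
proof (induction)
  case (step u v S w)
  then have "rwalk R \<chi> w (S \<union> {\<chi> {v, u}}) u"
    by (intro rwalk_append[OF step.IH rwalk_single]) (auto simp: assms(1) insert_commute)
  then show ?case
    by (simp add: insert_commute)
qed (rule rwalk.nil)

definition edges :: "(nat \<Rightarrow> nat \<Rightarrow> bool) \<Rightarrow> nat set set" where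
  "edges E = {{u, v} | u v. E u v}"

definition rainbow_colorable :: "(nat \<Rightarrow> nat \<Rightarrow> bool) \<Rightarrow> nat \<Rightarrow> nat \<Rightarrow> bool" where
  "rainbow_colorable E n k \<longleftrightarrow>
    (\<exists>\<chi>. card (\<chi> ` edges E) \<le> k \<and> (\<forall>u<n. \<forall>v<n. \<exists>S. rwalk E \<chi> u S v))"

text \<open>\<open>Min\<close> and \<open>Max\<close> recover the two ends of an edge, so a
  symmetric \<open>f\<close> becomes a function on undirected edges.\<close>

definition coloring :: "(nat \<Rightarrow> nat \<Rightarrow> nat) \<Rightarrow> nat set \<Rightarrow> nat" where
  "coloring f e = f (Min e) (Max e)"

lemma coloring: "f u v = f v u \<Longrightarrow> coloring f {u, v} = f u v"
  by (cases "u \<le> v") (auto simp: coloring_def)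

context sgraph
begin

definition walk :: "(nat \<Rightarrow> nat \<Rightarrow> nat) \<Rightarrow> nat \<Rightarrow> nat set \<Rightarrow> nat \<Rightarrow> bool" where
  "walk f u S v \<longleftrightarrow> rwalk E (coloring f) u S v"

definition joined :: "(nat \<Rightarrow> nat \<Rightarrow> nat) \<Rightarrow> nat \<Rightarrow> nat \<Rightarrow> bool" where
  "joined f u v \<longleftrightarrow> (\<exists>S. walk f u S v)"

lemma walk_nil: "walk f u {} u"
  unfolding walk_def by (rule rwalk.nil)

lemma walk1: "E u v \<Longrightarrow> f u v = f v u \<Longrightarrow> walk f u {f u v} v"
  using rwalk_single[of E u v "coloring f"] by (simp add: walk_def coloring)

lemma walk_append: "walk f u S v \<Longrightarrow> walk f v T w \<Longrightarrow> S \<inter> T = {} \<Longrightarrow> walk f u (S \<union> T) w"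
  unfolding walk_def by (rule rwalk_append)

lemma walk_rev: "walk f u S v \<Longrightarrow> walk f v S u"
  unfolding walk_def using rwalk_rev[of E] E_sym by blast

lemma walk2:
  assumes "E u v" "E v w" "f u v = f v u" "f v w = f w v" "f u v \<noteq> f v w"
  shows "walk f u {f u v, f v w} w"
  using walk_append[OF walk1[OF assms(1,3)] walk1[OF assms(2,4)]] assms(5)
  by (simp add: insert_commute)

lemma joined_sym: "joined f u v \<Longrightarrow> joined f v u"
  unfolding joined_def using walk_rev by blast

lemma joined_refl: "joined f u u"
  unfolding joined_def using walk_nil by blast

lemma joined_edge: "E u v \<Longrightarrow> f u v = f v u \<Longrightarrow> joined f u v"
  unfolding joined_def using walk1 by blast

lemma joined_meet: "walk f u S c \<Longrightarrow> walk f v T c \<Longrightarrow> S \<inter> T = {} \<Longrightarrow> joined f u v"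
  unfolding joined_def using walk_append walk_rev by blast

lemma rainbow_colorable_if_joined:
  assumes "\<And>u v. u < n \<Longrightarrow> v < n \<Longrightarrow> u \<noteq> v \<Longrightarrow> joined f u v"
    and "\<And>u v. E u v \<Longrightarrow> f u v < k"
  shows "rainbow_colorable E n k"
  unfolding rainbow_colorable_def
proof (intro exI[of _ "coloring f"] conjI allI impI)
  have "coloring f ` edges E \<subseteq> {..<k}"
  proof (intro subsetI)
    fix x
    assume "x \<in> coloring f ` edges E"
    then obtain u v where uv: "E u v" "x = coloring f {u, v}"
      unfolding edges_def by blast
    have "{u, v} = {min u v, max u v}" "E (min u v) (max u v)"
      using uv(1) E_sym by (auto simp: min_def max_def)
    then have "x = f (min u v) (max u v)"
      using uv(2) by (simp add: coloring_def)
    then show "x \<in> {..<k}"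
      using assms(2) \<open>E (min u v) (max u v)\<close> by simp
  qed
  then show "card (coloring f ` edges E) \<le> k"
    using card_mono[of "{..<k}"] by fastforce
  show "\<exists>S. rwalk E (coloring f) u S v" if "u < n" "v < n" for u v
    using assms(1)[OF that] joined_refl[of f] unfolding joined_def walk_def by (cases "u = v") blast+
qed

lemma rainbow_colorable_complete:
  assumes "\<And>u v. u < n \<Longrightarrow> v < n \<Longrightarrow> same_block E u v"
  shows "rainbow_colorable E n 1"
proof (rule rainbow_colorable_if_joined[where f = "\<lambda>_ _. 0"])
  fix u v
  assume "u < n" "v < n" "u \<noteq> v"
  then have "E u v"
    using assms unfolding same_block_def by blast
  then show "joined (\<lambda>_ _. 0) u v"
    by (rule joined_edge) simp
qed simp

lemma rainbow_colorable_singleton: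
  assumes "\<And>u v. u < n \<Longrightarrow> v < n \<Longrightarrow> u = v"
  shows "rainbow_colorable E n 0"
proof (rule rainbow_colorable_if_joined[where f = "\<lambda>_ _. 0"])
  show "0 < (0::nat)" if "E u v" for u v
    using assms[of u v] E_less[OF that] that E_irrefl by auto
  show "joined (\<lambda>_ _. 0) u v" if "u < n" "v < n" "u \<noteq> v" for u v
    using assms that by blast
qed

end


section \<open>A clique with pendant blocks\<close>

text \<open>A clique \<open>B\<close> such that every other vertex lies in a block attached to
  \<open>B\<close> at exactly one vertex \<open>top u\<close>. This covers blocks sharing one
  vertex, with \<open>B\<close> a singleton, as well as the root block that contains all deep
  vertices.\<close>

locale pendant_clique = sgraph +
  fixes B :: "nat set" and top :: "nat \<Rightarrow> nat"
  assumes B_less: "b \<in> B \<Longrightarrow> b < n"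
    and B_clique: "b \<in> B \<Longrightarrow> b' \<in> B \<Longrightarrow> same_block E b b'"
    and top_B: "u < n \<Longrightarrow> top u \<in> B"
    and top_edge: "u < n \<Longrightarrow> u \<notin> B \<Longrightarrow> E u (top u)"
    and top_unique: "u \<notin> B \<Longrightarrow> b \<in> B \<Longrightarrow> E u b \<Longrightarrow> b = top u"
    and top_same: "u \<notin> B \<Longrightarrow> v \<notin> B \<Longrightarrow> E u v \<Longrightarrow> top u = top v"
    and top_id: "b \<in> B \<Longrightarrow> top b = b"
    and pendant_trans: "u \<notin> B \<Longrightarrow> v \<notin> B \<Longrightarrow> w \<notin> B \<Longrightarrow> E u v \<Longrightarrow> E v w \<Longrightarrow> same_block E u w"
    and triangles: "every_edge_in_triangle E"
begin

definition block :: "nat \<Rightarrow> nat set" where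
  "block u = {z. z \<notin> B \<and> z < n \<and> same_block E u z}"

text \<open>The minimum is an arbitrary choice of one representative in each pendant block.\<close>

definition special :: "nat \<Rightarrow> bool" where
  "special u \<longleftrightarrow> u = Min (block u)"

lemma finite_block: "finite (block u)"
  by (simp add: block_def)

lemma self_in_block: "u < n \<Longrightarrow> u \<notin> B \<Longrightarrow> u \<in> block u"
  by (simp add: block_def)

lemma block_eq: "u \<notin> B \<Longrightarrow> v \<notin> B \<Longrightarrow> E u v \<Longrightarrow> block u = block v"
  using pendant_trans E_sym unfolding block_def same_block_def by blast

lemma special_exists:
  assumes "u < n" "u \<notin> B"
  obtains s where "s \<in> block u" "special s"
proof
  let ?s = "Min (block u)"
  show s: "?s \<in> block u"
    using Min_in[OF finite_block] self_in_block[OF assms] by blast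
  then have "?s \<notin> B" "?s = u \<or> E u ?s"
    by (auto simp: block_def same_block_def)
  then have "block ?s = block u"
    using block_eq[of u ?s] assms(2) by metis
  then show "special ?s"
    by (simp add: special_def)
qed

lemma special_unique:
  assumes "u < n" "u \<notin> B" "v \<in> block u" "special u" "special v"
  shows "u = v"
proof -
  have "block u = block v"
    using assms block_eq[of u v] unfolding block_def same_block_def by blast
  then show ?thesis
    using assms(4,5) by (simp add: special_def)
qed

text \<open>The edge to the top lies in a triangle, whose third vertex is outside \<open>B\<close>
  because the top is the only neighbour in \<open>B\<close>.\<close>

lemma ex_other:
  assumes "u < n" "u \<notin> B"
  obtains v where "v \<in> block u" "v \<noteq> u"
proof -
  obtain z where z: "E u z" "E (top u) z"
    using triangles top_edge[OF assms] unfolding every_edge_in_triangle_def by blast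
  have "z \<notin> B"
    using top_unique[OF assms(2) _ z(1)] z(2) E_irrefl by blast
  then show thesis
    using that[of z] z(1) E_less E_irrefl unfolding block_def same_block_def by blast
qed

text \<open>The special vertex of a pendant block reaches the top with the colors {0} or {1, 2},
  every other vertex with {1} or {0, 2}. Any two pendant vertices thus have disjoint choices, and
  color 3 is kept for crossing \<open>B\<close>.\<close>

definition col4 :: "nat \<Rightarrow> nat \<Rightarrow> nat" where
  "col4 u v =
    (if u \<in> B then if v \<in> B then 3 else if special v then 0 else 1
     else if v \<in> B then if special u then 0 else 1 else 2)"

lemma col4_sym: "col4 u v = col4 v u"
  by (simp add: col4_def)

lemma special_walks:
  assumes "u < n" "u \<notin> B" "special u"
  shows "walk col4 u {0} (top u)" "walk col4 u {1, 2} (top u)"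
proof -
  show "walk col4 u {0} (top u)"
    using walk1[of u "top u" col4, OF top_edge[OF assms(1,2)] col4_sym] top_B[OF assms(1)] assms by (simp add: col4_def)
  obtain v where v: "v \<in> block u" "v \<noteq> u"
    using ex_other assms by blast
  then have uv: "E u v" "v \<notin> B" "v < n" "\<not> special v"
    using special_unique[OF assms(1,2) v(1)] assms(3) unfolding block_def same_block_def by auto
  then have "top v = top u"
    using top_same[OF assms(2)] by metis
  then have "walk col4 u {col4 u v, col4 v (top u)} (top u)"
    using uv top_edge[OF uv(3,2)] top_B[OF assms(1)] assms
    by (intro walk2) (auto simp: col4_def)
  then show "walk col4 u {1, 2} (top u)"
    using uv top_B[OF assms(1)] assms by (simp add: col4_def insert_commute)
qed

lemma nonspecial_walks:
  assumes "u < n" "u \<notin> B" "\<not> special u"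
  shows "walk col4 u {1} (top u)" "walk col4 u {0, 2} (top u)"
proof -
  show "walk col4 u {1} (top u)"
    using walk1[of u "top u" col4, OF top_edge[OF assms(1,2)] col4_sym] top_B[OF assms(1)] assms by (simp add: col4_def)
  obtain v where v: "v \<in> block u" "special v"
    using special_exists assms by blast
  then have uv: "E u v" "v \<notin> B" "v < n"
    using assms(3) unfolding block_def same_block_def by auto
  then have "top v = top u"
    using top_same[OF assms(2)] by metis
  then have "walk col4 u {col4 u v, col4 v (top u)} (top u)"
    using uv v(2) top_edge[OF uv(3,2)] top_B[OF assms(1)] assms
    by (intro walk2) (auto simp: col4_def)
  then show "walk col4 u {0, 2} (top u)"
    using uv v(2) top_B[OF assms(1)] assms by (simp add: col4_def insert_commute)
qed

lemma pendant_walks: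
  assumes "u < n" "u \<notin> B" "v < n" "v \<notin> B"
  obtains S T where "walk col4 u S (top u)" "walk col4 v T (top v)" "S \<inter> T = {}" "3 \<notin> S \<union> T"
proof -
  have *: "{0} \<inter> {1, 2} = ({} :: nat set)" "{1, 2} \<inter> {0} = ({} :: nat set)"
    "{1} \<inter> {0, 2} = ({} :: nat set)" "{0} \<inter> {1} = ({} :: nat set)" "{1} \<inter> {0} = ({} :: nat set)"
    by auto
  show thesis
    using special_walks[OF assms(1,2)] special_walks[OF assms(3,4)]
      nonspecial_walks[OF assms(1,2)] nonspecial_walks[OF assms(3,4)]
      that[of "{0}" "{1, 2}"] that[of "{1}" "{0, 2}"] that[of "{0}" "{1}"] that[of "{1}" "{0}"] *
    by (cases "special u"; cases "special v") auto
qed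

lemma col4_joined:
  assumes "u < n" "v < n"
  shows "joined col4 u v"
proof -
  have tops: "\<exists>X\<subseteq>{3}. walk col4 (top u) X (top v)" if "u < n" "v < n" for u v
  proof (cases "top u = top v")
    case True
    then show ?thesis
      using walk_nil[of col4 "top u"] by auto
  next
    case False
    then have "E (top u) (top v)"
      using B_clique top_B that unfolding same_block_def by blast
    then have "walk col4 (top u) {col4 (top u) (top v)} (top v)"
      by (rule walk1) (rule col4_sym)
    then show ?thesis
      using top_B that by (intro exI[of _ "{3}"]) (simp add: col4_def)
  qed
  have one: "joined col4 u v" if uv: "u < n" "v < n" "v \<in> B" for u v
  proof -
    obtain X where X: "X \<subseteq> {3}" "walk col4 (top u) X v"
      using tops[OF uv(1,2)] top_id[OF uv(3)] by auto
    show ?thesis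
    proof (cases "u \<in> B")
      case True
      then show ?thesis
        using X(2) top_id unfolding joined_def by auto
    next
      case False
      obtain S where S: "walk col4 u S (top u)" "3 \<notin> S"
        using pendant_walks[OF uv(1) False uv(1) False] by blast
      have "S \<inter> X = {}"
        using S(2) X(1) by auto
      then show ?thesis
        using walk_append[OF S(1) X(2)] unfolding joined_def by blast
    qed
  qed
  consider "u \<in> B" | "v \<in> B" | "u \<notin> B" "v \<notin> B"
    by blast
  then show ?thesis
  proof cases
    case 1
    then show ?thesis
      using one[OF assms(2,1)] joined_sym by blast
  next
    case 2
    then show ?thesis
      using one[OF assms] by blast
  next
    case 3
    obtain S T where ST: "walk col4 u S (top u)" "walk col4 v T (top v)" "S \<inter> T = {}" "3 \<notin> S \<union> T"
      using pendant_walks[OF assms(1) 3(1) assms(2) 3(2)] by blast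
    obtain X where X: "X \<subseteq> {3}" "walk col4 (top u) X (top v)"
      using tops[OF assms] by auto
    have "S \<inter> X = {}" "(S \<union> X) \<inter> T = {}"
      using ST(3,4) X(1) by auto
    then show ?thesis
      using joined_meet[OF walk_append[OF ST(1) X(2)] ST(2)] by blast
  qed
qed

lemma rainbow_colorable_4: "rainbow_colorable E n 4"
  by (rule rainbow_colorable_if_joined[where f = col4]) (use col4_joined in \<open>auto simp: col4_def\<close>)

text \<open>A single vertex in \<open>B\<close> leaves no edge for color 3.\<close>

lemma rainbow_colorable_3_star:
  assumes "B = {b}"
  shows "rainbow_colorable E n 3"
proof (rule rainbow_colorable_if_joined[where f = col4])
  show "col4 u v < 3" if "E u v" for u v
  proof -
    have "\<not> (u \<in> B \<and> v \<in> B)"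
      using that assms E_irrefl by auto
    then show ?thesis
      by (simp add: col4_def)
  qed
qed (use col4_joined in blast)

definition cuts :: "nat set" where
  "cuts = {b \<in> B. \<exists>u<n. u \<notin> B \<and> top u = b}"

text \<open>All edges of the single pendant block at b take the label of b, one of three. Edges
  between vertices of \<open>B\<close> avoid the labels of their ends, so every path through
  \<open>B\<close> that goes straight from top to top is rainbow.\<close>

lemma rainbow_colorable_3:
  assumes one: "\<And>u v. u < n \<Longrightarrow> v < n \<Longrightarrow> u \<notin> B \<Longrightarrow> v \<notin> B \<Longrightarrow> top u = top v \<Longrightarrow> same_block E u v"
    and three: "card cuts \<le> 3"
  shows "rainbow_colorable E n 3"
proof -
  have "finite cuts"
    unfolding cuts_def by (rule finite_subset[of _ "{..<n}"]) (auto dest: B_less)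
  then obtain l where l: "inj_on l cuts" "l ` cuts \<subseteq> {..<3 :: nat}"
    using card_le_inj[of cuts "{..<3 :: nat}"] three by auto
  have l3: "l b < 3" if "b \<in> cuts" for b
    using l(2) that by blast
  \<comment> \<open>Two cut vertices are joined in the third color, computed from 0 + 1 + 2 = 3. An
    edge with only one cut vertex just has to avoid its label.\<close>
  define g where "g b b' =
    (if b \<in> cuts then if b' \<in> cuts then 3 - (l b + l b') else if l b = 0 then 1 else 0
     else if b' \<in> cuts then if l b' = 0 then 1 else 0 else 0)" for b b'
  define f where "f u v =
    (if u \<in> B then if v \<in> B then g u v else l (top v) else l (top u))" for u v
  have g_sym: "g b b' = g b' b" for b b'
    by (simp add: g_def add.commute)
  have f_sym: "f u v = f v u" if "E u v" for u v
    using that top_same by (auto simp: f_def g_sym)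
  have top_cuts: "top u \<in> cuts" if "u < n" "u \<notin> B" for u
    using that top_B by (auto simp: cuts_def)
  have g_ne: "g b b' \<noteq> l b" if "b \<in> cuts" "b \<noteq> b'" for b b'
  proof -
    have "b' \<in> cuts \<Longrightarrow> l b \<noteq> l b'"
      using that inj_onD[OF l(1), of b b'] by blast
    then have "b' \<in> cuts \<Longrightarrow> 3 - (l b + l b') \<noteq> l b"
      using l3[OF that(1)] l3[of b'] by arith
    then show ?thesis
      using that by (auto simp: g_def)
  qed
  have g_ne': "g b b' \<noteq> l b'" if "b' \<in> cuts" "b \<noteq> b'" for b b'
    using g_ne[of b' b] that g_sym by auto
  have up: "walk f u {l (top u)} (top u)" if "u < n" "u \<notin> B" for u
  proof -
    have "f u (top u) = l (top u)"
      using that by (simp add: f_def)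
    then show ?thesis
      using walk1[of u "top u" f, OF top_edge[OF that] f_sym[OF top_edge[OF that]]] by simp
  qed
  have across: "walk f b {g b b'} b'" if "b \<in> B" "b' \<in> B" "b \<noteq> b'" for b b'
  proof -
    have e: "E b b'"
      using that B_clique unfolding same_block_def by blast
    have "f b b' = g b b'"
      using that by (simp add: f_def)
    then show ?thesis
      using walk1[of b b' f, OF e f_sym[OF e]] by simp
  qed
  have mixed: "joined f u b" if "u < n" "u \<notin> B" "b \<in> B" for u b
  proof (cases "top u = b")
    case True
    then show ?thesis
      using up[OF that(1,2)] unfolding joined_def by blast
  next
    case False
    have "walk f u ({l (top u)} \<union> {g (top u) b}) b"
      using g_ne[of "top u" b, OF top_cuts[OF that(1,2)] False]
      by (intro walk_append[OF up[OF that(1,2)] across[OF top_B[OF that(1)] that(3) False]]) auto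
    then show ?thesis
      unfolding joined_def by blast
  qed
  show ?thesis
  proof (rule rainbow_colorable_if_joined[where f = f])
    fix u v
    assume uv: "u < n" "v < n" "u \<noteq> v"
    consider "u \<in> B" "v \<in> B" | "u \<in> B" "v \<notin> B" | "u \<notin> B" "v \<in> B"
      | "u \<notin> B" "v \<notin> B" "top u = top v" | "u \<notin> B" "v \<notin> B" "top u \<noteq> top v"
      by blast
    then show "joined f u v"
    proof cases
      case 1
      then show ?thesis
        using across[OF 1 uv(3)] unfolding joined_def by blast
    next
      case 2
      then show ?thesis
        using mixed[OF uv(2) 2(2,1)] joined_sym by blast
    next
      case 3
      then show ?thesis
        using mixed[OF uv(1)] by blast
    next
      case 4
      then have "E u v"
        using one uv unfolding same_block_def by blast
      then show ?thesis
        using joined_edge f_sym by blast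
    next
      case 5
      have "walk f u ({l (top u)} \<union> {g (top u) (top v)}) (top v)"
        using g_ne[of "top u" "top v", OF top_cuts[OF uv(1) 5(1)] 5(3)]
        by (intro walk_append[OF up[OF uv(1) 5(1)] across[OF top_B[OF uv(1)] top_B[OF uv(2)] 5(3)]]) auto
      moreover have "l (top u) \<noteq> l (top v)"
        using inj_onD[OF l(1) _ top_cuts[OF uv(1) 5(1)] top_cuts[OF uv(2) 5(2)]] 5(3) by blast
      ultimately show ?thesis
        using g_ne'[of "top v" "top u", OF top_cuts[OF uv(2) 5(2)] 5(3)]
        by (intro joined_meet[OF _ up[OF uv(2) 5(2)]]) auto
    qed
  next
    fix u v
    assume "E u v"
    then have uv: "u < n" "v < n" "u \<noteq> v"
      using E_less E_irrefl by auto
    have "g u v < 3"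
    proof (cases "u \<in> cuts \<and> v \<in> cuts")
      case True
      then have "l u \<noteq> l v"
        using inj_onD[OF l(1), of u v] uv(3) by blast
      then show ?thesis
        using True by (simp add: g_def)
    qed (simp add: g_def)
    then show "f u v < 3"
      using l3 top_cuts[OF uv(1)] top_cuts[OF uv(2)] by (simp add: f_def)
  qed
qed

text \<open>At most two blocks meet at b; the edges from b into one of them get color 0 and into the
  other color 1.\<close>

lemma rainbow_colorable_2:
  assumes B: "B = {b}"
    and two: "\<And>x y z. x < n \<Longrightarrow> y < n \<Longrightarrow> z < n \<Longrightarrow> same_block E x y \<or> same_block E x z \<or> same_block E y z"
  shows "rainbow_colorable E n 2"
proof -
  have tb: "top u = b" if "u < n" for u
    using top_B[OF that] B by simp
  have "b < n"
    using B_less[of b] unfolding B by simp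
  \<comment> \<open>\<open>y0\<close> picks the block whose edges at b are colored 0; in a graph
    with the single vertex b it is b itself.\<close>
  then have "\<exists>y0<n. (\<exists>y<n. y \<noteq> b) \<longrightarrow> y0 \<noteq> b"
    by blast
  then obtain y0 where y0: "y0 < n" "(\<exists>y<n. y \<noteq> b) \<longrightarrow> y0 \<noteq> b"
    by blast
  define a where "a y = (if same_block E y0 y then 0 else 1 :: nat)" for y
  define f where "f u v = (if u = b then a v else if v = b then a u else 0)" for u v
  have f_sym: "f u v = f v u" for u v
    by (simp add: f_def)
  show ?thesis
  proof (rule rainbow_colorable_if_joined[where f = f])
    fix u v
    assume uv: "u < n" "v < n" "u \<noteq> v"
    show "joined f u v"
    proof (cases "E u v")
      case True
      then show ?thesis
        using joined_edge f_sym by blast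
    next
      case False
      have adj: "E w b" if "w < n" "w \<noteq> b" for w
        using top_edge[of w] tb[OF that(1)] that B by simp
      have nb: "u \<noteq> b" "v \<noteq> b"
        using uv adj[of u] adj[of v] E_sym False by auto
      then have ub: "E u b" "E v b"
        using uv adj by auto
      have "y0 \<noteq> b"
        using y0(2) uv nb by blast
      then have "y0 \<notin> B"
        using B by simp
      have "a u \<noteq> a v"
      proof -
        have "\<not> same_block E u v"
          using False uv(3) by (simp add: same_block_def)
        moreover have "same_block E u v" if "same_block E y0 u" "same_block E y0 v"
          using that pendant_trans[of u y0 v] \<open>y0 \<notin> B\<close> nb B E_sym unfolding same_block_def by blast
        ultimately show ?thesis
          using two[OF y0(1) uv(1,2)] unfolding a_def by auto
      qed
      then have "f u b \<noteq> f b v"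
        using nb by (simp add: f_def)
      then show ?thesis
        using walk2[of u b v f, OF ub(1) E_sym[OF ub(2)] f_sym f_sym] unfolding joined_def by blast
    qed
  qed (simp add: f_def a_def)
qed

end


section \<open>Four colors for radius two\<close>

definition deep :: "(nat \<Rightarrow> nat \<Rightarrow> bool) \<Rightarrow> nat \<Rightarrow> nat \<Rightarrow> nat \<Rightarrow> bool" where
  "deep E n c v \<longleftrightarrow> E c v \<and> (\<exists>w<n. far E c w \<and> E v w)"

definition shallow :: "(nat \<Rightarrow> nat \<Rightarrow> bool) \<Rightarrow> nat \<Rightarrow> nat \<Rightarrow> nat \<Rightarrow> bool" where
  "shallow E n c y \<longleftrightarrow> E c y \<and> \<not> (\<exists>v<n. deep E n c v \<and> same_block E v y)"

context rooted_graph
begin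

lemma deep_par: "w < n \<Longrightarrow> far E c w \<Longrightarrow> deep E n c (par w)"
  using par unfolding deep_def by blast

lemma deep_near: "deep E n c v \<Longrightarrow> E c v \<and> v < n"
  using E_less unfolding deep_def by blast

text \<open>If all deep vertices share a block at c, this block is the central clique: the other
  neighbours of c hang on c, and far vertices hang on their parents. Without deep vertices
  \<open>B\<close> shrinks to c.\<close>

lemma pendant_clique_if_deep_same_block:
  assumes tri: "every_edge_in_triangle E"
    and same: "\<And>v v'. deep E n c v \<Longrightarrow> deep E n c v' \<Longrightarrow> same_block E v v'"
  defines "B \<equiv> insert c {y. E c y \<and> (\<exists>v<n. deep E n c v \<and> same_block E v y)}"
  shows "pendant_clique n E B (\<lambda>u. if u \<in> B then u else if E c u then c else par u)"
proof -
  let ?top = "\<lambda>u. if u \<in> B then u else if E c u then c else par u"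
  have B_iff: "y \<in> B \<longleftrightarrow> y = c \<or> E c y \<and> (\<exists>v. deep E n c v \<and> same_block E v y)" for y
    using deep_near unfolding B_def by blast
  have deep_B: "v \<in> B" if "deep E n c v" for v
    using that deep_near same_block_refl unfolding B_iff by blast
  have out: "E c u \<or> far E c u" if "u \<notin> B" for u
    using that unfolding B_iff far_def by blast
  have near_same: False if h: "u \<notin> B" "E c u" "E c v" "v \<in> B" "E u v" for u v
  proof -
    have "v \<noteq> c"
      using that E_irrefl by blast
    then obtain d where d: "deep E n c d" "same_block E d v"
      using h(4) unfolding B_iff by blast
    then have "same_block E d u"
      using near_trans[of d v u] deep_near that E_sym unfolding same_block_def by blast
    then show False
      using that d unfolding B_iff by blast
  qed
  have far_par: "far E c u \<Longrightarrow> u < n \<Longrightarrow> par u \<in> B" for u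
    using deep_par deep_B by blast
  have kind: "E c u \<longleftrightarrow> E c v" if "u \<notin> B" "v \<notin> B" "E u v" for u v
  proof -
    have "\<not> far E c v" if "E c u" "u \<notin> B" "E u v" for u v
      using that deep_B[of u] E_less unfolding deep_def by blast
    then show ?thesis
      using that out E_sym by blast
  qed
  show ?thesis
  proof
    show "b < n" if "b \<in> B" for b
      using that c_less E_less unfolding B_iff by blast
    show "same_block E b b'" if b: "b \<in> B" "b' \<in> B" for b b'
    proof (cases "b = c \<or> b' = c")
      case True
      then show ?thesis
        using that E_sym unfolding B_iff same_block_def by blast
    next
      case False
      then obtain d d' where d: "deep E n c d" "same_block E d b" "deep E n c d'" "same_block E d' b'"
        and bb: "E c b" "E c b'"
        using b unfolding B_iff by blast
      have "same_block E b d'"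
        using near_trans[of b d d'] d bb same deep_near same_block_sym by blast
      then show ?thesis
        using near_trans[of b d' b'] d bb deep_near by blast
    qed
    show "?top u \<in> B" if "u < n" for u
      using that far_par out B_iff[of c] by auto
    show "E u (?top u)" if "u < n" "u \<notin> B" for u
      using that out[of u] par[of u] E_sym by auto
    show "b = ?top u" if "u \<notin> B" "b \<in> B" "E u b" for u b
    proof (cases "E c u")
      case True
      then show ?thesis
        using that near_same[of u b] B_iff[of b] by auto
    next
      case False
      then have "far E c u"
        using out that by blast
      moreover have "b \<noteq> c"
        using False that E_sym by blast
      ultimately show ?thesis
        using that False far_nbr[of u b] B_iff[of b] by (auto simp: far_def)
    qed
    show "?top u = ?top v" if "u \<notin> B" "v \<notin> B" "E u v" for u v
      using kind[OF that] out that par_eq by auto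
    show "same_block E u w" if "u \<notin> B" "v \<notin> B" "w \<notin> B" "E u v" "E v w" for u v w
    proof (cases "E c u")
      case True
      then have "E c v" "E c w"
        using kind[OF that(1,2,4)] kind[OF that(2,3,5)] by auto
      then show ?thesis
        using near_trans'[OF True _ _ that(4,5)] by blast
    next
      case False
      then have "far E c u" "far E c v" "far E c w"
        using kind[OF that(1,2,4)] kind[OF that(2,3,5)] out that(1-3) by auto
      then show ?thesis
        using far_trans'[OF _ _ _ that(4,5)] by blast
    qed
  qed (use tri in auto)
qed

end

locale rooted_coloring = rooted_graph +
  fixes \<alpha> \<sigma> :: "nat \<Rightarrow> nat" and \<beta> :: "nat \<Rightarrow> nat \<Rightarrow> nat"
  assumes \<beta>_sym: "\<beta> x y = \<beta> y x"
begin

text \<open>\<open>\<alpha>\<close> colors the edges at the root, \<open>\<beta>\<close> the edges between neighbours of the root and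
  \<open>\<sigma> v\<close> the edges from \<open>v\<close> to vertices at distance two from the root.\<close>

definition col :: "nat \<Rightarrow> nat \<Rightarrow> nat" where
  "col u v = (if u = c then \<alpha> v else if v = c then \<alpha> u
     else if E c u then if E c v then \<beta> u v else \<sigma> u
     else if E c v then \<sigma> v else 0)"

lemma col_sym: "col u v = col v u"
  using \<beta>_sym by (auto simp: col_def)

lemma near_ne: "E c x \<Longrightarrow> x \<noteq> c"
  using E_irrefl by blast

lemma far_not_near: "far E c u \<Longrightarrow> u \<noteq> c \<and> \<not> E c u"
  by (simp add: far_def)

lemma walk_near: "E c x \<Longrightarrow> walk col x {\<alpha> x} c"
  using walk1[of x c col, OF E_sym col_sym] near_ne by (simp add: col_def)

lemma walk_near2:
  assumes "E c x" "E c y" "E x y" "\<beta> x y \<noteq> \<alpha> y"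
  shows "walk col x {\<beta> x y, \<alpha> y} c"
proof -
  have "col x y = \<beta> x y" "col y c = \<alpha> y"
    using assms near_ne by (auto simp: col_def)
  then show ?thesis
    using walk2[of x y c col, OF assms(3) E_sym[OF assms(2)] col_sym col_sym] assms(4) by simp
qed

lemma walk_far:
  assumes "u < n" "far E c u" "\<sigma> (par u) \<noteq> \<alpha> (par u)"
  shows "walk col u {\<sigma> (par u), \<alpha> (par u)} c"
proof -
  note p = par[OF assms(1,2)]
  have "col u (par u) = \<sigma> (par u)" "col (par u) c = \<alpha> (par u)"
    using far_not_near[OF assms(2)] near_ne p by (auto simp: col_def)
  then show ?thesis
    using walk2[of u "par u" c col, OF E_sym[OF p(2)] E_sym[OF p(1)] col_sym col_sym] assms(3) by simp
qed

lemma walk_far2: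
  assumes "u < n" "far E c u" "E c z" "E (par u) z" "\<sigma> (par u) \<noteq> \<beta> (par u) z"
    "\<sigma> (par u) \<noteq> \<alpha> z" "\<beta> (par u) z \<noteq> \<alpha> z"
  shows "walk col u {\<sigma> (par u), \<beta> (par u) z, \<alpha> z} c"
proof -
  note p = par[OF assms(1,2)]
  have "col u (par u) = \<sigma> (par u)"
    using far_not_near[OF assms(2)] near_ne p by (auto simp: col_def)
  then have "walk col u {\<sigma> (par u)} (par u)"
    using walk1[of u "par u" col, OF E_sym[OF p(2)] col_sym] by simp
  moreover have "walk col (par u) {\<beta> (par u) z, \<alpha> z} c"
    using walk_near2[OF p(1) assms(3,4,7)] .
  ultimately have "walk col u ({\<sigma> (par u)} \<union> {\<beta> (par u) z, \<alpha> z}) c"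
    using assms(5,6) by (intro walk_append) auto
  then show ?thesis
    by (simp add: insert_commute)
qed

definition branch :: "nat \<Rightarrow> nat" where
  "branch x = (if E c x then x else par x)"

lemma branch_near: "E c x \<Longrightarrow> branch x = x"
  by (simp add: branch_def)

lemma branch_far: "far E c x \<Longrightarrow> branch x = par x"
  by (simp add: branch_def far_def)

text \<open>Vertices from different blocks at the root can be joined only through it, so this is the
  form that \<open>joined\<close> takes for them.\<close>

definition meet :: "nat \<Rightarrow> nat \<Rightarrow> bool" where
  "meet x y \<longleftrightarrow> (\<exists>S T. walk col x S c \<and> walk col y T c \<and> S \<inter> T = {})"

lemma meetI: "walk col x S c \<Longrightarrow> walk col y T c \<Longrightarrow> S \<inter> T = {} \<Longrightarrow> meet x y"
  unfolding meet_def by blast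

lemma meet_sym: "meet x y \<Longrightarrow> meet y x"
  unfolding meet_def by blast

text \<open>Only pairs from different blocks at the root are left to \<open>cross\<close>. For the
  rest, \<open>one\<close> serves a neighbour of the root and a far vertex below the same block,
  \<open>two\<close> in addition two far vertices with different parents, \<open>three\<close> a far
  vertex and the root, and \<open>single\<close> two far vertices with a common parent.\<close>

lemma rainbow_colorable_if_meet:
  assumes single: "\<And>u w. u < n \<Longrightarrow> w < n \<Longrightarrow> far E c u \<Longrightarrow> far E c w \<Longrightarrow> par u = par w \<Longrightarrow> same_block E u w"
    and less: "\<And>x. \<alpha> x < k" "\<And>x. \<sigma> x < k" "\<And>x y. \<beta> x y < k"
    and one: "\<And>x v. deep E n c v \<Longrightarrow> E c x \<Longrightarrow> E x v \<Longrightarrow> \<beta> x v \<noteq> \<sigma> v"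
    and two: "\<And>v v'. deep E n c v \<Longrightarrow> deep E n c v' \<Longrightarrow> E v v' \<Longrightarrow> \<sigma> v \<noteq> \<sigma> v'"
    and three: "\<And>v. deep E n c v \<Longrightarrow> \<sigma> v \<noteq> \<alpha> v"
    and cross: "\<And>x y. x < n \<Longrightarrow> y < n \<Longrightarrow> x \<noteq> c \<Longrightarrow> y \<noteq> c \<Longrightarrow>
      \<not> same_block E (branch x) (branch y) \<Longrightarrow> meet x y"
  shows "rainbow_colorable E n k"
proof (rule rainbow_colorable_if_joined[where f = col])
  show "col u v < k" if "E u v" for u v
    using less[of u] less(1)[of v] less(2)[of v] less(3)[of u v] by (auto simp: col_def)
  have down: "walk col x {\<sigma> x} u" if "u < n" "far E c u" "par u = x" for x u
  proof -
    note p = par[OF that(1,2)]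
    have "col x u = \<sigma> x"
      using far_not_near[OF that(2)] near_ne p that(3) by (auto simp: col_def)
    then show ?thesis
      using walk1[of x u col, OF _ col_sym] p that(3) by simp
  qed
  have near_walk: "walk col x {\<beta> x y} y" if "E c x" "E c y" "E x y" for x y
  proof -
    have "col x y = \<beta> x y"
      using that near_ne by (auto simp: col_def)
    then show ?thesis
      using walk1[of x y col, OF that(3) col_sym] by simp
  qed
  have near_far: "joined col x u" if "u < n" "E c x" "far E c u" "same_block E x (par u)" for x u
  proof (cases "x = par u")
    case True
    then show ?thesis
      using down[OF that(1,3)] unfolding joined_def by blast
  next
    case False
    then have xp: "E x (par u)"
      using that by (simp add: same_block_def)
    note p = par[OF that(1,3)]
    have "walk col x ({\<beta> x (par u)} \<union> {\<sigma> (par u)}) u"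
      using one[OF deep_par[OF that(1,3)] that(2) xp]
      by (intro walk_append[OF near_walk[OF that(2) p(1) xp] down[OF that(1,3) refl]]) auto
    then show ?thesis
      unfolding joined_def by blast
  qed
  have far_far: "joined col u w" if uw: "u < n" "w < n" "far E c u" "far E c w" "same_block E (par u) (par w)" for u w
  proof (cases "par u = par w")
    case True
    then have "u = w \<or> E u w"
      using single[OF uw(1-4)] by (simp add: same_block_def)
    then show ?thesis
      using joined_refl[of col u] joined_edge[of u w col, OF _ col_sym] by auto
  next
    case False
    then have e: "E (par u) (par w)"
      using uw by (simp add: same_block_def)
    note p = par[OF uw(1,3)] and q = par[OF uw(2,4)]
    note d = deep_par[OF uw(1,3)] deep_par[OF uw(2,4)]
    have "\<beta> (par u) (par w) \<noteq> \<sigma> (par u)"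
      using one[OF d(1) q(1) E_sym[OF e]] \<beta>_sym by simp
    then have "walk col u ({\<sigma> (par u)} \<union> {\<beta> (par u) (par w)}) (par w)"
      by (intro walk_append[OF walk_rev[OF down[OF uw(1,3) refl]] near_walk[OF p(1) q(1) e]]) auto
    moreover have "walk col w {\<sigma> (par w)} (par w)"
      by (rule walk_rev[OF down[OF uw(2,4) refl]])
    ultimately show ?thesis
      using one[OF d(2) p(1) e] two[OF d e] by (intro joined_meet) auto
  qed
  have root: "joined col x c" if "x < n" "x \<noteq> c" for x
  proof (cases "E c x")
    case True
    then show ?thesis
      using walk_near unfolding joined_def by blast
  next
    case False
    then have far: "far E c x"
      using that by (simp add: far_def)
    show ?thesis
      using walk_far[OF that(1) far] three deep_par[OF that(1) far] unfolding joined_def by metis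
  qed
  show "joined col u v" if uv: "u < n" "v < n" "u \<noteq> v" for u v
  proof (cases "u = c \<or> v = c")
    case True
    then show ?thesis
      using root uv joined_sym by metis
  next
    case False
    show ?thesis
    proof (cases "same_block E (branch u) (branch v)")
      case True
      show ?thesis
      proof (cases "E c u"; cases "E c v")
        assume "E c u" "E c v"
        then show ?thesis
          using True uv joined_edge[of u v col, OF _ col_sym] by (simp add: branch_near same_block_def)
      next
        assume "E c u" "\<not> E c v"
        moreover from this have "far E c v"
          using False by (simp add: far_def)
        ultimately show ?thesis
          using near_far[of v u] True uv by (simp add: branch_near branch_far)
      next
        assume "\<not> E c u" "E c v"
        moreover from this have "far E c u"
          using False by (simp add: far_def)
        ultimately have "joined col v u"
          using near_far[of u v] True uv same_block_sym by (simp add: branch_near branch_far)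
        then show ?thesis
          by (rule joined_sym)
      next
        assume "\<not> E c u" "\<not> E c v"
        then have "far E c u" "far E c v"
          using False by (auto simp: far_def)
        then show ?thesis
          using far_far[of u v] True uv by (simp add: branch_far)
      qed
    next
      case ns: False
      then have "meet u v"
        using cross uv False by blast
      then show ?thesis
        unfolding meet_def using joined_meet by blast
    qed
  qed
qed

end


locale two_deep_blocks = rooted_graph +
  fixes v1 v2 :: nat
  assumes deep1: "deep E n c v1" and deep2: "deep E n c v2"
    and diff: "\<not> same_block E v1 v2"
    and cover: "deep E n c v \<Longrightarrow> same_block E v1 v \<or> same_block E v2 v"
    and single: "u < n \<Longrightarrow> w < n \<Longrightarrow> far E c u \<Longrightarrow> far E c w \<Longrightarrow> par u = par w \<Longrightarrow> same_block E u w"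
    and triangles: "every_edge_in_triangle E"
begin

definition cl1 :: "nat \<Rightarrow> bool" where
  "cl1 x \<longleftrightarrow> E c x \<and> same_block E v1 x"

definition cl2 :: "nat \<Rightarrow> bool" where
  "cl2 x \<longleftrightarrow> E c x \<and> same_block E v2 x"

text \<open>In contrast to \<open>cl1\<close> and \<open>cl2\<close>, this may comprise many blocks
  at the root, so pairs inside it still have to be joined through the root.\<close>

definition cl3 :: "nat \<Rightarrow> bool" where
  "cl3 x \<longleftrightarrow> E c x \<and> \<not> cl1 x \<and> \<not> cl2 x"

lemma near1: "E c v1" and near2: "E c v2"
  using deep1 deep2 deep_near by blast+

lemma cl_self: "cl1 v1" "cl2 v2"
  using near1 near2 by (simp_all add: cl1_def cl2_def)

lemma cl_exclusive: "cl1 x \<Longrightarrow> \<not> cl2 x"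
  using diff near_trans[OF near1 _ near2] same_block_sym unfolding cl1_def cl2_def by blast

lemma cl1_step: "cl1 x \<Longrightarrow> E c y \<Longrightarrow> same_block E x y \<Longrightarrow> cl1 y"
  using near_trans[OF near1] unfolding cl1_def by blast

lemma cl2_step: "cl2 x \<Longrightarrow> E c y \<Longrightarrow> same_block E x y \<Longrightarrow> cl2 y"
  using near_trans[OF near2] unfolding cl2_def by blast

lemma cl3_step: "cl3 x \<Longrightarrow> E c y \<Longrightarrow> same_block E x y \<Longrightarrow> cl3 y"
  using cl1_step[of y x] cl2_step[of y x] same_block_sym[of x y] unfolding cl3_def by blast

lemma cl1_same: "cl1 x \<Longrightarrow> cl1 y \<Longrightarrow> same_block E x y"
  using near_trans[OF _ near1, of x y] same_block_sym unfolding cl1_def by blast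

lemma cl2_same: "cl2 x \<Longrightarrow> cl2 y \<Longrightarrow> same_block E x y"
  using near_trans[OF _ near2, of x y] same_block_sym unfolding cl2_def by blast

lemma deep_cl: "deep E n c v \<Longrightarrow> cl1 v \<or> cl2 v"
  using cover deep_near unfolding cl1_def cl2_def by blast

lemma far_cl: "u < n \<Longrightarrow> far E c u \<Longrightarrow> cl1 (par u) \<or> cl2 (par u)"
  using deep_par deep_cl by blast

lemma ex_neighbour:
  assumes "E c x"
  obtains y where "E c y" "E x y" "y \<noteq> x"
  using triangles assms E_irrefl unfolding every_edge_in_triangle_def by metis

lemma shallow_iff: "shallow E n c y \<longleftrightarrow> cl3 y"
proof
  assume "shallow E n c y"
  then show "cl3 y"
    using deep1 deep2 deep_near unfolding shallow_def cl3_def cl1_def cl2_def by blast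
next
  assume y: "cl3 y"
  have "\<not> same_block E v y" if "deep E n c v" for v
  proof
    assume "same_block E v y"
    then have "cl1 y \<or> cl2 y"
      using deep_cl[OF that] cl1_step cl2_step y unfolding cl3_def by blast
    then show False
      using y unfolding cl3_def by blast
  qed
  then show "shallow E n c y"
    using y unfolding shallow_def cl3_def by blast
qed

end

locale four_coloring = two_deep_blocks + rooted_coloring
begin

lemma cl3_near: "cl3 x \<Longrightarrow> E c x"
  by (simp add: cl3_def)

text \<open>Pairs inside the first or the second class share a block and need no meeting at the
  root; symmetry of \<open>meet\<close> reduces the remaining combinations to four.\<close>

lemma rainbow_colorable_if_cases:
  assumes "\<And>x. \<alpha> x < k" "\<And>x. \<sigma> x < k" "\<And>x y. \<beta> x y < k"
    and "\<And>x v. deep E n c v \<Longrightarrow> E c x \<Longrightarrow> E x v \<Longrightarrow> \<beta> x v \<noteq> \<sigma> v"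
    and "\<And>v v'. deep E n c v \<Longrightarrow> deep E n c v' \<Longrightarrow> E v v' \<Longrightarrow> \<sigma> v \<noteq> \<sigma> v'"
    and "\<And>v. deep E n c v \<Longrightarrow> \<sigma> v \<noteq> \<alpha> v"
    and c12: "\<And>x y. x < n \<Longrightarrow> y < n \<Longrightarrow> x \<noteq> c \<Longrightarrow> y \<noteq> c \<Longrightarrow> cl1 (branch x) \<Longrightarrow> cl2 (branch y) \<Longrightarrow> meet x y"
    and c13: "\<And>x y. x < n \<Longrightarrow> x \<noteq> c \<Longrightarrow> cl1 (branch x) \<Longrightarrow> cl3 y \<Longrightarrow> meet x y"
    and c23: "\<And>x y. x < n \<Longrightarrow> x \<noteq> c \<Longrightarrow> cl2 (branch x) \<Longrightarrow> cl3 y \<Longrightarrow> meet x y"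
    and c33: "\<And>x y. cl3 x \<Longrightarrow> cl3 y \<Longrightarrow> meet x y"
  shows "rainbow_colorable E n k"
proof (rule rainbow_colorable_if_meet[OF single assms(1-6)])
  have kinds: "cl1 (branch x) \<or> cl2 (branch x) \<or> cl3 x" if x: "x < n" "x \<noteq> c" for x
  proof (cases "E c x")
    case True
    then show ?thesis
      unfolding branch_near[OF True] cl3_def by blast
  next
    case False
    then have far: "far E c x"
      using x(2) by (simp add: far_def)
    show ?thesis
      using far_cl[OF x(1) far] unfolding branch_far[OF far] by blast
  qed
  fix x y
  assume xy: "x < n" "y < n" "x \<noteq> c" "y \<noteq> c" "\<not> same_block E (branch x) (branch y)"
  have "\<not> (cl1 (branch x) \<and> cl1 (branch y))" "\<not> (cl2 (branch x) \<and> cl2 (branch y))"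
    using xy(5) cl1_same cl2_same by blast+
  then consider "cl1 (branch x)" "cl2 (branch y)" | "cl2 (branch x)" "cl1 (branch y)"
    | "cl1 (branch x)" "cl3 y" | "cl3 x" "cl1 (branch y)" | "cl2 (branch x)" "cl3 y"
    | "cl3 x" "cl2 (branch y)" | "cl3 x" "cl3 y"
    using kinds[OF xy(1,3)] kinds[OF xy(2,4)] by blast
  then show "meet x y"
  proof cases
    case 1
    then show ?thesis by (rule c12[OF xy(1-4)])
  next
    case 2
    show ?thesis by (rule meet_sym[OF c12[OF xy(2,1,4,3) 2(2,1)]])
  next
    case 3
    then show ?thesis by (rule c13[OF xy(1,3)])
  next
    case 4
    show ?thesis by (rule meet_sym[OF c13[OF xy(2,4) 4(2,1)]])
  next
    case 5
    then show ?thesis by (rule c23[OF xy(1,3)])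
  next
    case 6
    show ?thesis by (rule meet_sym[OF c23[OF xy(2,4) 6(2,1)]])
  next
    case 7
    then show ?thesis by (rule c33)
  qed
qed

end

context two_deep_blocks
begin

text \<open>Each block at the root without deep vertices has a cyclic labelling of its vertices by
  \<open>0, 1, 2, 3\<close>, in which a vertex reaches the root in two steps through the next label.\<close>

lemma rainbow_colorable_cyclic:
  assumes pair: "\<And>x y z. deep E n c x \<Longrightarrow> deep E n c y \<Longrightarrow> deep E n c z \<Longrightarrow> E x y \<Longrightarrow> E x z \<Longrightarrow> E y z \<Longrightarrow> False"
    and big: "\<And>y. cl3 y \<Longrightarrow> \<exists>y2 y3 y4. E c y2 \<and> E c y3 \<and> E c y4 \<and> E y y2 \<and> E y y3 \<and> E y y4 \<and>
      y2 \<noteq> y3 \<and> y2 \<noteq> y4 \<and> y3 \<noteq> y4"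
  shows "rainbow_colorable E n 4"
proof -
  define K where "K y = {z. E c z \<and> same_block E y z}" for y
  have K_eq: "K y = K z" if "E c y" "E c z" "E y z" for y z
  proof -
    have yz: "same_block E y z" "same_block E z y"
      using that E_sym by (auto simp: same_block_def)
    show ?thesis
      using near_trans[OF that(1,2) _ yz(1)] near_trans[OF that(2,1) _ yz(2)] unfolding K_def by blast
  qed
  have "\<exists>h. \<forall>i<4. \<exists>z\<in>K y. h z = (i::nat)" if y: "cl3 y" for y
  proof -
    obtain y2 y3 y4 where *: "E c y2" "E c y3" "E c y4" "E y y2" "E y y3" "E y y4"
      "y2 \<noteq> y3" "y2 \<noteq> y4" "y3 \<noteq> y4"
      using big[OF y] by blast
    then have ne: "y \<noteq> y2" "y \<noteq> y3" "y \<noteq> y4"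
      using E_irrefl by auto
    \<comment> \<open>Any function that takes all four values on the block will do; the default 0
      serves as the label of y.\<close>
    let ?h = "(\<lambda>_. 0)(y2 := 1, y3 := 2, y4 := 3 :: nat)"
    have "y \<in> K y" "y2 \<in> K y" "y3 \<in> K y" "y4 \<in> K y"
      using * y unfolding K_def cl3_def same_block_def by auto
    moreover have "?h y = 0" "?h y2 = 1" "?h y3 = 2" "?h y4 = 3"
      using * ne by auto
    moreover have "i = 0 \<or> i = 1 \<or> i = 2 \<or> i = 3" if "i < 4" for i :: nat
      using that by auto
    ultimately show ?thesis
      by (intro exI[of _ ?h]) metis
  qed
  \<comment> \<open>The labelling is chosen for the set \<open>K y\<close> and not for the vertex,
    so that all vertices of a block share it.\<close>
  then have "\<forall>X. \<exists>h. \<forall>y. cl3 y \<longrightarrow> X = K y \<longrightarrow> (\<forall>i<4. \<exists>z\<in>X. h z = (i::nat))"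
    by metis
  then obtain H where H: "\<And>X y i. cl3 y \<Longrightarrow> X = K y \<Longrightarrow> i < 4 \<Longrightarrow> \<exists>z\<in>X. H X z = (i::nat)"
    by metis
  \<comment> \<open>Only surjectivity onto the four labels is known about \<open>H\<close>;
    reduction mod 4 brings all other values into range.\<close>
  define r where "r y = H (K y) y mod 4" for y
  have next_label: "\<exists>z. E c z \<and> E y z \<and> cl3 z \<and> r z = (r y + 1) mod 4" if y: "cl3 y" for y
  proof -
    obtain z where z: "z \<in> K y" "H (K y) z = (r y + 1) mod 4"
      using H[OF y refl, of "(r y + 1) mod 4"] by auto
    then have zy: "E c z" "z = y \<or> E y z"
      unfolding K_def same_block_def by auto
    then have "K y = K z"
      using K_eq[of y z] y unfolding cl3_def by blast
    then have rz: "r z = (r y + 1) mod 4"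
      using z(2) by (simp add: r_def)
    have "z \<noteq> y"
    proof
      assume "z = y"
      then have "r y = (r y + 1) mod 4"
        using rz by simp
      then show False
        by presburger
    qed
    then show ?thesis
      using zy rz cl3_step[OF y zy(1)] by (auto simp: same_block_def)
  qed
  have r4: "r y = 0 \<or> r y = 1 \<or> r y = 2 \<or> r y = 3" for y
    unfolding r_def by presburger
  \<comment> \<open>Block 1 owns the pair 0, 1 and block 2 the pair 2, 3. In each, \<alpha> and
    \<sigma> complement each other, and the at most two deep vertices are told apart by singling out
    \<open>v1\<close> or \<open>v2\<close>. Shallow vertices alternate between 0 and 2 by the parity
    of their label.\<close>
  define \<alpha> where "\<alpha> x = (if cl1 x then if deep E n c x \<and> x \<noteq> v1 then 1 else 0
    else if cl2 x then if deep E n c x \<and> x \<noteq> v2 then 3 else 2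
    else if even (r x) then 0 else 2 :: nat)" for x
  define \<sigma> where "\<sigma> x = (if cl1 x then 1 - \<alpha> x else if cl2 x then 5 - \<alpha> x else 0)" for x
  \<comment> \<open>The step from label i to i + 1 and the root edge behind it must form the pair
    that does not contain the root color of label i: 3 then 2 from even labels, 1 then 0 from odd
    ones. Inside block 1 the color 2, and inside block 2 the color 0, stays clear of
    \<sigma>.\<close>
  define \<beta> where "\<beta> x y = (if cl1 x \<and> cl1 y then 2 else if cl3 x \<and> cl3 y then
    if {r x, r y} = {0, 1} \<or> {r x, r y} = {2, 3} then 3
    else if {r x, r y} = {1, 2} \<or> {r x, r y} = {3, 0} then 1 else 0 else 0 :: nat)" for x y
  interpret four_coloring n E c v1 v2 \<alpha> \<sigma> \<beta>
    by unfold_locales (simp add: \<beta>_def insert_commute conj_commute)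
  have \<alpha>1: "\<alpha> x \<in> {0, 1}" "\<sigma> x = 1 - \<alpha> x" if "cl1 x" for x
    using that by (auto simp: \<alpha>_def \<sigma>_def)
  have \<alpha>2: "\<alpha> x \<in> {2, 3}" "\<sigma> x = 5 - \<alpha> x" if "cl2 x" for x
    using that cl_exclusive by (auto simp: \<alpha>_def \<sigma>_def)
  have not3: "cl3 x \<Longrightarrow> \<not> cl1 x \<and> \<not> cl2 x" for x
    by (simp add: cl3_def)
  have walk1: "\<exists>S\<subseteq>{0, 1}. walk col x S c" if x: "x < n" "x \<noteq> c" "cl1 (branch x)" for x
  proof (cases "E c x")
    case True
    then have "cl1 x"
      using x(3) by (simp add: branch_near)
    then have "{\<alpha> x} \<subseteq> {0, 1}"
      using \<alpha>1(1)[of x] by simp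
    then show ?thesis
      using walk_near[OF True] by blast
  next
    case False
    then have far: "far E c x"
      using x(2) by (simp add: far_def)
    then have p: "cl1 (par x)"
      using x(3) branch_far by simp
    then have "{\<sigma> (par x), \<alpha> (par x)} \<subseteq> {0, 1}" "\<sigma> (par x) \<noteq> \<alpha> (par x)"
      using \<alpha>1[OF p] by auto
    then show ?thesis
      using walk_far[OF x(1) far] by blast
  qed
  have walk2: "\<exists>S\<subseteq>{2, 3}. walk col x S c" if x: "x < n" "x \<noteq> c" "cl2 (branch x)" for x
  proof (cases "E c x")
    case True
    then have "cl2 x"
      using x(3) by (simp add: branch_near)
    then have "{\<alpha> x} \<subseteq> {2, 3}"
      using \<alpha>2(1)[of x] by simp
    then show ?thesis
      using walk_near[OF True] by blast
  next
    case False
    then have far: "far E c x"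
      using x(2) by (simp add: far_def)
    then have p: "cl2 (par x)"
      using x(3) branch_far by simp
    then have "{\<sigma> (par x), \<alpha> (par x)} \<subseteq> {2, 3}" "\<sigma> (par x) \<noteq> \<alpha> (par x)"
      using \<alpha>2[OF p] by auto
    then show ?thesis
      using walk_far[OF x(1) far] by blast
  qed
  have walk3: "walk col x {0} c \<and> walk col x {2, 3} c \<or> walk col x {2} c \<and> walk col x {0, 1} c"
    if x: "cl3 x" for x
  proof -
    obtain z where z: "E c z" "E x z" "cl3 z" "r z = (r x + 1) mod 4"
      using next_label[OF x] by blast
    note w = walk_near[OF cl3_near[OF x]] walk_near2[OF cl3_near[OF x] z(1,2)]
    have e: "\<alpha> x = (if even (r x) then 0 else 2)" "\<alpha> z = (if even (r z) then 0 else 2)"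
      using not3[OF x] not3[OF z(3)] by (auto simp: \<alpha>_def)
    have b: "\<beta> x z = (if {r x, r z} = {0, 1} \<or> {r x, r z} = {2, 3} then 3
      else if {r x, r z} = {1, 2} \<or> {r x, r z} = {3, 0} then 1 else 0)"
      using x z(3) not3[OF x] by (simp add: \<beta>_def)
    consider "r x = 0" "r z = 1" | "r x = 1" "r z = 2" | "r x = 2" "r z = 3" | "r x = 3" "r z = 0"
      using r4[of x] z(4) by auto
    then show ?thesis
      by cases (use w e b in \<open>auto simp: insert_commute doubleton_eq_iff\<close>)
  qed
  show ?thesis
  proof (rule rainbow_colorable_if_cases)
    show "\<alpha> x < 4" "\<sigma> x < 4" "\<beta> x y < 4" for x y
      by (auto simp: \<alpha>_def \<sigma>_def \<beta>_def)
    show "\<beta> x v \<noteq> \<sigma> v" if h: "deep E n c v" "E c x" "E x v" for x v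
    proof -
      have sb: "same_block E v x" "E c v"
        using h E_sym deep_near by (auto simp: same_block_def)
      show ?thesis
      proof (cases "cl1 v")
        case True
        then have "cl1 x"
          using cl1_step h(2) sb(1) by blast
        then have "\<beta> x v = 2"
          using True by (simp add: \<beta>_def)
        then show ?thesis
          using \<alpha>1[OF True] by auto
      next
        case False
        then have v: "cl2 v"
          using deep_cl h(1) by blast
        then have "\<beta> x v = 0"
          using False not3[of v] by (auto simp: \<beta>_def)
        then show ?thesis
          using \<alpha>2[OF v] by auto
      qed
    qed
    show "\<sigma> v \<noteq> \<alpha> v" if "deep E n c v" for v
      using deep_cl[OF that] \<alpha>1[of v] \<alpha>2[of v] by auto
    show "\<sigma> v \<noteq> \<sigma> v'" if h: "deep E n c v" "deep E n c v'" "E v v'" for v v'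
    proof -
      have sb: "same_block E v v'" "E c v" "E c v'" "v \<noteq> v'"
        using h deep_near E_irrefl by (auto simp: same_block_def)
      show ?thesis
      proof (cases "cl1 v")
        case True
        then have v': "cl1 v'"
          using cl1_step sb by blast
        have "v = v1 \<or> v' = v1"
          using pair[OF deep1 h(1,2)] h(3) True v' unfolding cl1_def same_block_def by auto
        then show ?thesis
          using True v' h sb(4) by (auto simp: \<sigma>_def \<alpha>_def)
      next
        case False
        then have v: "cl2 v"
          using deep_cl h(1) by blast
        then have v': "cl2 v'"
          using cl2_step sb by blast
        have "v = v2 \<or> v' = v2"
          using pair[OF deep2 h(1,2)] h(3) v v' unfolding cl2_def same_block_def by auto
        then show ?thesis
          using v v' h sb(4) cl_exclusive by (auto simp: \<sigma>_def \<alpha>_def)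
      qed
    qed
    show "meet x y" if h: "x < n" "y < n" "x \<noteq> c" "y \<noteq> c" "cl1 (branch x)" "cl2 (branch y)" for x y
    proof -
      obtain S T where ST: "S \<subseteq> {0, 1}" "walk col x S c" "T \<subseteq> {2, 3}" "walk col y T c"
        using walk1[OF h(1,3,5)] walk2[OF h(2,4,6)] by blast
      have "{0, 1} \<inter> {2, 3} = ({} :: nat set)"
        by simp
      then show ?thesis
        using ST by (intro meetI[of x S y T]) blast+
    qed
    show "meet x y" if h: "x < n" "x \<noteq> c" "cl1 (branch x)" "cl3 y" for x y
    proof -
      obtain S where S: "S \<subseteq> {0, 1}" "walk col x S c"
        using walk1[OF h(1-3)] by blast
      have d: "S \<inter> {2, 3} = {}" "S \<inter> {2} = {}"
        using S(1) by auto
      have "walk col y {2, 3} c \<or> walk col y {2} c"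
        using walk3[OF h(4)] by blast
      then show ?thesis
        by (elim disjE meetI[OF S(2) _ d(1)] meetI[OF S(2) _ d(2)])
    qed
    show "meet x y" if h: "x < n" "x \<noteq> c" "cl2 (branch x)" "cl3 y" for x y
    proof -
      obtain S where S: "S \<subseteq> {2, 3}" "walk col x S c"
        using walk2[OF h(1-3)] by blast
      have d: "S \<inter> {0} = {}" "S \<inter> {0, 1} = {}"
        using S(1) by auto
      have "walk col y {0} c \<or> walk col y {0, 1} c"
        using walk3[OF h(4)] by blast
      then show ?thesis
        by (elim disjE meetI[OF S(2) _ d(1)] meetI[OF S(2) _ d(2)])
    qed
    show "meet x y" if h: "cl3 x" "cl3 y" for x y
    proof -
      consider "walk col x {0} c" "walk col y {2, 3} c" | "walk col x {0} c" "walk col y {2} c"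
        | "walk col x {2} c" "walk col y {0} c" | "walk col x {2} c" "walk col y {0, 1} c"
        using walk3[OF h(1)] walk3[OF h(2)] by blast
      then show ?thesis
        by cases (auto elim: meetI)
    qed
  qed
qed

definition class_of :: "nat \<Rightarrow> nat set" where
  "class_of y = {z. E c z \<and> same_block E y z}"

text \<open>One chosen vertex splits each shallow block into two nonempty parts, as by
  \<open>triangles\<close> such a block has at least two vertices besides c.\<close>

definition leader :: "nat \<Rightarrow> bool" where
  "leader y \<longleftrightarrow> y = Min (class_of y)"

lemma class_of_eq:
  assumes "E c y" "E c z" "E y z"
  shows "class_of y = class_of z"
proof -
  have yz: "same_block E y z" "same_block E z y"
    using assms E_sym by (auto simp: same_block_def)
  show ?thesis
    using near_trans[OF assms(1,2) _ yz(1)] near_trans[OF assms(2,1) _ yz(2)]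
    unfolding class_of_def by blast
qed

lemma ex_helper:
  assumes x: "cl3 x"
  obtains z where "E c z" "E x z" "cl3 z" "leader z \<longleftrightarrow> \<not> leader x"
proof -
  have cx: "E c x"
    using x by (simp add: cl3_def)
  have fin: "finite (class_of x)"
    using finite_subset[of "class_of x" "{..<n}"] E_less unfolding class_of_def by auto
  show thesis
  proof (cases "leader x")
    case True
    obtain z where z: "E c z" "E x z" "z \<noteq> x"
      using ex_neighbour[OF cx] .
    then have "\<not> leader z"
      using True class_of_eq[OF cx z(1,2)] by (simp add: leader_def)
    then show ?thesis
      using that[of z] z True cl3_step[OF x z(1)] by (simp add: same_block_def)
  next
    case False
    let ?z = "Min (class_of x)"
    have "x \<in> class_of x"
      using cx by (simp add: class_of_def)
    then have "?z \<in> class_of x"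
      using Min_in[OF fin] by blast
    then have z: "E c ?z" "E x ?z"
      using False by (auto simp: class_of_def same_block_def leader_def)
    then have "leader ?z"
      using class_of_eq[OF cx z] by (simp add: leader_def)
    then show ?thesis
      using that[of ?z] z False cl3_step[OF x z(1)] by (simp add: same_block_def)
  qed
qed

end

text \<open>This colors shallow blocks of any size: leaders get the walks {0} and {1, 2}, other
  vertices {2} and {0, 1}. The price is that {1, 2} meets both pairs, so a vertex confined to the
  colors 0, 1 needs an alternative walk towards leaders.\<close>

locale leader_coloring = four_coloring +
  assumes \<alpha>3: "cl3 x \<Longrightarrow> \<alpha> x = (if leader x then 0 else 2)"
    and \<beta>3: "cl3 x \<Longrightarrow> cl3 y \<Longrightarrow> \<beta> x y = 1"
begin

lemma shallow_walks:
  assumes x: "cl3 x"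
  shows "walk col x {0} c \<and> walk col x {1, 2} c \<or> walk col x {2} c \<and> walk col x {0, 1} c"
proof -
  obtain z where z: "E c z" "E x z" "cl3 z" "leader z \<longleftrightarrow> \<not> leader x"
    using ex_helper[OF x] .
  have 1: "walk col x {\<alpha> x} c"
    by (rule walk_near[OF cl3_near[OF x]])
  have 2: "walk col x {\<beta> x z, \<alpha> z} c"
    by (rule walk_near2[OF cl3_near[OF x] z(1,2)]) (simp add: \<alpha>3[OF z(3)] \<beta>3[OF x z(3)])
  show ?thesis
    using 1 2 z(4) by (cases "leader x") (simp_all add: \<alpha>3[OF x] \<alpha>3[OF z(3)] \<beta>3[OF x z(3)] insert_commute)
qed

lemma shallow_meet:
  assumes "cl3 x" "cl3 y"
  shows "meet x y"
proof -
  consider "walk col x {0} c" "walk col y {1, 2} c" | "walk col x {0} c" "walk col y {2} c"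
    | "walk col x {2} c" "walk col y {0} c" | "walk col x {2} c" "walk col y {0, 1} c"
    using shallow_walks[OF assms(1)] shallow_walks[OF assms(2)] by blast
  then show ?thesis
    by cases (auto elim: meetI)
qed

text \<open>\<open>S\<close> serves against a shallow vertex with the walks {0} and {1, 2},
  \<open>T\<close> against one with {2} and {0, 1}; each hypothesis is what makes one of the two
  walks disjoint.\<close>

lemma meet_shallow:
  assumes "cl3 y" "walk col x S c" "0 \<notin> S \<or> S \<subseteq> {0}" "walk col x T c" "2 \<notin> T \<or> T \<subseteq> {2}"
  shows "meet x y"
proof -
  consider "walk col y {0} c" "walk col y {1, 2} c" | "walk col y {2} c" "walk col y {0, 1} c"
    using shallow_walks[OF assms(1)] by blast
  then show ?thesis
  proof cases
    case 1
    have "S \<inter> {0} = {} \<or> S \<inter> {1, 2} = {}"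
      using assms(3) by auto
    then show ?thesis
      using 1 meetI[OF assms(2)] by metis
  next
    case 2
    have "T \<inter> {2} = {} \<or> T \<inter> {0, 1} = {}"
      using assms(5) by auto
    then show ?thesis
      using 2 meetI[OF assms(4)] by metis
  qed
qed

end

context two_deep_blocks
begin

text \<open>Block 2 keeps the pair 2, 3. Through z everything below v1 has the second walk {1, 3,
  2}, which avoids 0 and so serves against leaders. As z itself has root color 2, it needs z' for
  the walk {1, 0} against block 2.\<close>

lemma rainbow_colorable_lone:
  assumes pair: "\<And>x y z. deep E n c x \<Longrightarrow> deep E n c y \<Longrightarrow> deep E n c z \<Longrightarrow> E x y \<Longrightarrow> E x z \<Longrightarrow> E y z \<Longrightarrow> False"
    and lone: "\<And>v. deep E n c v \<Longrightarrow> cl1 v \<Longrightarrow> v = v1"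
    and z: "E c z" "E v1 z" "E c z'" "E v1 z'" "z \<noteq> z'"
  shows "rainbow_colorable E n 4"
proof -
  define \<alpha> where "\<alpha> x = (if cl1 x then if x = z then 2 else 0
    else if cl2 x then if deep E n c x \<and> x \<noteq> v2 then 3 else 2
    else if leader x then 0 else 2 :: nat)" for x
  define \<sigma> where "\<sigma> x = (if cl1 x then 1 else if cl2 x then 5 - \<alpha> x else 0)" for x
  \<comment> \<open>Edges at v1 must avoid \<sigma> v1 = 1. The edges from z to vertices other than
    v1 get 1, which completes the root color 0 of z' to the walk {1, 0}.\<close>
  define \<beta> where "\<beta> x y = (if cl1 x \<and> cl1 y then if x = v1 \<or> y = v1 then if x = z \<or> y = z then 3 else 2
      else if x = z \<or> y = z then 1 else 0
    else if cl3 x \<and> cl3 y then 1 else 0 :: nat)" for x y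
  have not3: "cl3 x \<Longrightarrow> \<not> cl1 x \<and> \<not> cl2 x" for x
    by (simp add: cl3_def)
  interpret leader_coloring n E c v1 v2 \<alpha> \<sigma> \<beta>
  proof
    show "\<beta> x y = \<beta> y x" for x y
      unfolding \<beta>_def
      by (simp only: conj_commute[of "cl1 x" "cl1 y"] conj_commute[of "cl3 x" "cl3 y"]
        disj_commute[of "x = v1" "y = v1"] disj_commute[of "x = z" "y = z"])
    show "\<alpha> x = (if leader x then 0 else 2)" if "cl3 x" for x
      using not3[OF that] by (simp add: \<alpha>_def)
    show "\<beta> x y = 1" if "cl3 x" "cl3 y" for x y
      using not3[OF that(1)] that by (simp add: \<beta>_def)
  qed
  have zv: "z \<noteq> v1" "z' \<noteq> v1" "cl1 z" "cl1 z'" "cl1 v1"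
    using z E_irrefl cl_self cl1_step[OF cl_self(1)] by (auto simp: same_block_def)
  have zz: "E z z'"
    using cl1_same[OF zv(3,4)] z(5) by (simp add: same_block_def)
  have \<alpha>2: "\<alpha> x \<in> {2, 3}" "\<sigma> x = 5 - \<alpha> x" if "cl2 x" for x
    using that cl_exclusive by (auto simp: \<alpha>_def \<sigma>_def)
  have far1: "par x = v1" if "x < n" "far E c x" "cl1 (par x)" for x
    using lone[OF deep_par[OF that(1,2)] that(3)] .
  have v1c: "\<alpha> v1 = 0" "\<sigma> v1 = 1" "\<beta> v1 z = 3" "\<alpha> z = 2" "\<alpha> z' = 0"
    using zv z(5) by (auto simp: \<alpha>_def \<sigma>_def \<beta>_def)
  have walk1: "(\<exists>S\<subseteq>{0, 1}. walk col x S c) \<and> (\<exists>S. walk col x S c \<and> (0 \<notin> S \<or> S \<subseteq> {0}))"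
    if x: "x < n" "x \<noteq> c" "cl1 (branch x)" for x
  proof (cases "E c x")
    case near: True
    then have clx: "cl1 x"
      using x(3) by (simp add: branch_near)
    show ?thesis
    proof (cases "x = z")
      case True
      have b: "\<beta> z z' = 1"
        using zv z(5) by (simp add: \<beta>_def)
      have "walk col z {1, 0} c"
        using walk_near2[OF z(1,3) zz] v1c(5) b by simp
      moreover have "walk col z {2} c"
        using walk_near[OF z(1)] v1c(4) by simp
      ultimately show ?thesis
        unfolding True by (intro conjI exI[of _ "{1, 0}"] exI[of _ "{2}"]) auto
    next
      case False
      then have "walk col x {0} c"
        using walk_near[OF near] clx by (simp add: \<alpha>_def)
      then show ?thesis
        by (intro conjI exI[of _ "{0}"]) auto
    qed
  next
    case False
    then have far: "far E c x"
      using x(2) by (simp add: far_def)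
    then have p: "par x = v1"
      using far1[OF x(1)] x(3) branch_far by simp
    have "walk col x {1, 0} c"
      using walk_far[OF x(1) far] v1c by (simp add: p)
    moreover have "walk col x {1, 3, 2} c"
      using walk_far2[OF x(1) far z(1)] z(2) v1c by (simp add: p)
    ultimately show ?thesis
      by (intro conjI exI[of _ "{1, 0}"] exI[of _ "{1, 3, 2}"]) auto
  qed
  have walk2: "\<exists>S\<subseteq>{2, 3}. walk col x S c" if x: "x < n" "x \<noteq> c" "cl2 (branch x)" for x
  proof (cases "E c x")
    case True
    then have "cl2 x"
      using x(3) by (simp add: branch_near)
    then have "{\<alpha> x} \<subseteq> {2, 3}"
      using \<alpha>2(1)[of x] by simp
    then show ?thesis
      using walk_near[OF True] by blast
  next
    case False
    then have far: "far E c x"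
      using x(2) by (simp add: far_def)
    then have p: "cl2 (par x)"
      using x(3) branch_far by simp
    then have "{\<sigma> (par x), \<alpha> (par x)} \<subseteq> {2, 3}" "\<sigma> (par x) \<noteq> \<alpha> (par x)"
      using \<alpha>2[OF p] by auto
    then show ?thesis
      using walk_far[OF x(1) far] by blast
  qed
  have deep_cl2: "cl2 v" if "deep E n c v" "\<not> cl1 v" for v
    using deep_cl that by blast
  show ?thesis
  proof (rule rainbow_colorable_if_cases)
    show "\<alpha> x < 4" "\<sigma> x < 4" "\<beta> x y < 4" for x y
      by (auto simp: \<alpha>_def \<sigma>_def \<beta>_def)
    show "\<beta> x v \<noteq> \<sigma> v" if h: "deep E n c v" "E c x" "E x v" for x v
    proof -
      have sb: "same_block E v x" "x \<noteq> v"
        using h E_sym E_irrefl by (auto simp: same_block_def)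
      show ?thesis
      proof (cases "cl1 v")
        case True
        then have "v = v1" "cl1 x"
          using cl1_step h sb(1) lone by blast+
        then show ?thesis
          using True sb(2) by (auto simp: \<beta>_def \<sigma>_def)
      next
        case False
        then have v: "cl2 v"
          using deep_cl2 h(1) by blast
        then have "\<beta> x v = 0"
          using False not3[of v] by (auto simp: \<beta>_def)
        then show ?thesis
          using \<alpha>2[OF v] by auto
      qed
    qed
    show "\<sigma> v \<noteq> \<alpha> v" if h: "deep E n c v" for v
    proof (cases "cl1 v")
      case True
      then show ?thesis
        using lone[OF h] v1c by simp
    next
      case False
      then show ?thesis
        using \<alpha>2[OF deep_cl2[OF h]] by auto
    qed
    show "\<sigma> v \<noteq> \<sigma> v'" if h: "deep E n c v" "deep E n c v'" "E v v'" for v v'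
    proof -
      have sb: "same_block E v v'" "E c v" "E c v'" "v \<noteq> v'"
        using h deep_near E_irrefl by (auto simp: same_block_def)
      have "\<not> cl1 v"
      proof
        assume a: "cl1 v"
        then have "cl1 v'"
          using cl1_step sb by blast
        then show False
          using a lone h(1,2) sb(4) by blast
      qed
      then have v: "cl2 v"
        using deep_cl2 h(1) by blast
      then have v': "cl2 v'"
        using cl2_step sb by blast
      have "v = v2 \<or> v' = v2"
        using pair[OF deep2 h(1,2)] h(3) v v' unfolding cl2_def same_block_def by auto
      then show ?thesis
        using v v' h sb(4) cl_exclusive by (auto simp: \<sigma>_def \<alpha>_def)
    qed
    show "meet x y" if h: "x < n" "y < n" "x \<noteq> c" "y \<noteq> c" "cl1 (branch x)" "cl2 (branch y)" for x y
    proof -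
      obtain S T where ST: "S \<subseteq> {0, 1}" "walk col x S c" "T \<subseteq> {2, 3}" "walk col y T c"
        using walk1[OF h(1,3,5)] walk2[OF h(2,4,6)] by blast
      have "{0, 1} \<inter> {2, 3} = ({} :: nat set)"
        by simp
      then show ?thesis
        using ST by (intro meetI[of x S y T]) blast+
    qed
    show "meet x y" if h: "x < n" "x \<noteq> c" "cl1 (branch x)" "cl3 y" for x y
    proof -
      obtain S T where S: "walk col x S c" "0 \<notin> S \<or> S \<subseteq> {0}" and T: "T \<subseteq> {0, 1}" "walk col x T c"
        using walk1[OF h(1-3)] by blast
      have "2 \<notin> T"
        using T(1) by auto
      then show ?thesis
        using meet_shallow[OF h(4) S T(2)] by blast
    qed
    show "meet x y" if h: "x < n" "x \<noteq> c" "cl2 (branch x)" "cl3 y" for x y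
    proof -
      obtain S where S: "S \<subseteq> {2, 3}" "walk col x S c"
        using walk2[OF h(1-3)] by blast
      have d: "S \<inter> {0} = {}" "S \<inter> {0, 1} = {}"
        using S(1) by auto
      have "walk col y {0} c \<or> walk col y {0, 1} c"
        using shallow_walks[OF h(4)] by blast
      then show ?thesis
        by (elim disjE meetI[OF S(2) _ d(1)] meetI[OF S(2) _ d(2)])
    qed
    show "meet x y" if "cl3 x" "cl3 y" for x y
      by (rule shallow_meet[OF that])
  qed
qed

text \<open>Here both blocks offer alternative walks, so one further vertex in each is enough, and
  \<open>triangles\<close> provides it. The coloring of block 2 arises from that of block 1 by
  exchanging 0 with 2 and 1 with 3.\<close>

lemma rainbow_colorable_all_lone:
  assumes lone1: "\<And>v. deep E n c v \<Longrightarrow> cl1 v \<Longrightarrow> v = v1"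
    and lone2: "\<And>v. deep E n c v \<Longrightarrow> cl2 v \<Longrightarrow> v = v2"
  shows "rainbow_colorable E n 4"
proof -
  define \<alpha> where "\<alpha> x = (if cl1 x then if x = v1 then 0 else 2
    else if cl2 x then if x = v2 then 2 else 0
    else if leader x then 0 else 2 :: nat)" for x
  define \<sigma> where "\<sigma> x = (if cl1 x then 1 else 3 :: nat)" for x
  define \<beta> where "\<beta> x y = (if cl1 x \<and> cl1 y then 3 else 1 :: nat)" for x y
  have not3: "cl3 x \<Longrightarrow> \<not> cl1 x \<and> \<not> cl2 x" for x
    by (simp add: cl3_def)
  interpret leader_coloring n E c v1 v2 \<alpha> \<sigma> \<beta>
  proof
    show "\<beta> x y = \<beta> y x" for x y
      unfolding \<beta>_def by (simp only: conj_commute[of "cl1 x" "cl1 y"])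
    show "\<alpha> x = (if leader x then 0 else 2)" if "cl3 x" for x
      using not3[OF that] by (simp add: \<alpha>_def)
    show "\<beta> x y = 1" if "cl3 x" "cl3 y" for x y
      using not3[OF that(1)] that by (simp add: \<beta>_def)
  qed
  obtain z where z: "E c z" "E v1 z" "z \<noteq> v1"
    using ex_neighbour[OF near1] .
  obtain z' where z': "E c z'" "E v2 z'" "z' \<noteq> v2"
    using ex_neighbour[OF near2] .
  have cl: "cl1 z" "cl2 z'"
    using z z' cl1_step[OF cl_self(1)] cl2_step[OF cl_self(2)] by (auto simp: same_block_def)
  have v1c: "\<alpha> v1 = 0" "\<sigma> v1 = 1" "\<beta> v1 z = 3" "\<alpha> z = 2"
    using cl z cl_self by (auto simp: \<alpha>_def \<sigma>_def \<beta>_def)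
  have v2c: "\<alpha> v2 = 2" "\<sigma> v2 = 3" "\<beta> v2 z' = 1" "\<alpha> z' = 0"
    using cl z' cl_self cl_exclusive[of v2] cl_exclusive[of z'] by (auto simp: \<alpha>_def \<sigma>_def \<beta>_def)
  have walk1: "walk col x {0, 1} c \<and> walk col x {1, 2, 3} c \<or> walk col x {0} c \<and> walk col x {2, 3} c \<or>
      walk col x {2} c \<and> walk col x {0, 3} c"
    if x: "x < n" "x \<noteq> c" "cl1 (branch x)" for x
  proof (cases "E c x")
    case near: True
    then have clx: "cl1 x"
      using x(3) by (simp add: branch_near)
    show ?thesis
    proof (cases "x = v1")
      case True
      have "walk col v1 {0} c"
        using walk_near[OF near1] v1c by simp
      moreover have "walk col v1 {3, 2} c"
        using walk_near2[OF near1 z(1,2)] v1c by simp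
      ultimately show ?thesis
        unfolding True by (simp add: insert_commute)
    next
      case False
      then have e: "E x v1" "\<alpha> x = 2" "\<beta> x v1 = 3"
        using cl1_same[OF clx cl_self(1)] clx cl_self by (auto simp: same_block_def \<alpha>_def \<beta>_def)
      have "walk col x {2} c"
        using walk_near[OF near] e by simp
      moreover have "walk col x {3, 0} c"
        using walk_near2[OF near near1 e(1)] v1c e by simp
      ultimately show ?thesis
        by (simp add: insert_commute)
    qed
  next
    case False
    then have far: "far E c x"
      using x(2) by (simp add: far_def)
    then have p: "par x = v1"
      using lone1[OF deep_par[OF x(1) far]] x(3) branch_far by simp
    have "walk col x {1, 0} c"
      using walk_far[OF x(1) far] v1c by (simp add: p)
    moreover have "walk col x {1, 3, 2} c"
      using walk_far2[OF x(1) far z(1)] z(2) v1c by (simp add: p)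
    ultimately show ?thesis
      by (simp add: insert_commute)
  qed
  have walk2: "walk col x {2, 3} c \<and> walk col x {0, 1, 3} c \<or> walk col x {2} c \<and> walk col x {0, 1} c \<or>
      walk col x {0} c \<and> walk col x {1, 2} c"
    if x: "x < n" "x \<noteq> c" "cl2 (branch x)" for x
  proof (cases "E c x")
    case near: True
    then have clx: "cl2 x"
      using x(3) by (simp add: branch_near)
    show ?thesis
    proof (cases "x = v2")
      case True
      have "walk col v2 {2} c"
        using walk_near[OF near2] v2c by simp
      moreover have "walk col v2 {1, 0} c"
        using walk_near2[OF near2 z'(1,2)] v2c by simp
      ultimately show ?thesis
        unfolding True by (simp add: insert_commute)
    next
      case False
      then have e: "E x v2" "\<alpha> x = 0" "\<beta> x v2 = 1"
        using cl2_same[OF clx cl_self(2)] clx cl_self cl_exclusive[of x]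
        by (auto simp: same_block_def \<alpha>_def \<beta>_def)
      have "walk col x {0} c"
        using walk_near[OF near] e by simp
      moreover have "walk col x {1, 2} c"
        using walk_near2[OF near near2 e(1)] v2c e by simp
      ultimately show ?thesis
        by simp
    qed
  next
    case False
    then have far: "far E c x"
      using x(2) by (simp add: far_def)
    then have p: "par x = v2"
      using lone2[OF deep_par[OF x(1) far]] x(3) branch_far by simp
    have "walk col x {3, 2} c"
      using walk_far[OF x(1) far] v2c by (simp add: p)
    moreover have "walk col x {3, 1, 0} c"
      using walk_far2[OF x(1) far z'(1)] z'(2) v2c by (simp add: p)
    ultimately show ?thesis
      by (simp add: insert_commute)
  qed
  have deep_v: "v = v1 \<or> v = v2" if "deep E n c v" for v
    using deep_cl[OF that] lone1 lone2 that by blast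
  show ?thesis
  proof (rule rainbow_colorable_if_cases)
    show "\<alpha> x < 4" "\<sigma> x < 4" "\<beta> x y < 4" for x y
      by (auto simp: \<alpha>_def \<sigma>_def \<beta>_def)
    show "\<beta> x v \<noteq> \<sigma> v" if h: "deep E n c v" "E c x" "E x v" for x v
    proof (cases "cl1 v")
      case True
      then have "cl1 x"
        using cl1_step[OF True h(2)] E_sym[OF h(3)] by (simp add: same_block_def)
      then show ?thesis
        using True by (simp add: \<beta>_def \<sigma>_def)
    qed (simp add: \<beta>_def \<sigma>_def)
    show "\<sigma> v \<noteq> \<alpha> v" if "deep E n c v" for v
      using deep_v[OF that] v1c v2c by auto
    show "\<sigma> v \<noteq> \<sigma> v'" if h: "deep E n c v" "deep E n c v'" "E v v'" for v v'
      using deep_v[OF h(1)] deep_v[OF h(2)] h(3) E_irrefl v1c(2) v2c(2) by auto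
    show "meet x y" if h: "x < n" "y < n" "x \<noteq> c" "y \<noteq> c" "cl1 (branch x)" "cl2 (branch y)" for x y
    proof -
      consider "walk col x {0, 1} c" "walk col y {2, 3} c" | "walk col x {0, 1} c" "walk col y {2} c"
        | "walk col x {1, 2, 3} c" "walk col y {0} c" | "walk col x {0} c" "walk col y {2, 3} c"
        | "walk col x {0} c" "walk col y {2} c" | "walk col x {2, 3} c" "walk col y {0} c"
        | "walk col x {2} c" "walk col y {0, 1, 3} c" | "walk col x {2} c" "walk col y {0, 1} c"
        | "walk col x {2} c" "walk col y {0} c"
        using walk1[OF h(1,3,5)] walk2[OF h(2,4,6)] by blast
      then show ?thesis
        by cases (auto elim: meetI)
    qed
    show "meet x y" if h: "x < n" "x \<noteq> c" "cl1 (branch x)" "cl3 y" for x y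
      using walk1[OF h(1-3)]
    proof (elim disjE conjE)
      assume "walk col x {0, 1} c" "walk col x {1, 2, 3} c"
      then show ?thesis
        by (intro meet_shallow[OF h(4), of x "{1, 2, 3}" "{0, 1}"]) auto
    next
      assume "walk col x {0} c" "walk col x {2, 3} c"
      then show ?thesis
        by (intro meet_shallow[OF h(4), of x "{0}" "{0}"]) auto
    next
      assume "walk col x {2} c" "walk col x {0, 3} c"
      then show ?thesis
        by (intro meet_shallow[OF h(4), of x "{2}" "{2}"]) auto
    qed
    show "meet x y" if h: "x < n" "x \<noteq> c" "cl2 (branch x)" "cl3 y" for x y
      using walk2[OF h(1-3)]
    proof (elim disjE conjE)
      assume "walk col x {2, 3} c" "walk col x {0, 1, 3} c"
      then show ?thesis
        by (intro meet_shallow[OF h(4), of x "{2, 3}" "{0, 1, 3}"]) auto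
    next
      assume "walk col x {2} c" "walk col x {0, 1} c"
      then show ?thesis
        by (intro meet_shallow[OF h(4), of x "{2}" "{2}"]) auto
    next
      assume "walk col x {0} c" "walk col x {1, 2} c"
      then show ?thesis
        by (intro meet_shallow[OF h(4), of x "{0}" "{0}"]) auto
    qed
    show "meet x y" if "cl3 x" "cl3 y" for x y
      by (rule shallow_meet[OF that])
  qed
qed

end


section \<open>Lower bounds: colors forced at cut vertices\<close>

section \<open>Lower bounds\<close>

locale rainbow = sgraph +
  fixes \<chi> :: "nat set \<Rightarrow> nat" and k :: nat
  assumes card_colors: "card (\<chi> ` edges E) \<le> k"
    and connected: "u < n \<Longrightarrow> v < n \<Longrightarrow> \<exists>S. rwalk E \<chi> u S v"
begin

abbreviation rw :: "nat \<Rightarrow> nat set \<Rightarrow> nat \<Rightarrow> bool" where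
  "rw \<equiv> rwalk E \<chi>"

abbreviation colors :: "nat set" where
  "colors \<equiv> \<chi> ` edges E"

lemma finite_colors: "finite colors"
proof -
  have "edges E \<subseteq> Pow {..<n}"
    using E_less by (auto simp: edges_def)
  then show ?thesis
    using finite_subset by blast
qed

lemma rw_subset: "rw u S v \<Longrightarrow> S \<subseteq> colors"
proof (induction rule: rwalk.induct)
  case (step u v S w)
  then have "{u, v} \<in> edges E"
    unfolding edges_def by blast
  then show ?case
    using step by blast
qed simp

lemma rw_finite: "rw u S v \<Longrightarrow> finite S"
  by (rule finite_subset[OF rw_subset finite_colors])

lemma rw_card: "rw u S v \<Longrightarrow> card S \<le> k"
  by (rule le_trans[OF card_mono[OF finite_colors rw_subset] card_colors])

lemma rw_rev: "rw u S v \<Longrightarrow> rw v S u"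
  by (rule rwalk_rev) (use E_sym in auto)

lemma color_in: "E u v \<Longrightarrow> \<chi> {u, v} \<in> colors"
  unfolding edges_def by blast

lemma rw_first:
  assumes "rw u S v" "u \<noteq> v"
  obtains x T where "E u x" "rw x T v" "S = insert (\<chi> {u, x}) T" "\<chi> {u, x} \<notin> T"
    "card S = Suc (card T)"
  using assms(1)
proof (cases rule: rwalk.cases)
  case nil
  then show ?thesis
    using assms(2) by simp
next
  case (step x T)
  then show ?thesis
    using that[of x T] rw_finite[of x T v] by simp
qed

lemma rw_0: "rw u S v \<Longrightarrow> card S = 0 \<Longrightarrow> u = v"
  using rw_first by (metis nat.distinct(1))

lemma rw_1: "rw u S v \<Longrightarrow> card S = 1 \<Longrightarrow> u \<noteq> v \<Longrightarrow> E u v \<and> S = {\<chi> {u, v}}"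
proof -
  assume a: "rw u S v" "card S = 1" "u \<noteq> v"
  obtain x T where x: "E u x" "rw x T v" "S = insert (\<chi> {u, x}) T" "card S = Suc (card T)"
    using rw_first[OF a(1,3)] by metis
  then have "T = {}" "x = v"
    using rw_0[OF x(2)] rw_finite[OF x(2)] a(2) by auto
  then show ?thesis
    using x by simp
qed

lemma rw_relpow: "rw u S v \<Longrightarrow> (E ^^ card S) u v"
proof (induction rule: rwalk.induct)
  case (step u v S w)
  then have "card (insert (\<chi> {u, v}) S) = Suc (card S)"
    using rw_finite by simp
  then show ?case
    using step by (metis relpowp_Suc_I2)
qed simp

lemma walks_le_k: "u < n \<Longrightarrow> v < n \<Longrightarrow> walks_le k u v"
  using connected rw_relpow rw_card unfolding walks_le_def by metis

text \<open>The set \<open>Q\<close> has b as its only exit, so the walk splits at its arrival at b.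
  The edge from \<open>Q\<close> into b is recorded because its color is the one that later
  arguments force.\<close>

lemma rw_leave:
  assumes "rw u S v" "u \<in> Q" "v \<notin> Q" "\<And>a z. a \<in> Q \<Longrightarrow> E a z \<Longrightarrow> z \<in> Q \<or> z = b"
  obtains S1 S2 a where "rw u S1 b" "rw b S2 v" "S1 \<inter> S2 = {}" "S = S1 \<union> S2"
    "card S = card S1 + card S2" "a \<in> Q" "E a b" "\<chi> {a, b} \<in> S1"
proof -
  have "\<exists>S1 S2 a. rw u S1 b \<and> rw b S2 v \<and> S1 \<inter> S2 = {} \<and> S = S1 \<union> S2 \<and> a \<in> Q \<and> E a b \<and> \<chi> {a, b} \<in> S1"
    using assms(1-3)
  proof (induction rule: rwalk.induct)
    case (step u x S w)
    show ?case
    proof (cases "x = b")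
      case True
      then show ?thesis
        using step rwalk_single[of E u x \<chi>]
        by (intro exI[of _ "{\<chi> {u, x}}"] exI[of _ S] exI[of _ u]) auto
    next
      case False
      then have "x \<in> Q"
        using assms(4)[OF step.prems(1) step.hyps(1)] by blast
      then obtain S1 S2 a where IH: "rw x S1 b" "rw b S2 w" "S1 \<inter> S2 = {}" "S = S1 \<union> S2" "a \<in> Q" "E a b"
        "\<chi> {a, b} \<in> S1"
        using step.IH step.prems by blast
      have "rw u (insert (\<chi> {u, x}) S1) b"
        using rwalk.step[OF step.hyps(1) IH(1)] step.hyps(3) IH(4) by blast
      then show ?thesis
        using IH step.hyps(3)
        by (intro exI[of _ "insert (\<chi> {u, x}) S1"] exI[of _ S2] exI[of _ a]) auto
    qed
  qed blast
  then obtain S1 S2 a where *: "rw u S1 b" "rw b S2 v" "S1 \<inter> S2 = {}" "S = S1 \<union> S2" "a \<in> Q" "E a b"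
    "\<chi> {a, b} \<in> S1"
    by blast
  moreover have "card S = card S1 + card S2"
    unfolding *(4) by (rule card_Un_disjoint[OF rw_finite[OF *(1)] rw_finite[OF *(2)] *(3)])
  ultimately show thesis
    using that by blast
qed

lemma complete_if_1: "k \<le> 1 \<Longrightarrow> u < n \<Longrightarrow> v < n \<Longrightarrow> same_block E u v"
proof -
  assume a: "k \<le> 1" "u < n" "v < n"
  obtain S where S: "rw u S v"
    using connected a by blast
  then have "card S = 0 \<or> card S = 1"
    using rw_card[OF S] a(1) by linarith
  then show ?thesis
    using rw_0[OF S] rw_1[OF S] unfolding same_block_def by blast
qed

lemma singleton_if_0: "k = 0 \<Longrightarrow> u < n \<Longrightarrow> v < n \<Longrightarrow> u = v"
proof -
  assume a: "k = 0" "u < n" "v < n"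
  obtain S where S: "rw u S v"
    using connected a by blast
  then show ?thesis
    using rw_0[OF S] rw_card[OF S] a(1) by simp
qed

end

locale rainbow_pendant_clique = rainbow n E \<chi> k + pendant_clique n E B top
  for n E \<chi> k B top
begin

definition child :: "nat \<Rightarrow> nat \<Rightarrow> bool" where
  "child b u \<longleftrightarrow> u < n \<and> u \<notin> B \<and> top u = b"

lemma child_edge: "child b u \<Longrightarrow> E u b \<and> b \<in> B"
  using top_edge top_B unfolding child_def by blast

lemma child_closed: "child b a \<Longrightarrow> E a z \<Longrightarrow> child b z \<or> z = b"
  using top_unique top_same E_less unfolding child_def by metis

text \<open>The walk has to pass b and b', which gives three nonempty parts with disjoint colors;
  with three colors in total each part is a single edge.\<close>

lemma across:
  assumes u: "child b u" and w: "child b' w" and "b \<noteq> b'"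
  obtains S where "rw u S w" "3 \<le> card S" "card S = 3 \<longrightarrow> S = {\<chi> {u, b}, \<chi> {b, b'}, \<chi> {b', w}}"
proof -
  have ub: "u \<noteq> b" "w \<noteq> b'"
    using child_edge[OF u] child_edge[OF w] E_irrefl by auto
  obtain S where S: "rw u S w"
    using connected u w unfolding child_def by blast
  have w_out: "w \<notin> Collect (child b)"
    using w \<open>b \<noteq> b'\<close> by (simp add: child_def)
  obtain S1 S2 where s: "rw u S1 b" "rw b S2 w" "S = S1 \<union> S2" "card S = card S1 + card S2"
    using rw_leave[OF S, of "Collect (child b)" b] u w_out child_closed by (metis mem_Collect_eq)
  have b_out: "b \<notin> Collect (child b')"
    using child_edge[OF u] by (simp add: child_def)
  obtain T1 T2 where t: "rw w T1 b'" "rw b' T2 b" "S2 = T1 \<union> T2" "card S2 = card T1 + card T2"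
    using rw_leave[OF rw_rev[OF s(2)], of "Collect (child b')" b'] w b_out child_closed
    by (metis mem_Collect_eq)
  have pos: "card S1 \<noteq> 0" "card T1 \<noteq> 0" "card T2 \<noteq> 0"
    using rw_0[OF s(1)] rw_0[OF t(1)] rw_0[OF t(2)] ub \<open>b \<noteq> b'\<close> by auto
  show thesis
  proof (rule that[OF S])
    show "3 \<le> card S"
      using pos s(4) t(4) by linarith
    have "S = {\<chi> {u, b}, \<chi> {b, b'}, \<chi> {b', w}}" if "card S = 3"
    proof -
      have "card S1 = 1" "card T1 = 1" "card T2 = 1"
        using that pos s(4) t(4) by linarith+
      then show ?thesis
        using rw_1[OF s(1)] rw_1[OF t(1)] rw_1[OF t(2)] ub \<open>b \<noteq> b'\<close> s(3) t(3)
        by (auto simp: insert_commute)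
    qed
    then show "card S = 3 \<longrightarrow> S = {\<chi> {u, b}, \<chi> {b, b'}, \<chi> {b', w}}" ..
  qed
qed

lemma cuts_child: "b \<in> cuts \<longleftrightarrow> (\<exists>u. child b u)"
  using top_B unfolding cuts_def child_def by blast

lemma cuts_unique_if_2: "k \<le> 2 \<Longrightarrow> b \<in> cuts \<Longrightarrow> b' \<in> cuts \<Longrightarrow> b = b'"
proof (rule ccontr)
  assume a: "k \<le> 2" "b \<in> cuts" "b' \<in> cuts" "b \<noteq> b'"
  then obtain u w where "child b u" "child b' w"
    unfolding cuts_child by blast
  then obtain S where "rw u S w" "3 \<le> card S"
    using across a(4) by metis
  then show False
    using rw_card[of u S w] a(1) by linarith
qed

text \<open>Three colors admit only the direct path, and it must use all of them.\<close>

lemma three_colors: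
  assumes "k \<le> 3" "child b u" "child b' w" "b \<noteq> b'"
  shows "colors = {\<chi> {u, b}, \<chi> {b, b'}, \<chi> {b', w}}" "card colors = 3"
proof -
  obtain S where S: "rw u S w" "3 \<le> card S" "card S = 3 \<longrightarrow> S = {\<chi> {u, b}, \<chi> {b, b'}, \<chi> {b', w}}"
    by (rule across[OF assms(2-4)])
  have le: "card S \<le> card colors"
    by (rule card_mono[OF finite_colors rw_subset[OF S(1)]])
  have cc: "card colors \<le> 3"
    using card_colors assms(1) by linarith
  have "card S = 3" "card colors = 3"
    using le cc S(2) by linarith+
  moreover from this have "S = colors"
    using card_subset_eq[OF finite_colors rw_subset[OF S(1)]] by simp
  ultimately show "colors = {\<chi> {u, b}, \<chi> {b, b'}, \<chi> {b', w}}" "card colors = 3"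
    using S(3) by auto
qed

lemma distinct_if_card_3: "card {x, y, z} = 3 \<Longrightarrow> x \<noteq> y \<and> x \<noteq> z \<and> y \<noteq> z"
  by (auto simp: card_insert_if split: if_splits)

text \<open>Comparison with a second cut vertex b' shows that all pendant edges at b have the one
  color missing from the rest of the direct path. A walk between two pendant blocks at b would use
  it twice.\<close>

lemma one_pendant_if_3:
  assumes k: "k \<le> 3" and u: "child b u" "child b u'" and w: "child b' w" "b \<noteq> b'"
  shows "same_block E u u'"
proof (rule ccontr)
  assume ns: "\<not> same_block E u u'"
  have same: "\<chi> {a, b} = \<chi> {u, b}" if "child b a" for a
  proof -
    have "card {\<chi> {a, b}, \<chi> {b, b'}, \<chi> {b', w}} = 3" "card {\<chi> {u, b}, \<chi> {b, b'}, \<chi> {b', w}} = 3"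
      using three_colors[OF k that w] three_colors[OF k u(1) w] by simp_all
    moreover have "{\<chi> {a, b}, \<chi> {b, b'}, \<chi> {b', w}} = {\<chi> {u, b}, \<chi> {b, b'}, \<chi> {b', w}}"
      using three_colors(1)[OF k that w] three_colors(1)[OF k u(1) w] by simp
    ultimately show ?thesis
      using distinct_if_card_3 by (metis insert_iff singletonD)
  qed
  let ?Q = "\<lambda>u. {z. child b z \<and> same_block E u z}"
  have closed: "z \<in> ?Q u \<or> z = b" if "child b u" "a \<in> ?Q u" "E a z" for u a z
  proof (cases "z = b")
    case False
    then have "child b z" "child b a"
      using child_closed that by blast+
    then have "same_block E u z"
      using pendant_trans[of u a z] that unfolding child_def same_block_def by blast
    then show ?thesis
      using \<open>child b z\<close> by blast
  qed simp
  obtain S where S: "rw u S u'"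
    using connected u unfolding child_def by blast
  have Q: "u \<in> ?Q u" "u' \<notin> ?Q u" "u' \<in> ?Q u'" "b \<notin> ?Q u'"
    using u ns child_edge[OF u(1)] by (auto simp: child_def)
  obtain S1 S2 a where s: "rw u S1 b" "rw b S2 u'" "S1 \<inter> S2 = {}" "S = S1 \<union> S2"
    "card S = card S1 + card S2" "a \<in> ?Q u" "E a b" "\<chi> {a, b} \<in> S1"
    by (rule rw_leave[OF S Q(1,2) closed[OF u(1)]])
  obtain T1 T2 a' where t: "rw u' T1 b" "rw b T2 b" "T1 \<inter> T2 = {}" "S2 = T1 \<union> T2"
    "card S2 = card T1 + card T2" "a' \<in> ?Q u'" "E a' b" "\<chi> {a', b} \<in> T1"
    by (rule rw_leave[OF rw_rev[OF s(2)] Q(3,4) closed[OF u(2)]])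
  have "\<chi> {a, b} = \<chi> {a', b}"
    using same[of a] same[of a'] s(6) t(6) by simp
  then show False
    using s(3,8) t(4,8) by auto
qed

text \<open>Pendant edges at different cut vertices lie on a common direct path with three distinct
  colors, so four cut vertices would need four colors.\<close>

lemma four_cuts_if_3:
  assumes k: "k \<le> 3" and "{b1, b2, b3, b4} \<subseteq> cuts"
  shows "\<not> distinct [b1, b2, b3, b4]"
proof
  assume d: "distinct [b1, b2, b3, b4]"
  obtain u1 u2 u3 u4 where u: "child b1 u1" "child b2 u2" "child b3 u3" "child b4 u4"
  proof -
    have "b1 \<in> cuts" "b2 \<in> cuts" "b3 \<in> cuts" "b4 \<in> cuts"
      using assms(2) by auto
    then show ?thesis
      using that unfolding cuts_child by blast
  qed
  have ne: "\<chi> {u, b} \<noteq> \<chi> {w, b'}" if "child b u" "child b' w" "b \<noteq> b'" for u w b b'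
    using three_colors[OF k that] distinct_if_card_3 by (metis insert_commute)
  have "card {\<chi> {u1, b1}, \<chi> {u2, b2}, \<chi> {u3, b3}, \<chi> {u4, b4}} = 4"
    using ne[OF u(1,2)] ne[OF u(1,3)] ne[OF u(1,4)] ne[OF u(2,3)] ne[OF u(2,4)] ne[OF u(3,4)] d
    by simp
  moreover have "{\<chi> {u1, b1}, \<chi> {u2, b2}, \<chi> {u3, b3}, \<chi> {u4, b4}} \<subseteq> colors"
    using color_in child_edge u by simp
  ultimately have "4 \<le> card colors"
    using card_mono[OF finite_colors] by metis
  then show False
    using card_colors k by linarith
qed

end


locale rainbow_rooted = rainbow n E \<chi> k + rooted_graph n E c for n E \<chi> k c
begin

definition br :: "nat \<Rightarrow> nat" where
  "br x = (if E c x then x else par x)"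

text \<open>All vertices that reach the root through the block of v; by \<open>side_closed\<close>
  the root is its only exit.\<close>

definition side :: "nat \<Rightarrow> nat set" where
  "side v = {z. z \<noteq> c \<and> z < n \<and> same_block E v (br z)}"

definition tip :: "nat \<Rightarrow> nat" where
  "tip u = \<chi> {u, par u}"

definition rt :: "nat \<Rightarrow> nat" where
  "rt v = \<chi> {v, c}"

text \<open>The colors on the direct path to the root, which is the only walk with two edges since
  parents are unique.\<close>

definition pr :: "nat \<Rightarrow> nat set" where
  "pr u = {tip u, rt (par u)}"

lemma br_near: "E c x \<Longrightarrow> br x = x"
  by (simp add: br_def)

lemma br_far: "far E c x \<Longrightarrow> br x = par x"
  by (simp add: br_def far_def)

lemma kinds: "z \<noteq> c \<Longrightarrow> E c z \<or> far E c z"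
  by (simp add: far_def)

lemma br_step:
  assumes "E a z" "a \<noteq> c" "z \<noteq> c"
  shows "same_block E (br a) (br z) \<and> E c (br a) \<and> E c (br z)"
proof -
  have an: "a < n" "z < n"
    using assms(1) E_less by auto
  have mixed: "br a = br z \<and> E c (br a) \<and> E c (br z)" if "E a z" "E c a" "far E c z" for a z
    using par_unique[OF that(3,2,1)] that(2) br_near[OF that(2)] br_far[OF that(3)] by simp
  show ?thesis
    using kinds[OF assms(2)] kinds[OF assms(3)]
  proof (elim disjE)
    assume "E c a" "E c z"
    then show ?thesis
      using assms(1) br_near by (simp add: same_block_def)
  next
    assume "E c a" "far E c z"
    then show ?thesis
      using mixed[OF assms(1)] by simp
  next
    assume "far E c a" "E c z"
    then show ?thesis
      using mixed[OF E_sym[OF assms(1)]] by simp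
  next
    assume f: "far E c a" "far E c z"
    then show ?thesis
      using par_eq[OF f assms(1)] par(1)[OF an(1) f(1)] br_far by simp
  qed
qed

lemma side_closed:
  assumes "E c v" "a \<in> side v" "E a z"
  shows "z \<in> side v \<or> z = c"
proof (cases "z = c")
  case False
  have "a \<noteq> c" "same_block E v (br a)"
    using assms(2) by (auto simp: side_def)
  then have "same_block E v (br z)"
    using br_step[OF assms(3) _ False] near_trans[OF assms(1)] by blast
  then show ?thesis
    using False E_less[OF assms(3)] by (simp add: side_def)
qed simp

text \<open>The root separates different sides, so a rainbow walk splits there and the colors are
  divided between its halves.\<close>

lemma through_root:
  assumes x: "x < n" "x \<noteq> c" and y: "y < n" "y \<noteq> c" and ns: "\<not> same_block E (br x) (br y)"
  obtains S T where "rw x S c" "rw y T c" "S \<inter> T = {}" "card S + card T \<le> k"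
proof -
  have bx: "E c (br x)"
    using kinds[OF x(2)] par(1)[OF x(1)] by (auto simp: br_near br_far)
  obtain U where U: "rw x U y"
    using connected x y by blast
  have Q: "x \<in> side (br x)" "y \<notin> side (br x)"
    using x ns by (auto simp: side_def)
  obtain S T a where s: "rw x S c" "rw c T y" "S \<inter> T = {}" "U = S \<union> T"
    "card U = card S + card T" "a \<in> side (br x)" "E a c" "\<chi> {a, c} \<in> S"
    by (rule rw_leave[OF U Q side_closed[OF bx]])
  show thesis
    by (rule that[OF s(1) rw_rev[OF s(2)] s(3)]) (use rw_card[OF U] s(5) in simp)
qed

lemma far_ne: "far E c u \<Longrightarrow> u \<noteq> c \<and> \<not> E u c"
  using E_sym unfolding far_def by blast

lemma near_walk_card: "rw y S c \<Longrightarrow> y \<noteq> c \<Longrightarrow> 1 \<le> card S"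
  using rw_0 by (metis less_one not_le)

lemma near_walk_1: "rw y S c \<Longrightarrow> y \<noteq> c \<Longrightarrow> card S = 1 \<Longrightarrow> S = {rt y}"
  using rw_1 unfolding rt_def by blast

lemma near_walk_2:
  assumes "rw y S c" "E c y" "card S = 2"
  obtains y' where "E c y'" "E y y'" "S = {\<chi> {y, y'}, rt y'}" "\<chi> {y, y'} \<noteq> rt y'"
proof -
  have "y \<noteq> c"
    using assms(2) E_irrefl by blast
  then obtain x T where x: "E y x" "rw x T c" "S = insert (\<chi> {y, x}) T" "\<chi> {y, x} \<notin> T"
    "card S = Suc (card T)"
    by (rule rw_first[OF assms(1)])
  \<comment> \<open>A first step to c would leave a closed walk with a single edge, that is, a
    loop.\<close>
  have "x \<noteq> c"
  proof
    assume "x = c"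
    then obtain T' where T': "rw c T c" "card T = 1"
      using x assms(3) by simp
    have False if "rw c T c" "card T = 1"
      using that(1)
    proof (cases rule: rwalk.cases)
      case nil
      then show ?thesis
        using that(2) by simp
    next
      case (step z T')
      then have "card T' = 0"
        using that(2) rw_finite[of z T' c] by simp
      then show ?thesis
        using rw_0[OF step(3)] step(2) E_irrefl by blast
    qed
    then show False
      using T' by blast
  qed
  moreover have "card T = 1"
    using x(5) assms(3) by simp
  ultimately have "E x c" "T = {rt x}"
    using rw_1[OF x(2)] by (auto simp: rt_def)
  then show thesis
    using that[of x] x E_sym by simp
qed

lemma far_walk_card:
  assumes "rw u S c" "far E c u"
  shows "2 \<le> card S"
proof -
  have "card S \<noteq> 0" "card S \<noteq> 1"
    using rw_0[OF assms(1)] rw_1[OF assms(1)] far_ne[OF assms(2)] by auto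
  then show ?thesis
    by linarith
qed

lemma far_walk_2:
  assumes "rw u S c" "far E c u" "card S = 2"
  shows "S = pr u" "tip u \<noteq> rt (par u)"
proof -
  obtain x T where x: "E u x" "rw x T c" "S = insert (\<chi> {u, x}) T" "\<chi> {u, x} \<notin> T" "card S = Suc (card T)"
    using far_ne[OF assms(2)] by (auto intro: rw_first[OF assms(1)])
  have "x \<noteq> c"
    using x(1) far_ne[OF assms(2)] by blast
  then have "E x c" "T = {\<chi> {x, c}}"
    using rw_1[OF x(2)] x(5) assms(3) by auto
  then have "par u = x"
    using par_unique[OF assms(2)] E_sym x(1) by blast
  then show "S = pr u" "tip u \<noteq> rt (par u)"
    using x \<open>T = {\<chi> {x, c}}\<close> by (auto simp: pr_def tip_def rt_def)
qed

text \<open>The alternative to the detour over z is a step to another far vertex; its parent is the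
  same, so the walk would end with the excluded root color.\<close>

lemma far_walk_3:
  assumes "rw u S c" "far E c u" "card S = 3" "rt (par u) \<notin> S"
  obtains z where "E c z" "E (par u) z" "S = {tip u, \<chi> {par u, z}, rt z}"
proof -
  have un: "u < n"
    using E_less rw_first[OF assms(1)] far_ne[OF assms(2)] by metis
  note p = par[OF un assms(2)]
  obtain x T where x: "E u x" "rw x T c" "S = insert (\<chi> {u, x}) T" "card S = Suc (card T)"
    using far_ne[OF assms(2)] by (auto intro: rw_first[OF assms(1)])
  have T2: "card T = 2"
    using x(4) assms(3) by simp
  show thesis
    using far_nbr[OF assms(2) x(1)]
  proof
    assume xp: "x = par u"
    obtain z where z: "E c z" "E x z" "T = {\<chi> {x, z}, rt z}"
      using near_walk_2[OF x(2) _ T2] p(1) xp by metis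
    then show thesis
      using that[of z] x(3) xp by (simp add: tip_def)
  next
    assume "far E c x \<and> par x = par u"
    then have "T = pr x"
      using far_walk_2[OF x(2) _ T2] by blast
    then have "rt (par u) \<in> S"
      using x(3) \<open>far E c x \<and> par x = par u\<close> by (simp add: pr_def)
    then show thesis
      using assms(4) by blast
  qed
qed

text \<open>The vertices below a common parent can be left only by an edge to that parent, whose
  color is a tip.\<close>

lemma tip_in_walk:
  assumes "rw u S c" "far E c u" "u < n"
  obtains a where "a < n" "far E c a" "par a = par u" "tip a \<in> S"
proof -
  let ?Q = "{z. z < n \<and> far E c z \<and> par z = par u}"
  have Q: "u \<in> ?Q" "c \<notin> ?Q"
    using assms(2,3) by (auto simp: far_def)
  have closed: "z \<in> ?Q \<or> z = par u" if "a \<in> ?Q" "E a z" for a z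
    using far_nbr[of a z] that E_less by auto
  obtain S1 S2 a where s: "rw u S1 (par u)" "rw (par u) S2 c" "S1 \<inter> S2 = {}" "S = S1 \<union> S2"
    "card S = card S1 + card S2" "a \<in> ?Q" "E a (par u)" "\<chi> {a, par u} \<in> S1"
    by (rule rw_leave[OF assms(1) Q closed])
  then show thesis
    using that[of a] by (auto simp: tip_def)
qed

end

locale rainbow_rooted_4 = rainbow_rooted n E \<chi> 4 c for n E \<chi> c +
  fixes d1 d2 :: nat
  assumes deep_d: "deep E n c d1" "deep E n c d2" and diff: "\<not> same_block E d1 d2"
begin

definition cross :: "nat \<Rightarrow> nat \<Rightarrow> bool" where
  "cross u w \<longleftrightarrow> u < n \<and> w < n \<and> far E c u \<and> far E c w \<and> \<not> same_block E (par u) (par w)"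

lemma cross_sym: "cross u w \<Longrightarrow> cross w u"
  unfolding cross_def using same_block_sym by blast

text \<open>The two halves of a walk through the root need at least two colors each and at most four
  together. Hence both are direct paths, and they exhaust the colors.\<close>

lemma cross_pr:
  assumes "cross u w"
  shows "card (pr u) = 2" "pr u \<inter> pr w = {}" "pr u \<union> pr w = colors" "tip u \<noteq> rt (par u)"
proof -
  have h: "u < n" "u \<noteq> c" "w < n" "w \<noteq> c" "far E c u" "far E c w" "\<not> same_block E (br u) (br w)"
    using assms unfolding cross_def by (auto simp: br_far far_def)
  obtain S T where S: "rw u S c" "rw w T c" "S \<inter> T = {}" "card S + card T \<le> 4"
    by (rule through_root[OF h(1-4,7)])
  then have two: "card S = 2" "card T = 2"
    using far_walk_card[OF S(1) h(5)] far_walk_card[OF S(2) h(6)] by linarith+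
  note u = far_walk_2[OF S(1) h(5) two(1)] and w = far_walk_2[OF S(2) h(6) two(2)]
  show 1: "card (pr u) = 2" "pr u \<inter> pr w = {}" "tip u \<noteq> rt (par u)"
    using S(3) two u w by simp_all
  have "card (S \<union> T) = 4"
    using card_Un_disjoint[OF rw_finite[OF S(1)] rw_finite[OF S(2)] S(3)] two by simp
  moreover have "S \<union> T \<subseteq> colors"
    using rw_subset[OF S(1)] rw_subset[OF S(2)] by blast
  ultimately have "S \<union> T = colors"
    using card_colors card_mono[OF finite_colors, of "S \<union> T"]
    by (intro card_subset_eq[OF finite_colors]) auto
  then show "pr u \<union> pr w = colors"
    using u(1) w(1) by simp
qed

lemma card_colors_4: "card colors = 4"
proof -
  obtain u w where "cross u w"
    using deep_d diff deep_near far_def par_unique unfolding deep_def cross_def by metis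
  then have "card (pr u \<union> pr w) = 4"
    using cross_pr[of u w] cross_pr(1)[OF cross_sym, of u w]
    by (subst card_Un_disjoint) (auto simp: pr_def)
  then show ?thesis
    using cross_pr(3)[OF \<open>cross u w\<close>] by simp
qed

lemma pr_complement: "cross u w \<Longrightarrow> pr u = colors - pr w"
  using cross_pr(2,3)[of u w] by blast

lemma deep_child: "deep E n c v \<Longrightarrow> \<exists>u. u < n \<and> far E c u \<and> par u = v"
  using par_unique unfolding deep_def by blast

lemma ex_other_branch:
  assumes "E c v"
  obtains w where "w < n" "far E c w" "\<not> same_block E v (par w)"
proof -
  have "\<not> same_block E v d1 \<or> \<not> same_block E v d2"
    using near_trans[of d1 v d2] same_block_sym deep_near deep_d diff assms by blast
  then show thesis
    using that deep_child[OF deep_d(1)] deep_child[OF deep_d(2)] by blast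
qed

text \<open>Both pairs are the complement of the pair of a vertex in another branch.\<close>

lemma pr_same_branch:
  assumes u: "u < n" "far E c u" and u': "u' < n" "far E c u'" and "same_block E (par u) (par u')"
  shows "pr u = pr u'"
proof -
  note p = par(1)[OF u] par(1)[OF u']
  obtain w where w: "w < n" "far E c w" "\<not> same_block E (par u) (par w)"
    using ex_other_branch[OF p(1)] .
  have "\<not> same_block E (par u') (par w)"
    using w(3) near_trans[OF p par(1)[OF w(1,2)]] assms(5) by blast
  then have "cross u w" "cross u' w"
    using u u' w by (auto simp: cross_def)
  then show ?thesis
    using pr_complement by simp
qed

lemma pr_card: "u < n \<Longrightarrow> far E c u \<Longrightarrow> card (pr u) = 2"
  using ex_other_branch[OF par(1)] cross_pr(1) unfolding cross_def by metis

lemma tip_rt: "u < n \<Longrightarrow> far E c u \<Longrightarrow> tip u \<noteq> rt (par u)"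
  using pr_card[of u] by (auto simp: pr_def)

text \<open>Equal pairs with the same root color leave the same tip.\<close>

lemma tip_same:
  assumes "u < n" "far E c u" "u' < n" "far E c u'" "par u = par u'"
  shows "tip u = tip u'"
proof -
  have "pr u = pr u'"
    using pr_same_branch[OF assms(1-4)] assms(5) by simp
  then show ?thesis
    using tip_rt[OF assms(1,2)] tip_rt[OF assms(3,4)] assms(5) unfolding pr_def by (auto simp: doubleton_eq_iff)
qed

text \<open>Two disjoint pairs exhaust the four colors, so a third branch has none left.\<close>

lemma no_three_deep_blocks:
  assumes "deep E n c x" "deep E n c y" "deep E n c z"
  shows "same_block E x y \<or> same_block E x z \<or> same_block E y z"
proof (rule ccontr)
  assume ns: "\<not> ?thesis"
  obtain u v w where u: "u < n" "far E c u" "par u = x" and v: "v < n" "far E c v" "par v = y"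
    and w: "w < n" "far E c w" "par w = z"
    using deep_child assms by metis
  have c: "cross u v" "cross u w" "cross v w"
    using u v w ns by (auto simp: cross_def)
  have "pr w \<subseteq> colors"
    using cross_pr(3)[OF c(2)] by blast
  then have "pr w = {}"
    using cross_pr(3)[OF c(1)] cross_pr(2)[OF c(2)] cross_pr(2)[OF c(3)] by blast
  then show False
    by (simp add: pr_def)
qed

text \<open>Both ends of a walk between different pendant blocks use the same color.\<close>

lemma single_pendant:
  assumes u: "u < n" "far E c u" and u': "u' < n" "far E c u'" and p: "par u = par u'"
  shows "same_block E u u'"
proof (rule ccontr)
  assume ns: "\<not> same_block E u u'"
  let ?Q = "\<lambda>u. {z. z < n \<and> far E c z \<and> same_block E u z}"
  have Q: "u \<in> ?Q u" "u' \<notin> ?Q u" "u' \<in> ?Q u'" "par u \<notin> ?Q u'"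
    using u u' ns par(1)[OF u] by (auto simp: far_def)
  have closed: "z \<in> ?Q u \<or> z = par u" if u: "far E c u" and a: "a \<in> ?Q u" "E a z" for u a z
  proof -
    have "par a = par u"
      using a(1) par_eq[OF u] by (auto simp: same_block_def)
    then show ?thesis
      using far_nbr[of a z] a far_trans[OF u, of a z] E_less[OF a(2)] by (auto simp: same_block_def)
  qed
  obtain S where S: "rw u S u'"
    using connected u u' by blast
  obtain S1 S2 a where s: "rw u S1 (par u)" "rw (par u) S2 u'" "S1 \<inter> S2 = {}" "S = S1 \<union> S2"
    "card S = card S1 + card S2" "a \<in> ?Q u" "E a (par u)" "\<chi> {a, par u} \<in> S1"
    by (rule rw_leave[OF S Q(1,2) closed[OF u(2)]])
  obtain T1 T2 a' where t: "rw u' T1 (par u')" "rw (par u') T2 (par u)" "T1 \<inter> T2 = {}" "S2 = T1 \<union> T2"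
    "card S2 = card T1 + card T2" "a' \<in> ?Q u'" "E a' (par u')" "\<chi> {a', par u'} \<in> T1"
    by (rule rw_leave[OF rw_rev[OF s(2)] Q(3,4) closed[OF u'(2)]])
  have par: "par a = par u" "par a' = par u'"
    using s(6) t(6) par_eq u(2) u'(2) by (auto simp: same_block_def)
  have "tip a = tip a'"
    by (rule tip_same) (use s(6) t(6) par p in auto)
  then show False
    using s(3,8) t(4,8) par by (auto simp: tip_def)
qed

text \<open>Vertices below x and y have the same pair, so equal root colors would force equal tips;
  but a walk from below x to below y uses a tip at either end.\<close>

lemma rt_distinct:
  assumes x: "deep E n c x" and y: "deep E n c y" and "same_block E x y" "x \<noteq> y"
  shows "rt x \<noteq> rt y"
proof
  assume eq: "rt x = rt y"
  obtain u where u: "u < n" "far E c u" "par u = x"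
    using deep_child[OF x] by blast
  obtain w where w: "w < n" "far E c w" "par w = y"
    using deep_child[OF y] by blast
  have "pr u = pr w"
    using pr_same_branch u w assms(3) by blast
  then have tips: "tip u = tip w"
    using tip_rt[OF u(1,2)] tip_rt[OF w(1,2)] u(3) w(3) eq unfolding pr_def by (auto simp: doubleton_eq_iff)
  let ?Q = "\<lambda>v. {z. z < n \<and> far E c z \<and> par z = v}"
  have closed: "z \<in> ?Q v \<or> z = v" if "a \<in> ?Q v" "E a z" for v a z
    using far_nbr[of a z] that E_less by auto
  have Q: "u \<in> ?Q x" "w \<notin> ?Q x" "w \<in> ?Q y" "x \<notin> ?Q y"
    using u w assms(4) deep_near[OF x] by (auto simp: far_def)
  obtain S where S: "rw u S w"
    using connected u w by blast
  obtain S1 S2 a where s: "rw u S1 x" "rw x S2 w" "S1 \<inter> S2 = {}" "S = S1 \<union> S2"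
    "card S = card S1 + card S2" "a \<in> ?Q x" "E a x" "\<chi> {a, x} \<in> S1"
    by (rule rw_leave[OF S Q(1,2) closed])
  obtain T1 T2 a' where t: "rw w T1 y" "rw y T2 x" "T1 \<inter> T2 = {}" "S2 = T1 \<union> T2"
    "card S2 = card T1 + card T2" "a' \<in> ?Q y" "E a' y" "\<chi> {a', y} \<in> T1"
    by (rule rw_leave[OF rw_rev[OF s(2)] Q(3,4) closed])
  have "tip a = tip u" "tip a' = tip w"
    using tip_same[of a u] tip_same[of a' w] s(6) t(6) u w by auto
  then show False
    using tips s(3,6,8) t(4,6,8) by (auto simp: tip_def)
qed

text \<open>Three distinct root colors would have to lie in a common pair.\<close>

lemma no_three_deep_in_block:
  assumes d: "deep E n c x" "deep E n c y" "deep E n c z" and e: "E x y" "E x z" "E y z"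
  shows False
proof -
  have ne: "x \<noteq> y" "x \<noteq> z" "y \<noteq> z"
    using e E_irrefl by auto
  have sb: "same_block E x y" "same_block E x z" "same_block E y z"
    using e by (auto simp: same_block_def)
  have rts: "rt x \<noteq> rt y" "rt x \<noteq> rt z" "rt y \<noteq> rt z"
    using rt_distinct d sb ne by blast+
  obtain u v w where u: "u < n" "far E c u" "par u = x" and v: "v < n" "far E c v" "par v = y"
    and w: "w < n" "far E c w" "par w = z"
    using deep_child d by metis
  have "pr v = pr u" "pr w = pr u"
    using pr_same_branch[of u v] pr_same_branch[of u w] u v w sb by auto
  then have "{rt x, rt y, rt z} \<subseteq> pr u"
    using u(3) v(3) w(3) unfolding pr_def by blast
  then have "card {rt x, rt y, rt z} \<le> card (pr u)"
    by (rule card_mono[rotated]) (simp add: pr_def)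
  then show False
    using pr_card[OF u(1,2)] rts by simp
qed

text \<open>Equality with \<open>P\<close> also places the root color of the helper in
  \<open>P\<close>, so the argument can be continued from the helper.\<close>

definition helped :: "nat \<Rightarrow> nat set \<Rightarrow> bool" where
  "helped y P \<longleftrightarrow> (\<exists>y'. E c y' \<and> E y y' \<and> {\<chi> {y, y'}, rt y'} = P)"

lemma helped_if_two_deep:
  assumes x: "deep E n c x" and x': "deep E n c x'" and xx: "same_block E x x'" "x \<noteq> x'"
    and u: "u < n" "far E c u" "par u = x" and y: "E c y" "\<not> same_block E y x"
    and col: "rt y \<in> pr u"
  shows "helped y (colors - pr u)"
proof -
  have yn: "y < n" "y \<noteq> c"
    using y(1) E_less E_irrefl by blast+
  obtain u' where u': "u' < n" "far E c u'" "par u' = x'"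
    using deep_child[OF x'] by blast
  have pr: "pr u' = pr u"
    using pr_same_branch[OF u(1,2) u'(1,2)] u(3) u'(3) xx by simp
  have "rt x \<noteq> rt x'"
    using rt_distinct x x' xx by blast
  then have tips: "tip u = rt x'" "tip u' = rt x"
    using pr tip_rt[OF u(1,2)] tip_rt[OF u'(1,2)] u(3) u'(3) unfolding pr_def
    by (auto simp: doubleton_eq_iff)
  \<comment> \<open>t is u or u', whichever has the color of yc as its tip.\<close>
  then obtain t where t: "t < n" "far E c t" "same_block E x (par t)" "tip t = rt y" "pr t = pr u"
    using col u u' xx pr unfolding pr_def by (metis empty_iff insert_iff same_block_refl)
  have ns: "\<not> same_block E (br y) (br t)"
  proof
    assume "same_block E (br y) (br t)"
    then have "same_block E y (par t)"
      using br_near[OF y(1)] br_far[OF t(2)] by simp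
    then have "same_block E y x"
      using near_trans[OF y(1) par(1)[OF t(1,2)], of x] deep_near[OF x] same_block_sym[OF t(3)] by blast
    then show False
      using y(2) by blast
  qed
  have tc: "t \<noteq> c"
    using t(2) by (simp add: far_def)
  obtain S T where S: "rw y S c" "rw t T c" "S \<inter> T = {}" "card S + card T \<le> 4"
    by (rule through_root[OF yn t(1) tc ns])
  obtain a where a: "a < n" "far E c a" "par a = par t" "tip a \<in> T"
    by (rule tip_in_walk[OF S(2) t(2,1)])
  then have inT: "rt y \<in> T"
    using tip_same[OF a(1,2) t(1,2) a(3)] t(4) by simp
  have "card S \<noteq> 1"
    using near_walk_1[OF S(1) yn(2)] inT S(3) by auto
  then have two: "card S = 2" "card T = 2"
    using near_walk_card[OF S(1) yn(2)] far_walk_card[OF S(2) t(2)] S(4) by linarith+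
  have T: "T = pr u"
    using far_walk_2[OF S(2) t(2) two(2)] t(5) by simp
  obtain y' where y': "E c y'" "E y y'" "S = {\<chi> {y, y'}, rt y'}"
    using near_walk_2[OF S(1) y(1) two(1)] by metis
  have "S \<subseteq> colors - pr u"
    using rw_subset[OF S(1)] S(3) T by blast
  moreover have "card (colors - pr u) = 2"
    using card_Diff_subset[of "pr u" colors] pr_card[OF u(1,2)] card_colors_4 rw_subset[OF S(2)] T
    by (simp add: pr_def)
  ultimately have "S = colors - pr u"
    using two(1) finite_colors by (intro card_subset_eq) auto
  then show ?thesis
    unfolding helped_def using y' by blast
qed

text \<open>By \<open>thin\<close> the block of v has at most one vertex z besides v and c. If y
  used its direct edge, the walk from w would have to detour over z with colors of
  \<open>pr u\<close>. But then z is helped in the complement of \<open>pr u\<close>, and its helper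
  can only be v, so the edge vz would have a color in both pairs.\<close>

lemma helped_if_lone:
  assumes x: "deep E n c x" and x': "deep E n c x'" and xx: "same_block E x x'" "x \<noteq> x'"
    and u: "u < n" "far E c u" "par u = x"
    and v: "deep E n c v" and vx: "\<not> same_block E v x"
    and w: "w < n" "far E c w" "par w = v"
    and thin: "\<And>z z'. E c z \<Longrightarrow> E c z' \<Longrightarrow> E v z \<Longrightarrow> E v z' \<Longrightarrow> z = z'"
    and y: "E c y" "\<not> same_block E y v" and col: "rt y \<in> pr w"
  shows "helped y (colors - pr w)"
proof -
  have yn: "y < n" "y \<noteq> c"
    using y(1) E_less E_irrefl by blast+
  have wc: "w \<noteq> c"
    using w(2) by (simp add: far_def)
  have "cross w u"
    using u w vx by (simp add: cross_def)
  note cr = cross_pr[OF this]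
  have ns: "\<not> same_block E (br y) (br w)"
    using y(2) br_near[OF y(1)] br_far[OF w(2)] w(3) by simp
  obtain S T where S: "rw y S c" "rw w T c" "S \<inter> T = {}" "card S + card T \<le> 4"
    by (rule through_root[OF yn w(1) wc ns])
  obtain a where a: "a < n" "far E c a" "par a = par w" "tip a \<in> T"
    by (rule tip_in_walk[OF S(2) w(2,1)])
  then have inT: "tip w \<in> T"
    using tip_same[OF a(1,2) w(1,2) a(3)] by simp
  show ?thesis
  proof (cases "card S = 1")
    case True
    then have S1: "S = {rt y}"
      using near_walk_1[OF S(1) yn(2)] by blast
    \<comment> \<open>The walk from w contains the tip of w, which leaves the other color of
      \<open>pr w\<close> for the edge yc.\<close>
    then have "rt y = rt v"
      using S(3) inT col w(3) unfolding pr_def by auto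
    then have rtv: "rt v \<notin> T"
      using S1 S(3) by auto
    have "card T \<noteq> 2"
      using far_walk_2(1)[OF S(2) w(2)] rtv w(3) by (auto simp: pr_def)
    then have T3: "card T = 3"
      using far_walk_card[OF S(2) w(2)] S(4) True by linarith
    obtain z where z: "E c z" "E (par w) z" "T = {tip w, \<chi> {par w, z}, rt z}"
      using far_walk_3[OF S(2) w(2) T3] rtv w(3) by metis
    have sub: "T \<subseteq> colors - {rt v}"
      using rw_subset[OF S(2)] rtv by blast
    have "card {tip w, \<chi> {v, z}, rt z} = 3"
      using T3 z(3) w(3) by simp
    then have "tip w \<noteq> \<chi> {v, z}" "tip w \<noteq> rt z"
      by (auto simp: card_insert_if split: if_splits)
    then have in2: "\<chi> {v, z} \<in> pr u" "rt z \<in> pr u"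
    proof -
      have prw: "pr w = {tip w, rt v}"
        using w(3) by (simp add: pr_def)
      have "\<chi> {v, z} \<in> T" "rt z \<in> T"
        using z(3) w(3) by auto
      then have "\<chi> {v, z} \<in> pr w \<union> pr u" "rt z \<in> pr w \<union> pr u" "\<chi> {v, z} \<noteq> rt v" "rt z \<noteq> rt v"
        using sub cr(3) by auto
      then show "\<chi> {v, z} \<in> pr u" "rt z \<in> pr u"
        using \<open>tip w \<noteq> \<chi> {v, z}\<close> \<open>tip w \<noteq> rt z\<close> unfolding prw by auto
    qed
    have vz: "E v z" "same_block E v z" "E c v"
      using z(2) w(3) deep_near[OF v] by (auto simp: same_block_def)
    have "\<not> same_block E z x"
      using vx near_trans[OF vz(3) z(1), of x] vz(2) deep_near[OF x] by blast
    then have "helped z (colors - pr u)"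
      by (rule helped_if_two_deep[OF x x' xx u z(1) _ in2(2)])
    then obtain z' where z': "E c z'" "E z z'" "{\<chi> {z, z'}, rt z'} = colors - pr u"
      unfolding helped_def by blast
    have "z' = v"
    proof (rule ccontr)
      assume "z' \<noteq> v"
      then have "E v z'"
        using near_trans[OF vz(3) z(1) z'(1) vz(2)] z'(2) by (simp add: same_block_def)
      then have "z = z'"
        using thin z(1) z'(1) vz(1) by blast
      then show False
        using z'(2) E_irrefl by simp
    qed
    then have "\<chi> {v, z} \<notin> pr u"
      using z'(3) by (auto simp: insert_commute)
    then show ?thesis
      using in2(1) by blast
  next
    case False
    then have two: "card S = 2" "card T = 2"
      using near_walk_card[OF S(1) yn(2)] far_walk_card[OF S(2) w(2)] S(4) by linarith+
    have T: "T = pr w"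
      using far_walk_2[OF S(2) w(2) two(2)] by simp
    obtain y' where y': "E c y'" "E y y'" "S = {\<chi> {y, y'}, rt y'}"
      using near_walk_2[OF S(1) y(1) two(1)] by metis
    have "S \<subseteq> colors - pr w"
      using rw_subset[OF S(1)] S(3) T by blast
    moreover have "card (colors - pr w) = 2"
      using card_Diff_subset[of "pr w" colors] pr_card[OF w(1,2)] card_colors_4 rw_subset[OF S(2)] T
      by (simp add: pr_def)
    ultimately have "S = colors - pr w"
      using two(1) finite_colors by (intro card_subset_eq) auto
    then show ?thesis
      unfolding helped_def using y' by blast
  qed
qed

text \<open>Following helpers alternates between the two pairs of colors, hence visits four vertices.\<close>

lemma four_in_block:
  assumes y: "E c y" and P: "P \<inter> Q = {}" "rt y \<in> P"
    and PQ: "\<And>z. E c z \<Longrightarrow> same_block E y z \<Longrightarrow> rt z \<in> P \<Longrightarrow> helped z Q"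
    and QP: "\<And>z. E c z \<Longrightarrow> same_block E y z \<Longrightarrow> rt z \<in> Q \<Longrightarrow> helped z P"
  shows "\<exists>y2 y3 y4. E c y2 \<and> E c y3 \<and> E c y4 \<and> E y y2 \<and> E y y3 \<and> E y y4 \<and>
    y2 \<noteq> y3 \<and> y2 \<noteq> y4 \<and> y3 \<noteq> y4"
proof -
  have PQ': "a \<noteq> b" if "a \<in> P" "b \<in> Q" for a b
    using P(1) that by blast
  obtain y2 where y2: "E c y2" "E y y2" "{\<chi> {y, y2}, rt y2} = Q"
    using PQ[OF y _ P(2)] unfolding helped_def by auto
  have s2: "same_block E y y2"
    using y2(2) by (simp add: same_block_def)
  have q2: "rt y2 \<in> Q" "\<chi> {y, y2} \<in> Q"
    using y2(3) by auto
  obtain y3 where y3: "E c y3" "E y2 y3" "{\<chi> {y2, y3}, rt y3} = P"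
    using QP[OF y2(1) s2 q2(1)] unfolding helped_def by auto
  have s3: "same_block E y y3"
    using near_trans[OF y y2(1) y3(1) s2] y3(2) by (simp add: same_block_def)
  have q3: "rt y3 \<in> P" "\<chi> {y2, y3} \<in> P"
    using y3(3) by auto
  obtain y4 where y4: "E c y4" "E y3 y4" "{\<chi> {y3, y4}, rt y4} = Q"
    using PQ[OF y3(1) s3 q3(1)] unfolding helped_def by auto
  have s4: "same_block E y y4"
    using near_trans[OF y y3(1) y4(1) s3] y4(2) by (simp add: same_block_def)
  have q4: "rt y4 \<in> Q" "\<chi> {y3, y4} \<in> Q"
    using y4(3) by auto
  \<comment> \<open>The edges entering and leaving y2 have colors in different pairs, so the second
    does not lead back to y, and likewise at y3. Root colors in different pairs separate y from
    y4.\<close>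
  have "y \<noteq> y3"
    using PQ'[OF q3(2) q2(2)] by (auto simp: insert_commute)
  moreover have "y \<noteq> y4"
    using PQ'[OF P(2) q4(1)] by auto
  moreover have "y2 \<noteq> y4"
    using PQ'[OF q3(2) q4(2)] by (auto simp: insert_commute)
  moreover have "y2 \<noteq> y3" "y3 \<noteq> y4"
    using y3(2) y4(2) E_irrefl by auto
  ultimately show ?thesis
    using y2 y3 y4 s3 s4 unfolding same_block_def by blast
qed

text \<open>The pairs of \<open>four_in_block\<close> are those of x and of a deep v in another
  block. The block of x has two deep vertices; that of v has two as well, or v is alone and its
  block thin. In both cases helpers exist for either pair.\<close>

lemma large_shallow_blocks:
  assumes x: "deep E n c x" and x': "deep E n c x'" and xx: "same_block E x x'" "x \<noteq> x'"
    and thin: "\<And>v z z'. deep E n c v \<Longrightarrow> (\<And>v'. deep E n c v' \<Longrightarrow> same_block E v v' \<Longrightarrow> v = v') \<Longrightarrow>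
      E c z \<Longrightarrow> E c z' \<Longrightarrow> E v z \<Longrightarrow> E v z' \<Longrightarrow> z = z'"
    and y: "shallow E n c y"
  shows "\<exists>y2 y3 y4. E c y2 \<and> E c y3 \<and> E c y4 \<and> E y y2 \<and> E y y3 \<and> E y y4 \<and>
    y2 \<noteq> y3 \<and> y2 \<noteq> y4 \<and> y3 \<noteq> y4"
proof -
  have cy: "E c y"
    using y by (simp add: shallow_def)
  have "\<not> same_block E d1 x \<or> \<not> same_block E d2 x"
    using near_trans[of d1 x d2] same_block_sym deep_near deep_d diff x by blast
  then obtain v where v: "deep E n c v" "\<not> same_block E v x"
    using deep_d by blast
  obtain u where u: "u < n" "far E c u" "par u = x"
    using deep_child[OF x] by blast
  obtain w where w: "w < n" "far E c w" "par w = v"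
    using deep_child[OF v(1)] by blast
  have "cross w u"
    using u w v(2) by (simp add: cross_def)
  note cr = cross_pr[OF this]
  have compl: "colors - pr u = pr w" "colors - pr w = pr u"
    using cr(2,3) by blast+
  have apart: "\<not> same_block E z d" if "same_block E y z" "E c z" "deep E n c d" for z d
  proof
    assume "same_block E z d"
    then have "same_block E y d"
      using near_trans[OF cy that(2) _ that(1)] deep_near[OF that(3)] by blast
    then show False
      using y that(3) deep_near[OF that(3)] same_block_sym unfolding shallow_def by blast
  qed
  have h2: "helped z (pr w)" if "E c z" "same_block E y z" "rt z \<in> pr u" for z
    using helped_if_two_deep[OF x x' xx u that(1) apart[OF that(2,1) x] that(3)] compl(1) by simp
  have h1: "helped z (pr u)" if "E c z" "same_block E y z" "rt z \<in> pr w" for z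
  proof (cases "\<exists>v'. deep E n c v' \<and> same_block E v v' \<and> v \<noteq> v'")
    case True
    then obtain v' where v': "deep E n c v'" "same_block E v v'" "v \<noteq> v'"
      by blast
    show ?thesis
      using helped_if_two_deep[OF v(1) v' w that(1) apart[OF that(2,1) v(1)] that(3)] compl(2) by simp
  next
    case False
    then have thin_v: "z = z'" if "E c z" "E c z'" "E v z" "E v z'" for z z'
      using thin[OF v(1) _ that] by blast
    have "helped z (colors - pr w)"
      by (rule helped_if_lone[OF x x' xx u v w thin_v that(1) apart[OF that(2,1) v(1)] that(3)])
    then show ?thesis
      using compl(2) by simp
  qed
  have "\<chi> {c, y} \<in> colors"
    by (rule color_in[OF cy])
  then have "rt y \<in> pr w \<or> rt y \<in> pr u"
    using cr(3) by (auto simp: rt_def insert_commute)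
  then show ?thesis
  proof
    assume "rt y \<in> pr w"
    then show ?thesis
      by (rule four_in_block[OF cy cr(2) _ h1 h2])
  next
    assume "rt y \<in> pr u"
    then show ?thesis
      using cr(2) by (intro four_in_block[OF cy _ _ h2 h1]) auto
  qed
qed

end


section \<open>Characterizations and their translation into sentences\<close>

section \<open>Characterizations\<close>

definition universal :: "(nat \<Rightarrow> nat \<Rightarrow> bool) \<Rightarrow> nat \<Rightarrow> nat \<Rightarrow> bool" where
  "universal E n c \<longleftrightarrow> (\<forall>x<n. same_block E c x)"

definition one_pendant_each :: "(nat \<Rightarrow> nat \<Rightarrow> bool) \<Rightarrow> nat \<Rightarrow> nat \<Rightarrow> bool" where
  "one_pendant_each E n c \<longleftrightarrow> (\<forall>v<n. \<forall>u<n. \<forall>w<n. deep E n c v \<longrightarrow>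
    far E c u \<longrightarrow> far E c w \<longrightarrow> E v u \<longrightarrow> E v w \<longrightarrow> same_block E u w)"

definition one_deep_block :: "(nat \<Rightarrow> nat \<Rightarrow> bool) \<Rightarrow> nat \<Rightarrow> nat \<Rightarrow> bool" where
  "one_deep_block E n c \<longleftrightarrow>
    (\<forall>v<n. \<forall>w<n. deep E n c v \<longrightarrow> deep E n c w \<longrightarrow> same_block E v w)"

definition lone :: "(nat \<Rightarrow> nat \<Rightarrow> bool) \<Rightarrow> nat \<Rightarrow> nat \<Rightarrow> nat \<Rightarrow> bool" where
  "lone E n c v \<longleftrightarrow> (\<forall>w<n. deep E n c w \<longrightarrow> same_block E v w \<longrightarrow> v = w)"

definition cond0 :: "(nat \<Rightarrow> nat \<Rightarrow> bool) \<Rightarrow> nat \<Rightarrow> bool" where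
  "cond0 E n \<longleftrightarrow> (\<forall>x<n. \<forall>y<n. x = y)"

definition cond1 :: "(nat \<Rightarrow> nat \<Rightarrow> bool) \<Rightarrow> nat \<Rightarrow> bool" where
  "cond1 E n \<longleftrightarrow> (\<forall>x<n. \<forall>y<n. same_block E x y)"

definition cond2 :: "(nat \<Rightarrow> nat \<Rightarrow> bool) \<Rightarrow> nat \<Rightarrow> bool" where
  "cond2 E n \<longleftrightarrow> (\<exists>c<n. universal E n c) \<and>
    (\<forall>x<n. \<forall>y<n. \<forall>z<n. same_block E x y \<or> same_block E x z \<or> same_block E y z)"

text \<open>The cut vertices of the central clique are the deep vertices and, if there is a shallow
  vertex, c. The last clause bounds their number by three; the two clauses before it allow one
  pendant block at each.\<close>

definition cond3_at :: "(nat \<Rightarrow> nat \<Rightarrow> bool) \<Rightarrow> nat \<Rightarrow> nat \<Rightarrow> bool" where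
  "cond3_at E n c \<longleftrightarrow> one_deep_block E n c \<and> one_pendant_each E n c \<and>
    (\<forall>y<n. \<forall>z<n. shallow E n c y \<longrightarrow> shallow E n c z \<longrightarrow> same_block E y z) \<and>
    \<not> (\<exists>v1<n. \<exists>v2<n. \<exists>v3<n. deep E n c v1 \<and> deep E n c v2 \<and> deep E n c v3 \<and>
      v1 \<noteq> v2 \<and> v1 \<noteq> v3 \<and> v2 \<noteq> v3 \<and>
      ((\<exists>y<n. shallow E n c y) \<or>
       (\<exists>v4<n. deep E n c v4 \<and> v1 \<noteq> v4 \<and> v2 \<noteq> v4 \<and> v3 \<noteq> v4)))"

text \<open>Any number of blocks sharing one vertex can be colored with three colors;
  \<open>cond3_at\<close> does not cover this case in general.\<close>

definition cond3 :: "(nat \<Rightarrow> nat \<Rightarrow> bool) \<Rightarrow> nat \<Rightarrow> bool" where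
  "cond3 E n \<longleftrightarrow> (\<exists>c<n. universal E n c) \<or> (\<exists>c<n. rooted E n c \<and> cond3_at E n c)"

text \<open>A single deep block is the case of a clique with pendant blocks. The last three
  alternatives correspond to \<open>rainbow_colorable_cyclic\<close>,
  \<open>rainbow_colorable_all_lone\<close> and \<open>rainbow_colorable_lone\<close>.\<close>

definition cond4_at :: "(nat \<Rightarrow> nat \<Rightarrow> bool) \<Rightarrow> nat \<Rightarrow> nat \<Rightarrow> bool" where
  "cond4_at E n c \<longleftrightarrow> one_deep_block E n c \<or>
    one_pendant_each E n c \<and>
    (\<forall>x<n. \<forall>y<n. \<forall>z<n. deep E n c x \<longrightarrow> deep E n c y \<longrightarrow> deep E n c z \<longrightarrow>
      (same_block E x y \<or> same_block E x z \<or> same_block E y z) \<and> \<not> (E x y \<and> E x z \<and> E y z)) \<and>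
    ((\<forall>y<n. shallow E n c y \<longrightarrow> (\<exists>y2<n. \<exists>y3<n. \<exists>y4<n. E c y2 \<and> E c y3 \<and> E c y4 \<and>
        E y y2 \<and> E y y3 \<and> E y y4 \<and> y2 \<noteq> y3 \<and> y2 \<noteq> y4 \<and> y3 \<noteq> y4)) \<or>
     (\<forall>v<n. deep E n c v \<longrightarrow> lone E n c v) \<or>
     (\<exists>v<n. deep E n c v \<and> lone E n c v \<and>
       (\<exists>z<n. \<exists>z'<n. E c z \<and> E c z' \<and> E v z \<and> E v z' \<and> z \<noteq> z')))"

definition cond4 :: "(nat \<Rightarrow> nat \<Rightarrow> bool) \<Rightarrow> nat \<Rightarrow> bool" where
  "cond4 E n \<longleftrightarrow> (\<exists>c<n. rooted E n c \<and> cond4_at E n c)"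

text \<open>If all pendant blocks hang on one vertex of the clique, that vertex is adjacent to
  everything else; without pendant blocks any vertex of \<open>B\<close> will do.\<close>

lemma (in pendant_clique) universal_if_one_cut:
  assumes "\<And>b b'. b \<in> cuts \<Longrightarrow> b' \<in> cuts \<Longrightarrow> b = b'" "0 < n"
  shows "\<exists>b<n. universal E n b"
proof -
  obtain b where b: "b \<in> B" "\<And>b'. b' \<in> cuts \<Longrightarrow> b' = b"
  proof (cases "cuts = {}")
    case True
    then show ?thesis
      using that[of "top 0"] top_B[OF assms(2)] by blast
  next
    case False
    then obtain b where "b \<in> cuts"
      by blast
    then show ?thesis
      using that[of b] assms(1) unfolding cuts_def by blast
  qed
  have "same_block E b x" if "x < n" for x
  proof (cases "x \<in> B")
    case True
    then show ?thesis
      using B_clique b(1) by blast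
  next
    case False
    then have "top x \<in> cuts"
      using that top_B unfolding cuts_def by blast
    then show ?thesis
      using b(2) top_edge[OF that False] E_sym by (auto simp: same_block_def)
  qed
  then show ?thesis
    using b(1) B_less unfolding universal_def by blast
qed

locale block_graph_of_radius_two = rooted_graph +
  assumes triangles: "every_edge_in_triangle E"
begin

lemma n_pos: "0 < n"
  using c_less by simp

lemma rooted_if_universal:
  assumes "b < n" "universal E n b"
  shows "rooted_graph n E b"
proof
  have "within_two E n b"
    using assms(2) unfolding within_two_def universal_def far_def same_block_def by blast
  then show "rooted E n b"
    by (rule rooted_if_within_two[OF locally_separated assms(1)])
qed (rule assms(1))

text \<open>A universal vertex is itself a root without deep vertices, so the central clique built
  at it is a singleton.\<close>

lemma star:
  assumes "b < n" "universal E n b"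
  shows "pendant_clique n E {b} (\<lambda>u. if u \<in> {b} then u else if E b u then b else rooted_graph.par E b u)"
proof -
  interpret u: rooted_graph n E b
    by (rule rooted_if_universal[OF assms])
  have no: "\<not> deep E n b v" for v
    using assms(2) unfolding deep_def universal_def far_def same_block_def by blast
  have "insert b {y. E b y \<and> (\<exists>v<n. deep E n b v \<and> same_block E v y)} = {b}"
    using no by blast
  then show ?thesis
    using u.pendant_clique_if_deep_same_block[OF triangles] no by simp
qed

definition hub :: "nat set" where
  "hub = insert c {y. E c y \<and> (\<exists>v<n. deep E n c v \<and> same_block E v y)}"

definition hub_top :: "nat \<Rightarrow> nat" where
  "hub_top u = (if u \<in> hub then u else if E c u then c else par u)"

lemma hub: "one_deep_block E n c \<Longrightarrow> pendant_clique n E hub hub_top"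
  using pendant_clique_if_deep_same_block[OF triangles] deep_near
  unfolding hub_def hub_top_def one_deep_block_def by blast

lemma not_hub_near: "u < n \<Longrightarrow> u \<notin> hub \<Longrightarrow> E c u \<Longrightarrow> shallow E n c u \<and> hub_top u = c"
  by (auto simp: hub_def hub_top_def shallow_def)

lemma not_hub_far: "u < n \<Longrightarrow> u \<notin> hub \<Longrightarrow> \<not> E c u \<Longrightarrow> far E c u \<and> hub_top u = par u \<and> deep E n c (par u)"
  using deep_par by (auto simp: hub_def hub_top_def far_def)

lemma shallow_not_hub: "shallow E n c y \<Longrightarrow> y < n \<and> y \<notin> hub \<and> hub_top y = c"
  using E_less E_irrefl by (auto simp: hub_def hub_top_def shallow_def)

lemma far_not_hub: "u < n \<Longrightarrow> far E c u \<Longrightarrow> u \<notin> hub \<and> hub_top u = par u"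
  by (auto simp: hub_def hub_top_def far_def)

lemma colorable_2: "cond2 E n \<Longrightarrow> rainbow_colorable E n 2"
proof -
  assume c2: "cond2 E n"
  then obtain b where b: "b < n" "universal E n b"
    unfolding cond2_def by blast
  interpret pendant_clique n E "{b}" "\<lambda>u. if u \<in> {b} then u else if E b u then b else rooted_graph.par E b u"
    by (rule star[OF b])
  show ?thesis
    by (rule rainbow_colorable_2) (use c2 in \<open>auto simp: cond2_def\<close>)
qed

lemma colorable_3_universal:
  assumes b: "b < n" "universal E n b"
  shows "rainbow_colorable E n 3"
proof -
  interpret pendant_clique n E "{b}" "\<lambda>u. if u \<in> {b} then u else if E b u then b else rooted_graph.par E b u"
    by (rule star[OF b])
  show ?thesis
    by (rule rainbow_colorable_3_star) (rule refl)
qed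

lemma four_elements:
  assumes "4 \<le> card A"
  obtains a b d e where "a \<in> A" "b \<in> A" "d \<in> A" "e \<in> A" "distinct [a, b, d, e]"
proof -
  obtain T where T: "T \<subseteq> A" "card T = 4"
    using obtain_subset_with_card_n[OF assms] by blast
  obtain xs where xs: "set xs = T" "distinct xs"
    using finite_distinct_list[of T] T(2) card.infinite by fastforce
  then have "length xs = 4"
    using T(2) distinct_card by metis
  then obtain a b d e where "xs = [a, b, d, e]"
    by (auto simp: numeral_eq_Suc length_Suc_conv)
  then show thesis
    using that[of a b d e] xs T(1) by auto
qed

lemma par_child: "deep E n c v \<Longrightarrow> far E c u \<Longrightarrow> E v u \<Longrightarrow> par u = v"
  using par_unique deep_near by blast

lemma colorable_3_at:
  assumes c3: "cond3_at E n c"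
  shows "rainbow_colorable E n 3"
proof -
  have odb: "one_deep_block E n c"
    using c3 unfolding cond3_at_def by blast
  interpret pendant_clique n E hub hub_top
    by (rule hub[OF odb])
  have cut: "b = c \<and> (\<exists>y<n. shallow E n c y) \<or> deep E n c b" if b: "b \<in> cuts" for b
  proof -
    obtain u where u: "u < n" "u \<notin> hub" "hub_top u = b"
      using b unfolding cuts_def by blast
    then show ?thesis
      using not_hub_near[OF u(1,2)] not_hub_far[OF u(1,2)] by (cases "E c u") auto
  qed
  show ?thesis
  proof (rule rainbow_colorable_3)
    fix u v
    assume uv: "u < n" "v < n" "u \<notin> hub" "v \<notin> hub" "hub_top u = hub_top v"
    show "same_block E u v"
    proof (cases "E c u")
      case True
      then have u: "shallow E n c u" "hub_top u = c"
        using not_hub_near[OF uv(1,3)] by auto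
      have "E c v"
      proof (rule ccontr)
        assume "\<not> E c v"
        then have "deep E n c c"
          using not_hub_far[OF uv(2,4)] u(2) uv(5) by auto
        then show False
          using deep_near E_irrefl by blast
      qed
      then have "shallow E n c v"
        using not_hub_near[OF uv(2,4)] by blast
      then show ?thesis
        using c3 u(1) uv(1,2) unfolding cond3_at_def by blast
    next
      case False
      then have u: "far E c u" "hub_top u = par u" "deep E n c (par u)"
        using not_hub_far[OF uv(1,3)] by auto
      have "\<not> E c v"
      proof
        assume "E c v"
        then have "deep E n c c"
          using not_hub_near[OF uv(2,4)] u(2,3) uv(5) by simp
        then show False
          using deep_near E_irrefl by blast
      qed
      then have v: "far E c v" "par v = par u"
        using not_hub_far[OF uv(2,4)] u(2) uv(5) by auto
      have "one_pendant_each E n c"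
        using c3 unfolding cond3_at_def by blast
      then show ?thesis
        using u v uv(1,2) par(2)[OF uv(1) u(1)] par(2)[OF uv(2) v(1)] deep_near[OF u(3)]
        unfolding one_pendant_each_def by metis
    qed
  next
    show "card cuts \<le> 3"
    proof (rule ccontr)
      assume "\<not> card cuts \<le> 3"
      then have "4 \<le> card cuts"
        by simp
      then obtain b1 b2 b3 b4 where b: "b1 \<in> cuts" "b2 \<in> cuts" "b3 \<in> cuts" "b4 \<in> cuts"
        "distinct [b1, b2, b3, b4]"
        by (rule four_elements)
      have at_most: "\<not> (\<exists>v1<n. \<exists>v2<n. \<exists>v3<n. deep E n c v1 \<and> deep E n c v2 \<and> deep E n c v3 \<and>
          v1 \<noteq> v2 \<and> v1 \<noteq> v3 \<and> v2 \<noteq> v3 \<and> ((\<exists>y<n. shallow E n c y) \<or>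
          (\<exists>v4<n. deep E n c v4 \<and> v1 \<noteq> v4 \<and> v2 \<noteq> v4 \<and> v3 \<noteq> v4)))"
        using c3 unfolding cond3_at_def by (elim conjE)
      have no: False if "deep E n c v1" "deep E n c v2" "deep E n c v3" "distinct [v1, v2, v3]"
        "(\<exists>y<n. shallow E n c y) \<or> (\<exists>v4. deep E n c v4 \<and> v4 \<notin> {v1, v2, v3})" for v1 v2 v3
      proof -
        have "v1 < n" "v2 < n" "v3 < n"
          using deep_near that by blast+
        moreover have "v1 \<noteq> v2" "v1 \<noteq> v3" "v2 \<noteq> v3"
          using that(4) by auto
        moreover have "(\<exists>y<n. shallow E n c y) \<or>
            (\<exists>v4<n. deep E n c v4 \<and> v1 \<noteq> v4 \<and> v2 \<noteq> v4 \<and> v3 \<noteq> v4)"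
          using that(5) deep_near by auto
        ultimately show False
          using at_most that(1-3) by blast
      qed
      \<comment> \<open>Among four distinct cut vertices at most one is c, and c is a cut vertex
        only through a shallow vertex; the others are deep, which the last clause of
        \<open>cond3_at\<close> excludes.\<close>
      have "(\<exists>y<n. shallow E n c y) \<or> b \<noteq> c" if "b \<in> cuts" for b
        using cut[OF that] deep_near E_irrefl by blast
      then show False
        using cut[OF b(1)] cut[OF b(2)] cut[OF b(3)] cut[OF b(4)] b(5)
          no[of b1 b2 b3] no[of b1 b2 b4] no[of b1 b3 b4] no[of b2 b3 b4] by auto
    qed
  qed
qed

lemma colorable_4_at:
  assumes c4: "cond4_at E n c"
  shows "rainbow_colorable E n 4"
proof (cases "one_deep_block E n c")
  case True
  interpret pendant_clique n E hub hub_top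
    by (rule hub[OF True])
  show ?thesis
    by (rule rainbow_colorable_4)
next
  case False
  have c4': "one_pendant_each E n c \<and>
    (\<forall>x<n. \<forall>y<n. \<forall>z<n. deep E n c x \<longrightarrow> deep E n c y \<longrightarrow> deep E n c z \<longrightarrow>
      (same_block E x y \<or> same_block E x z \<or> same_block E y z) \<and> \<not> (E x y \<and> E x z \<and> E y z)) \<and>
    ((\<forall>y<n. shallow E n c y \<longrightarrow> (\<exists>y2<n. \<exists>y3<n. \<exists>y4<n. E c y2 \<and> E c y3 \<and> E c y4 \<and>
        E y y2 \<and> E y y3 \<and> E y y4 \<and> y2 \<noteq> y3 \<and> y2 \<noteq> y4 \<and> y3 \<noteq> y4)) \<or>
     (\<forall>v<n. deep E n c v \<longrightarrow> lone E n c v) \<or>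
     (\<exists>v<n. deep E n c v \<and> lone E n c v \<and>
       (\<exists>z<n. \<exists>z'<n. E c z \<and> E c z' \<and> E v z \<and> E v z' \<and> z \<noteq> z')))"
    using c4 unfolding cond4_at_def
  proof (rule disjE)
    assume "one_deep_block E n c"
    with False show ?thesis
      by contradiction
  qed
  note ope = c4'[THEN conjunct1] and last = c4'[THEN conjunct2, THEN conjunct2]
  have three: "\<And>x y z. deep E n c x \<Longrightarrow> deep E n c y \<Longrightarrow> deep E n c z \<Longrightarrow>
      (same_block E x y \<or> same_block E x z \<or> same_block E y z) \<and> \<not> (E x y \<and> E x z \<and> E y z)"
    using c4'[THEN conjunct2, THEN conjunct1] deep_near by blast
  obtain v1 v2 where v: "deep E n c v1" "deep E n c v2" "\<not> same_block E v1 v2"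
    using False unfolding one_deep_block_def by blast
  have two: "two_deep_blocks n E c v1 v2" if v: "deep E n c v1" "deep E n c v2" "\<not> same_block E v1 v2" for v1 v2
  proof
    show "same_block E v1 v \<or> same_block E v2 v" if "deep E n c v" for v
      using three[OF v(1,2) that] v(3) by blast
    show "same_block E u w" if h: "u < n" "w < n" "far E c u" "far E c w" "par u = par w" for u w
    proof -
      have "E (par u) u" "E (par u) w" "deep E n c (par u)"
        using par(2)[OF h(1,3)] par(2)[OF h(2,4)] h(5) deep_par[OF h(1,3)] by simp_all
      then show ?thesis
        using ope h deep_near unfolding one_pendant_each_def by blast
    qed
  qed (use v triangles in auto)
  have pair: "deep E n c x \<Longrightarrow> deep E n c y \<Longrightarrow> deep E n c z \<Longrightarrow> E x y \<Longrightarrow> E x z \<Longrightarrow> E y z \<Longrightarrow> False" for x y z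
    using three by blast
  have lone_eq: "w = v" if "lone E n c v" "deep E n c w" "same_block E v w" for v w
    using that deep_near unfolding lone_def by blast
  have wide: "rainbow_colorable E n 4"
    if v: "deep E n c v1" "deep E n c v2" "\<not> same_block E v1 v2" and l: "lone E n c v1"
      and z: "E c z" "E v1 z" "E c z'" "E v1 z'" "z \<noteq> z'" for v1 v2 z z'
  proof -
    interpret two_deep_blocks n E c v1 v2
      by (rule two[OF v])
    show ?thesis
    proof (rule rainbow_colorable_lone[OF _ _ z])
      show False if "deep E n c x" "deep E n c y" "deep E n c z" "E x y" "E x z" "E y z" for x y z
        by (rule pair[OF that])
      show "w = v1" if "deep E n c w" "cl1 w" for w
        using lone_eq[OF l that(1)] that(2) by (simp add: cl1_def)
    qed
  qed
  interpret two_deep_blocks n E c v1 v2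
    by (rule two[OF v])
  show ?thesis
    using last
  proof (elim disjE)
    assume big: "\<forall>y<n. shallow E n c y \<longrightarrow> (\<exists>y2<n. \<exists>y3<n. \<exists>y4<n. E c y2 \<and> E c y3 \<and> E c y4 \<and>
        E y y2 \<and> E y y3 \<and> E y y4 \<and> y2 \<noteq> y3 \<and> y2 \<noteq> y4 \<and> y3 \<noteq> y4)"
    show ?thesis
    proof (rule rainbow_colorable_cyclic[OF pair])
      fix y
      assume "cl3 y"
      then have "shallow E n c y" "y < n"
        using shallow_iff E_less unfolding cl3_def by blast+
      then show "\<exists>y2 y3 y4. E c y2 \<and> E c y3 \<and> E c y4 \<and> E y y2 \<and> E y y3 \<and> E y y4 \<and>
          y2 \<noteq> y3 \<and> y2 \<noteq> y4 \<and> y3 \<noteq> y4"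
        using big by blast
    qed
  next
    assume all: "\<forall>v<n. deep E n c v \<longrightarrow> lone E n c v"
    have l: "lone E n c v1" "lone E n c v2"
      using all v(1,2) deep_near by blast+
    show ?thesis
    proof (rule rainbow_colorable_all_lone)
      show "v = v1" if "deep E n c v" "cl1 v" for v
        using lone_eq[OF l(1) that(1)] that(2) by (simp add: cl1_def)
      show "v = v2" if "deep E n c v" "cl2 v" for v
        using lone_eq[OF l(2) that(1)] that(2) by (simp add: cl2_def)
    qed
  next
    assume "\<exists>v<n. deep E n c v \<and> lone E n c v \<and>
       (\<exists>z<n. \<exists>z'<n. E c z \<and> E c z' \<and> E v z \<and> E v z' \<and> z \<noteq> z')"
    then obtain w z z' where w: "deep E n c w" "lone E n c w"
      and z: "E c z" "E w z" "E c z'" "E w z'" "z \<noteq> z'"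
      by blast
    \<comment> \<open>Whichever of v1 and v2 lies outside the block of w takes the place of the
      second block, with w in the role of the first.\<close>
    have "\<not> same_block E w v1 \<or> \<not> same_block E w v2"
      using near_trans[of v1 w v2] same_block_sym v deep_near w(1) by blast
    then show ?thesis
      using wide[OF w(1) v(1) _ w(2) z] wide[OF w(1) v(2) _ w(2) z] by blast
  qed
qed

end

context block_graph_of_radius_two
begin

lemma rainbowE:
  assumes "rainbow_colorable E n k"
  obtains \<chi> where "rainbow n E \<chi> k"
proof -
  obtain \<chi> where "card (\<chi> ` edges E) \<le> k" "\<forall>u<n. \<forall>v<n. \<exists>S. rwalk E \<chi> u S v"
    using assms unfolding rainbow_colorable_def by blast
  then have "rainbow n E \<chi> k"
    by unfold_locales auto
  then show thesis
    by (rule that)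
qed

text \<open>Vertices below deep vertices of two blocks would need two colors each to meet at the
  root.\<close>

lemma one_deep_block_if_3:
  assumes k: "k \<le> 3" and col: "rainbow n E \<chi> k"
  shows "one_deep_block E n c"
  unfolding one_deep_block_def
proof (intro allI impI, rule ccontr)
  interpret rainbow n E \<chi> k
    by (rule col)
  interpret rainbow_rooted n E \<chi> k c
    by unfold_locales
  fix v w
  assume v: "deep E n c v" "deep E n c w" "\<not> same_block E v w"
  obtain x where x: "x < n" "far E c x" "E v x"
    using v(1) unfolding deep_def by blast
  obtain y where y: "y < n" "far E c y" "E w y"
    using v(2) unfolding deep_def by blast
  have "br x = v" "br y = w"
    using x y v par_child by (simp_all add: br_far)
  then have ns: "\<not> same_block E (br x) (br y)"
    using v(3) by simp
  have ne: "x \<noteq> c" "y \<noteq> c"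
    using x(2) y(2) by (simp_all add: far_def)
  obtain S T where "rw x S c" "rw y T c" "S \<inter> T = {}" "card S + card T \<le> k"
    by (rule through_root[OF x(1) ne(1) y(1) ne(2) ns])
  then show False
    using far_walk_card[of x S] far_walk_card[of y T] x(2) y(2) k by linarith
qed

text \<open>Two colors leave room for at most one cut vertex in the hub, which gives a universal
  vertex b as a new root. Different blocks at b need different root colors, so there are at most
  two.\<close>

lemma cond2_if_colorable:
  assumes "rainbow_colorable E n 2"
  shows "cond2 E n"
proof -
  obtain \<chi> where col: "rainbow n E \<chi> 2"
    using rainbowE[OF assms] .
  have odb: "one_deep_block E n c"
    by (rule one_deep_block_if_3[OF _ col]) simp
  obtain b where b: "b < n" "universal E n b"
  proof -
    interpret rainbow n E \<chi> 2
      by (rule col)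
    interpret pendant_clique n E hub hub_top
      by (rule hub[OF odb])
    interpret rainbow_pendant_clique n E \<chi> 2 hub hub_top
      by unfold_locales
    have "\<exists>b<n. universal E n b"
      by (rule universal_if_one_cut[OF _ n_pos]) (rule cuts_unique_if_2[OF order_refl])
    then show ?thesis
      using that by blast
  qed
  interpret rainbow n E \<chi> 2
    by (rule col)
  interpret r: rooted_graph n E b
    by (rule rooted_if_universal[OF b])
  interpret r: rainbow_rooted n E \<chi> 2 b
    by unfold_locales
  have near: "E b x" "r.br x = x" if "x < n" "x \<noteq> b" for x
    using b(2) that r.br_near[of x] unfolding universal_def same_block_def by auto
  have ne: "r.rt x \<noteq> r.rt y" if x: "x < n" "y < n" "\<not> same_block E x y" "x \<noteq> b" "y \<noteq> b" for x y
  proof -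
    have ns: "\<not> same_block E (r.br x) (r.br y)"
      using x near by simp
    obtain S T where S: "rw x S b" "rw y T b" "S \<inter> T = {}" "card S + card T \<le> 2"
      by (rule r.through_root[OF x(1,4,2,5) ns])
    then have "card S = 1" "card T = 1"
      using r.near_walk_card[OF S(1) x(4)] r.near_walk_card[OF S(2) x(5)] by linarith+
    then show ?thesis
      using r.near_walk_1[OF S(1) x(4)] r.near_walk_1[OF S(2) x(5)] S(3) by simp
  qed
  have "same_block E x y \<or> same_block E x z \<or> same_block E y z" if x: "x < n" "y < n" "z < n" for x y z
  proof (rule ccontr)
    assume a: "\<not> ?thesis"
    have nb: "u \<noteq> b" if "w < n" "\<not> same_block E u w" for u w
      using b(2) that unfolding universal_def by blast
    have xyz: "x \<noteq> b" "y \<noteq> b" "z \<noteq> b"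
      using nb[OF x(2), of x] nb[OF x(3), of y] nb[OF x(1), of z] a same_block_sym by blast+
    have "card {r.rt x, r.rt y, r.rt z} = 3"
      using ne[of x y] ne[of x z] ne[of y z] x xyz a by simp
    moreover have "{r.rt x, r.rt y, r.rt z} \<subseteq> colors"
      using color_in[OF E_sym[OF near(1)]] x xyz by (simp add: r.rt_def)
    ultimately have "3 \<le> card colors"
      using card_mono[OF finite_colors] by metis
    then show False
      using card_colors by linarith
  qed
  then show ?thesis
    using b unfolding cond2_def by blast
qed

lemma cond3_if_colorable:
  assumes "rainbow_colorable E n 3"
  shows "cond3 E n"
proof -
  obtain \<chi> where col: "rainbow n E \<chi> 3"
    using rainbowE[OF assms] .
  have odb: "one_deep_block E n c"
    by (rule one_deep_block_if_3[OF order_refl col])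
  interpret rainbow n E \<chi> 3
    by (rule col)
  interpret pendant_clique n E hub hub_top
    by (rule hub[OF odb])
  interpret rainbow_pendant_clique n E \<chi> 3 hub hub_top
    by unfold_locales
  show ?thesis
  proof (cases "\<forall>b b'. b \<in> cuts \<longrightarrow> b' \<in> cuts \<longrightarrow> b = b'")
    case True
    have "\<exists>b<n. universal E n b"
      by (rule universal_if_one_cut[OF _ n_pos]) (use True in blast)
    then show ?thesis
      unfolding cond3_def by blast
  next
    case False
    \<comment> \<open>With two cut vertices at hand, every b has another one to be compared with in
      \<open>one_pendant_if_3\<close>.\<close>
    then have other: "\<exists>b' w. child b' w \<and> b \<noteq> b'" for b
      unfolding cuts_child by metis
    have same: "same_block E u w" if "child b u" "child b w" for b u w
      using one_pendant_if_3[OF order_refl that] other[of b] by blast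
    have far_child: "child v u" if "deep E n c v" "far E c u" "E v u" for u v
      using far_not_hub[OF _ that(2)] par_child[OF that] E_less[OF that(3)] unfolding child_def by simp
    have shallow_child: "child c y" if "shallow E n c y" for y
      using shallow_not_hub[OF that] unfolding child_def by simp
    have deep_cut: "v \<in> cuts" "v \<noteq> c" if v: "deep E n c v" for v
    proof -
      obtain u where "far E c u" "E v u"
        using v unfolding deep_def by blast
      then show "v \<in> cuts"
        using far_child[OF v] unfolding cuts_child by blast
      show "v \<noteq> c"
        using deep_near[OF v] E_irrefl by blast
    qed
    have "cond3_at E n c"
      unfolding cond3_at_def
    proof (intro conjI odb allI impI)
      show "one_pendant_each E n c"
        unfolding one_pendant_each_def using same far_child by blast
      show "same_block E y z" if "shallow E n c y" "shallow E n c z" for y z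
        using same shallow_child that by blast
      show "\<not> (\<exists>v1<n. \<exists>v2<n. \<exists>v3<n. deep E n c v1 \<and> deep E n c v2 \<and> deep E n c v3 \<and>
          v1 \<noteq> v2 \<and> v1 \<noteq> v3 \<and> v2 \<noteq> v3 \<and> ((\<exists>y<n. shallow E n c y) \<or>
          (\<exists>v4<n. deep E n c v4 \<and> v1 \<noteq> v4 \<and> v2 \<noteq> v4 \<and> v3 \<noteq> v4)))"
      proof (intro notI, elim exE conjE disjE)
        fix v1 v2 v3 y
        assume d: "deep E n c v1" "deep E n c v2" "deep E n c v3" "v1 \<noteq> v2" "v1 \<noteq> v3" "v2 \<noteq> v3"
          and "shallow E n c y"
        then have "c \<in> cuts"
          using shallow_child unfolding cuts_child by blast
        then show False
          using four_cuts_if_3[of v1 v2 v3 c] deep_cut d by auto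
      next
        fix v1 v2 v3 v4
        assume d: "deep E n c v1" "deep E n c v2" "deep E n c v3" "v1 \<noteq> v2" "v1 \<noteq> v3" "v2 \<noteq> v3"
          and "deep E n c v4" "v1 \<noteq> v4" "v2 \<noteq> v4" "v3 \<noteq> v4"
        then show False
          using four_cuts_if_3[of v1 v2 v3 v4] deep_cut by auto
      qed
    qed
    then show ?thesis
      using c_less rooted unfolding cond3_def by blast
  qed
qed

lemma cond4_if_colorable:
  assumes "rainbow_colorable E n 4"
  shows "cond4 E n"
proof (cases "one_deep_block E n c")
  case True
  then show ?thesis
    using c_less rooted unfolding cond4_def cond4_at_def by blast
next
  case False
  then obtain d1 d2 where d: "deep E n c d1" "deep E n c d2" "\<not> same_block E d1 d2"
    unfolding one_deep_block_def by blast
  obtain \<chi> where col: "rainbow n E \<chi> 4"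
    using rainbowE[OF assms] .
  interpret rainbow n E \<chi> 4
    by (rule col)
  interpret rainbow_rooted_4 n E \<chi> c d1 d2
    by unfold_locales (use d in auto)
  have ope: "one_pendant_each E n c"
    unfolding one_pendant_each_def
  proof (intro allI impI)
    fix v u w
    assume h: "v < n" "u < n" "w < n" "deep E n c v" "far E c u" "far E c w" "E v u" "E v w"
    then have "par u = par w"
      using par_child by simp
    then show "same_block E u w"
      using single_pendant h by blast
  qed
  have three: "(same_block E x y \<or> same_block E x z \<or> same_block E y z) \<and> \<not> (E x y \<and> E x z \<and> E y z)"
    if "deep E n c x" "deep E n c y" "deep E n c z" for x y z
    using no_three_deep_blocks[OF that] no_three_deep_in_block[OF that] by blast
  \<comment> \<open>When the other two alternatives fail, some block has two deep vertices and every
    lone deep vertex has a thin block, which are the premises of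
    \<open>large_shallow_blocks\<close>.\<close>
  have last: "(\<forall>y<n. shallow E n c y \<longrightarrow> (\<exists>y2<n. \<exists>y3<n. \<exists>y4<n. E c y2 \<and> E c y3 \<and> E c y4 \<and>
        E y y2 \<and> E y y3 \<and> E y y4 \<and> y2 \<noteq> y3 \<and> y2 \<noteq> y4 \<and> y3 \<noteq> y4))"
    if not_all: "\<not> (\<forall>v<n. deep E n c v \<longrightarrow> lone E n c v)"
      and thin: "\<not> (\<exists>v<n. deep E n c v \<and> lone E n c v \<and>
       (\<exists>z<n. \<exists>z'<n. E c z \<and> E c z' \<and> E v z \<and> E v z' \<and> z \<noteq> z'))"
  proof (intro allI impI)
    fix y
    assume y: "shallow E n c y"
    obtain x x' where x: "deep E n c x" "deep E n c x'" "same_block E x x'" "x \<noteq> x'"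
      using not_all unfolding lone_def by blast
    have "\<exists>y2 y3 y4. E c y2 \<and> E c y3 \<and> E c y4 \<and> E y y2 \<and> E y y3 \<and> E y y4 \<and>
        y2 \<noteq> y3 \<and> y2 \<noteq> y4 \<and> y3 \<noteq> y4"
    proof (rule large_shallow_blocks[OF x _ y])
      fix v z z'
      assume v: "deep E n c v" "\<And>v'. deep E n c v' \<Longrightarrow> same_block E v v' \<Longrightarrow> v = v'"
        and z: "E c z" "E c z'" "E v z" "E v z'"
      have "lone E n c v" "v < n" "z < n" "z' < n"
        using v deep_near z E_less unfolding lone_def by blast+
      then show "z = z'"
        using thin v(1) z by blast
    qed
    then show "\<exists>y2<n. \<exists>y3<n. \<exists>y4<n. E c y2 \<and> E c y3 \<and> E c y4 \<and>
        E y y2 \<and> E y y3 \<and> E y y4 \<and> y2 \<noteq> y3 \<and> y2 \<noteq> y4 \<and> y3 \<noteq> y4"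
      using E_less by blast
  qed
  have "cond4_at E n c"
    unfolding cond4_at_def
  proof (rule disjI2, intro conjI ope)
    show "\<forall>x<n. \<forall>y<n. \<forall>z<n. deep E n c x \<longrightarrow> deep E n c y \<longrightarrow> deep E n c z \<longrightarrow>
      (same_block E x y \<or> same_block E x z \<or> same_block E y z) \<and> \<not> (E x y \<and> E x z \<and> E y z)"
      using three by blast
  qed (use last in argo)
  then show ?thesis
    using c_less rooted unfolding cond4_def by blast
qed

lemma radius_two_at: "rooted E n b \<Longrightarrow> b < n \<Longrightarrow> block_graph_of_radius_two n E b"
  by unfold_locales (use triangles in auto)

text \<open>Sufficiency holds for every root and necessity for the given one, so quantifying
  existentially over roots gives an equivalence; \<open>radius_two_at\<close> moves to the root of
  the witness.\<close>

lemma rainbow_colorable_iff: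
  "rainbow_colorable E n 0 \<longleftrightarrow> cond0 E n"
  "rainbow_colorable E n 1 \<longleftrightarrow> cond1 E n"
  "rainbow_colorable E n 2 \<longleftrightarrow> cond2 E n"
  "rainbow_colorable E n 3 \<longleftrightarrow> cond3 E n"
  "rainbow_colorable E n 4 \<longleftrightarrow> cond4 E n"
proof -
  show "rainbow_colorable E n 0 \<longleftrightarrow> cond0 E n"
  proof
    assume "rainbow_colorable E n 0"
    then obtain \<chi> where "rainbow n E \<chi> 0"
      by (rule rainbowE)
    then show "cond0 E n"
      unfolding cond0_def using rainbow.singleton_if_0 by blast
  next
    assume "cond0 E n"
    then show "rainbow_colorable E n 0"
      unfolding cond0_def by (intro rainbow_colorable_singleton) blast
  qed
  show "rainbow_colorable E n 1 \<longleftrightarrow> cond1 E n"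
  proof
    assume "rainbow_colorable E n 1"
    then obtain \<chi> where "rainbow n E \<chi> 1"
      by (rule rainbowE)
    then show "cond1 E n"
      unfolding cond1_def using rainbow.complete_if_1 by blast
  next
    assume "cond1 E n"
    then show "rainbow_colorable E n 1"
      unfolding cond1_def by (intro rainbow_colorable_complete) blast
  qed
  show "rainbow_colorable E n 2 \<longleftrightarrow> cond2 E n"
    using colorable_2 cond2_if_colorable by blast
  show "rainbow_colorable E n 3 \<longleftrightarrow> cond3 E n"
  proof
    assume "cond3 E n"
    then consider b where "b < n" "universal E n b" | b where "b < n" "rooted E n b" "cond3_at E n b"
      unfolding cond3_def by blast
    then show "rainbow_colorable E n 3"
      using colorable_3_universal block_graph_of_radius_two.colorable_3_at[OF radius_two_at] by cases
  qed (rule cond3_if_colorable)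
  show "rainbow_colorable E n 4 \<longleftrightarrow> cond4 E n"
  proof
    assume "cond4 E n"
    then obtain b where "b < n" "rooted E n b" "cond4_at E n b"
      unfolding cond4_def by blast
    then show "rainbow_colorable E n 4"
      using block_graph_of_radius_two.colorable_4_at[OF radius_two_at] by blast
  qed (rule cond4_if_colorable)
qed

end


section \<open>The conditions as first-order formulas\<close>

text \<open>Derived connectives are abbreviations, so that the machine has to evaluate five
  constructors only.\<close>

definition Dsj :: "fo \<Rightarrow> fo \<Rightarrow> fo" where
  "Dsj \<phi> \<psi> = Neg (Cnj (Neg \<phi>) (Neg \<psi>))"

definition Imp :: "fo \<Rightarrow> fo \<Rightarrow> fo" where
  "Imp \<phi> \<psi> = Neg (Cnj \<phi> (Neg \<psi>))"

definition Uni :: "nat \<Rightarrow> fo \<Rightarrow> fo" where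
  "Uni k \<phi> = Neg (Exi k (Neg \<phi>))"

lemma sat_derived [simp]:
  "sat E n \<sigma> (Dsj \<phi> \<psi>) \<longleftrightarrow> sat E n \<sigma> \<phi> \<or> sat E n \<sigma> \<psi>"
  "sat E n \<sigma> (Imp \<phi> \<psi>) \<longleftrightarrow> (sat E n \<sigma> \<phi> \<longrightarrow> sat E n \<sigma> \<psi>)"
  "sat E n \<sigma> (Uni k \<phi>) \<longleftrightarrow> (\<forall>v<n. sat E n (\<sigma>(k := v)) \<phi>)"
  by (auto simp: Dsj_def Imp_def Uni_def)

lemma wf_derived [simp]:
  "wf_fo d (Dsj \<phi> \<psi>) \<longleftrightarrow> wf_fo d \<phi> \<and> wf_fo d \<psi>"
  "wf_fo d (Imp \<phi> \<psi>) \<longleftrightarrow> wf_fo d \<phi> \<and> wf_fo d \<psi>"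
  "wf_fo d (Uni k \<phi>) \<longleftrightarrow> k < d \<and> k \<notin> bvars \<phi> \<and> wf_fo d \<phi>"
  "bvars (Dsj \<phi> \<psi>) = bvars \<phi> \<union> bvars \<psi>"
  "bvars (Imp \<phi> \<psi>) = bvars \<phi> \<union> bvars \<psi>"
  "bvars (Uni k \<phi>) = insert k (bvars \<phi>)"
  by (auto simp: Dsj_def Imp_def Uni_def)

text \<open>Beyond the index range a matrix entry has no meaning while adjacency is false;
  quantifiers below \<open>n\<close> do not see the difference.\<close>

lemma sat_cong:
  assumes "\<And>i j. i < n \<Longrightarrow> j < n \<Longrightarrow> E i j = E' i j" "\<And>i. \<sigma> i < n"
  shows "sat E n \<sigma> \<phi> = sat E' n \<sigma> \<phi>"
  using assms(2)
proof (induction \<phi> arbitrary: \<sigma>)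
  case (Exi k \<phi>)
  have "sat E n (\<sigma>(k := v)) \<phi> = sat E' n (\<sigma>(k := v)) \<phi>" if "v < n" for v
    by (rule Exi.IH) (use Exi.prems that in simp)
  then show ?case
    by auto
qed (use assms(1) in auto)

definition Same :: "nat \<Rightarrow> nat \<Rightarrow> fo" where
  "Same x y = Dsj (Equ x y) (Adj x y)"

definition Far :: "nat \<Rightarrow> nat \<Rightarrow> fo" where
  "Far c w = Cnj (Neg (Equ w c)) (Neg (Adj c w))"

text \<open>Variables 7 and 8 are reserved for the quantifiers in the following two formulas.\<close>

definition Deep :: "nat \<Rightarrow> nat \<Rightarrow> fo" where
  "Deep c v = Cnj (Adj c v) (Exi 7 (Cnj (Far c 7) (Adj v 7)))"

definition Shallow :: "nat \<Rightarrow> nat \<Rightarrow> fo" where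
  "Shallow c y = Cnj (Adj c y) (Neg (Exi 8 (Cnj (Deep c 8) (Same 8 y))))"

lemma sat_basic [simp]:
  "sat E n \<sigma> (Same x y) \<longleftrightarrow> same_block E (\<sigma> x) (\<sigma> y)"
  "sat E n \<sigma> (Far c w) \<longleftrightarrow> far E (\<sigma> c) (\<sigma> w)"
  "c \<noteq> 7 \<Longrightarrow> v \<noteq> 7 \<Longrightarrow> sat E n \<sigma> (Deep c v) \<longleftrightarrow> deep E n (\<sigma> c) (\<sigma> v)"
  by (auto simp: Same_def Far_def Deep_def same_block_def far_def deep_def)

lemma sat_Shallow [simp]:
  "c < 7 \<Longrightarrow> y < 7 \<Longrightarrow> sat E n \<sigma> (Shallow c y) \<longleftrightarrow> shallow E n (\<sigma> c) (\<sigma> y)"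
  by (auto simp: Shallow_def shallow_def)

lemma wf_basic [simp]:
  "wf_fo 9 (Same x y) \<longleftrightarrow> x < 9 \<and> y < 9" "bvars (Same x y) = {}"
  "wf_fo 9 (Far x y) \<longleftrightarrow> x < 9 \<and> y < 9" "bvars (Far x y) = {}"
  "wf_fo 9 (Deep x y) \<longleftrightarrow> x < 9 \<and> y < 9" "bvars (Deep x y) = {7}"
  "wf_fo 9 (Shallow x y) \<longleftrightarrow> x < 9 \<and> y < 9" "bvars (Shallow x y) = {7, 8}"
  by (auto simp: Same_def Far_def Deep_def Shallow_def)

text \<open>Variable 0 is the root and stays free, as in \<open>One_Deep_Block\<close>,
  \<open>One_Pendant_Each\<close> and \<open>Lone\<close>; the last also has variable 1
  free.\<close>

definition Rooted :: fo where
  "Rooted =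
    Cnj (Uni 1 (Imp (Far 0 1) (Exi 2 (Cnj (Adj 0 2) (Adj 2 1)))))
    (Cnj (Uni 1 (Uni 2 (Uni 3 (Imp (Far 0 1) (Imp (Adj 0 2) (Imp (Adj 2 1) (Imp (Adj 0 3)
      (Imp (Adj 3 1) (Equ 2 3)))))))))
    (Cnj (Uni 1 (Uni 2 (Uni 3 (Imp (Adj 0 1) (Imp (Adj 0 2) (Imp (Adj 0 3) (Imp (Adj 1 2)
      (Imp (Adj 2 3) (Same 1 3)))))))))
    (Cnj (Uni 1 (Uni 2 (Uni 3 (Imp (Far 0 1) (Imp (Far 0 2) (Imp (Adj 1 2) (Imp (Adj 0 3)
      (Imp (Adj 3 1) (Adj 3 2)))))))))
    (Uni 1 (Uni 2 (Uni 3 (Imp (Far 0 1) (Imp (Far 0 2) (Imp (Far 0 3) (Imp (Adj 1 2)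
      (Imp (Adj 2 3) (Same 1 3))))))))))))"

text \<open>This also checks that the matrix encodes a symmetric loop-free graph at all. Only graphs
  with a centre pass, which is no loss because four colors guarantee one.\<close>

definition Block_Graph :: fo where
  "Block_Graph =
    Cnj (Uni 1 (Uni 2 (Imp (Adj 1 2) (Adj 2 1))))
    (Cnj (Uni 1 (Neg (Adj 1 1)))
    (Cnj (Uni 1 (Uni 2 (Imp (Adj 1 2) (Exi 3 (Cnj (Adj 1 3) (Adj 2 3))))))
    (Exi 0 Rooted)))"

definition Cond0 :: fo where
  "Cond0 = Uni 1 (Uni 2 (Equ 1 2))"

definition Cond1 :: fo where
  "Cond1 = Uni 1 (Uni 2 (Same 1 2))"

definition Universal :: fo where
  "Universal = Exi 0 (Uni 1 (Same 0 1))"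

definition Cond2 :: fo where
  "Cond2 = Cnj Universal (Uni 1 (Uni 2 (Uni 3 (Dsj (Same 1 2) (Dsj (Same 1 3) (Same 2 3))))))"

definition One_Deep_Block :: fo where
  "One_Deep_Block = Uni 1 (Uni 2 (Imp (Deep 0 1) (Imp (Deep 0 2) (Same 1 2))))"

definition One_Pendant_Each :: fo where
  "One_Pendant_Each = Uni 1 (Uni 2 (Uni 3 (Imp (Deep 0 1) (Imp (Far 0 2) (Imp (Far 0 3)
    (Imp (Adj 1 2) (Imp (Adj 1 3) (Same 2 3))))))))"

definition Cond3 :: fo where
  "Cond3 = Dsj Universal (Exi 0 (Cnj Rooted (Cnj One_Deep_Block (Cnj One_Pendant_Each
    (Cnj (Uni 1 (Uni 2 (Imp (Shallow 0 1) (Imp (Shallow 0 2) (Same 1 2)))))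
    (Neg (Exi 1 (Exi 2 (Exi 3 (Cnj (Deep 0 1) (Cnj (Deep 0 2) (Cnj (Deep 0 3)
      (Cnj (Neg (Equ 1 2)) (Cnj (Neg (Equ 1 3)) (Cnj (Neg (Equ 2 3))
      (Dsj (Exi 4 (Shallow 0 4))
        (Exi 4 (Cnj (Deep 0 4) (Cnj (Neg (Equ 1 4)) (Cnj (Neg (Equ 2 4)) (Neg (Equ 3 4))))))))))))))))))))))"

definition Lone :: fo where
  "Lone = Uni 2 (Imp (Deep 0 2) (Imp (Same 1 2) (Equ 1 2)))"

definition Cond4 :: fo where
  "Cond4 = Exi 0 (Cnj Rooted (Dsj One_Deep_Block (Cnj One_Pendant_Each
    (Cnj (Uni 1 (Uni 2 (Uni 3 (Imp (Deep 0 1) (Imp (Deep 0 2) (Imp (Deep 0 3)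
      (Cnj (Dsj (Same 1 2) (Dsj (Same 1 3) (Same 2 3)))
        (Neg (Cnj (Adj 1 2) (Cnj (Adj 1 3) (Adj 2 3)))))))))))
    (Dsj (Uni 1 (Imp (Shallow 0 1) (Exi 2 (Exi 3 (Exi 4 (Cnj (Adj 0 2) (Cnj (Adj 0 3) (Cnj (Adj 0 4)
      (Cnj (Adj 1 2) (Cnj (Adj 1 3) (Cnj (Adj 1 4)
      (Cnj (Neg (Equ 2 3)) (Cnj (Neg (Equ 2 4)) (Neg (Equ 3 4)))))))))))))))
    (Dsj (Uni 1 (Imp (Deep 0 1) Lone))
    (Exi 1 (Cnj (Deep 0 1) (Cnj Lone (Exi 3 (Exi 4 (Cnj (Adj 0 3) (Cnj (Adj 0 4)
      (Cnj (Adj 1 3) (Cnj (Adj 1 4) (Neg (Equ 3 4)))))))))))))))))"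

lemma sat_Rooted [simp]: "sat E n \<sigma> Rooted \<longleftrightarrow> rooted E n (\<sigma> 0)"
  by (simp add: Rooted_def rooted_def)

lemma sat_Universal [simp]: "sat E n \<sigma> Universal \<longleftrightarrow> (\<exists>c<n. universal E n c)"
  by (simp add: Universal_def universal_def)

lemma sat_Block_Graph [simp]: "sat E n \<sigma> Block_Graph \<longleftrightarrow>
    (\<forall>x<n. \<forall>y<n. E x y \<longrightarrow> E y x) \<and> (\<forall>x<n. \<not> E x x) \<and>
    (\<forall>x<n. \<forall>y<n. E x y \<longrightarrow> (\<exists>z<n. E x z \<and> E y z)) \<and> (\<exists>c<n. rooted E n c)"
  by (simp add: Block_Graph_def)

lemma sat_One [simp]:
  "sat E n \<sigma> One_Deep_Block \<longleftrightarrow> one_deep_block E n (\<sigma> 0)"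
  "sat E n \<sigma> One_Pendant_Each \<longleftrightarrow> one_pendant_each E n (\<sigma> 0)"
  "sat E n \<sigma> Lone \<longleftrightarrow> lone E n (\<sigma> 0) (\<sigma> 1)"
  by (simp_all add: One_Deep_Block_def one_deep_block_def One_Pendant_Each_def one_pendant_each_def
      Lone_def lone_def)

definition Colorable :: "nat \<Rightarrow> fo" where
  "Colorable k = [Cond0, Cond1, Cond2, Cond3, Cond4] ! k"

lemma sat_Cond:
  "sat E n \<sigma> Cond0 \<longleftrightarrow> cond0 E n"
  "sat E n \<sigma> Cond1 \<longleftrightarrow> cond1 E n"
  "sat E n \<sigma> Cond2 \<longleftrightarrow> cond2 E n"
  "sat E n \<sigma> Cond3 \<longleftrightarrow> cond3 E n"
  "sat E n \<sigma> Cond4 \<longleftrightarrow> cond4 E n"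
  by (simp_all add: Cond0_def cond0_def Cond1_def cond1_def Cond2_def cond2_def
      Cond3_def cond3_def cond3_at_def Cond4_def cond4_def cond4_at_def)

lemma wf_Colorable: "k \<le> 4 \<Longrightarrow> wf_fo 9 (Colorable k)"
proof -
  assume "k \<le> 4"
  then consider "k = 0" | "k = 1" | "k = 2" | "k = 3" | "k = 4"
    by linarith
  then show ?thesis
    by cases (simp_all add: Colorable_def Cond0_def Cond1_def Cond2_def Cond3_def Cond4_def Universal_def
        Rooted_def One_Deep_Block_def One_Pendant_Each_def Lone_def)
qed

lemma wf_Block_Graph: "wf_fo 9 Block_Graph"
  by (simp add: Block_Graph_def Rooted_def)

text \<open>The subtraction is meant for \<open>1 \<le> k\<close>; \<open>Cond0\<close> is the
  sentence for the predecessor of 1.\<close>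

definition Exact :: "nat \<Rightarrow> fo" where
  "Exact k = Cnj Block_Graph (Cnj (Colorable k) (Neg (Colorable (k - 1))))"

lemma wf_Exact: "k \<le> 4 \<Longrightarrow> wf_fo 9 (Exact k)"
  by (simp add: Exact_def wf_Block_Graph wf_Colorable)


section \<open>Correctness for block graphs\<close>

lemma (in block_graph_of_radius_two) rainbow_colorable_iff_sat:
  assumes "k \<le> 4"
  shows "rainbow_colorable E n k \<longleftrightarrow> sat E n \<sigma> (Colorable k)"
proof -
  consider "k = 0" | "k = 1" | "k = 2" | "k = 3" | "k = 4"
    using assms by linarith
  then show ?thesis
    by cases (simp_all add: Colorable_def sat_Cond rainbow_colorable_iff del: One_nat_def)
qed

locale adjacency = pair_graph G for G :: "nat pair_pre_digraph" +
  fixes n :: nat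
  assumes verts: "pverts G = {0..<n}"
begin

definition E :: "nat \<Rightarrow> nat \<Rightarrow> bool" where
  "E u v \<longleftrightarrow> (u, v) \<in> parcs G"

lemma adj_E: "adj (with_proj G) = E"
  by (simp add: fun_eq_iff adj_def E_def)

lemma graph_G: "graph (with_proj G)"
  by (rule pair_graphD_graph)

lemma sgraph: "sgraph n E"
proof
  show "u < n \<and> v < n" if "E u v" for u v
    using that in_arcsD1 in_arcsD2 verts unfolding E_def by auto
  show "E v u" if "E u v" for u v
    using that sympD[OF symp_adj[OF graph_G]] unfolding adj_E by blast
  show "\<not> E v v" for v
    using pair_no_loops unfolding E_def by fastforce
qed

lemma uedges_G: "uedges (with_proj G) = edges E"
  unfolding uedges_def uedge_def edges_def E_def by force

lemma rc_le_iff_colorable: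
  assumes "Digraph_Component.connected (with_proj G)"
  shows "rc (with_proj G) \<le> k \<longleftrightarrow> rainbow_colorable E n k"
  unfolding rc_le_iff[OF graph_G assms] rainbow_colorable_def uedges_G
    rainbow_connected_iff[OF wf_digraph_graph[OF graph_G]] adj_E
  using verts by (simp add: Ball_def)

lemma sat_Exact_if_rc:
  assumes conn: "Digraph_Component.connected (with_proj G)" and "bridgeless (with_proj G)"
    "block_graph (with_proj G)" "rc (with_proj G) = k" "1 \<le> k" "k \<le> 4" "\<And>i. \<sigma> i < n"
  shows "sat E n \<sigma> (Exact k)"
proof -
  interpret sgraph n E
    by (rule sgraph)
  have sep: "locally_separated E"
    using block_graph_imp_locally_separated[OF assms(3)] unfolding adj_E .
  have tri: "every_edge_in_triangle E"
    using bridgeless_imp_every_edge_in_triangle[OF graph_G assms(2)] sep unfolding adj_E by blast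
  have "0 < n"
    using assms(7)[of 0] by simp
  have "rainbow_colorable E n k"
    using rc_le_iff_colorable[OF conn] assms(4) by blast
  then obtain \<chi> where "card (\<chi> ` edges E) \<le> k" "\<forall>u<n. \<forall>v<n. \<exists>S. rwalk E \<chi> u S v"
    unfolding rainbow_colorable_def by blast
  then interpret rainbow n E \<chi> k
    by unfold_locales auto
  \<comment> \<open>A rainbow walk with at most four colors has at most four edges, which bounds the
    diameter as \<open>ex_center\<close> requires.\<close>
  have "\<exists>c<n. within_two E n c"
    using ex_center[OF sep \<open>0 < n\<close>] walks_le_k walks_le_mono[OF _ assms(6)] by blast
  then obtain c where c: "c < n" "rooted E n c"
    using rooted_if_within_two[OF sep] by blast
  interpret block_graph_of_radius_two n E c
    by unfold_locales (use c tri in auto)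
  have "sat E n \<sigma> (Colorable k)" "\<not> sat E n \<sigma> (Colorable (k - 1))"
    using rainbow_colorable_iff_sat[of k \<sigma>] rainbow_colorable_iff_sat[of "k - 1" \<sigma>]
      rc_le_iff_colorable[OF conn, of k] rc_le_iff_colorable[OF conn, of "k - 1"] assms(4-6)
    by auto
  moreover have "sat E n \<sigma> Block_Graph"
    unfolding sat_Block_Graph
    using E_sym E_irrefl c tri E_less unfolding every_edge_in_triangle_def by blast
  ultimately show ?thesis
    by (simp add: Exact_def)
qed

lemma rc_if_sat_Exact:
  assumes "sat E n \<sigma> (Exact k)" "1 \<le> k" "k \<le> 4"
  shows "Digraph_Component.connected (with_proj G)" "bridgeless (with_proj G)"
    "block_graph (with_proj G)" "rc (with_proj G) = k"
proof -
  interpret sgraph n E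
    by (rule sgraph)
  have s: "sat E n \<sigma> Block_Graph" "sat E n \<sigma> (Colorable k)" "\<not> sat E n \<sigma> (Colorable (k - 1))"
    using assms(1) by (simp_all add: Exact_def)
  then obtain c where c: "c < n" "rooted E n c"
    by auto
  have tri: "every_edge_in_triangle E"
    unfolding every_edge_in_triangle_def
  proof (intro allI impI)
    fix x y
    assume "E x y"
    moreover have "\<forall>x<n. \<forall>y<n. E x y \<longrightarrow> (\<exists>z<n. E x z \<and> E y z)"
      using s(1) by simp
    ultimately show "\<exists>z. E x z \<and> E y z"
      using E_less[of x y] by blast
  qed
  interpret block_graph_of_radius_two n E c
    by unfold_locales (use c tri in auto)
  show "block_graph (with_proj G)"
    using locally_separated_imp_block_graph[OF graph_G] locally_separated unfolding adj_E .
  have reach: "(\<lambda>x y. E x y \<and> x \<in> pverts G \<and> y \<in> pverts G)\<^sup>*\<^sup>* c u" if "u < n" for u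
  proof -
    have step: "(\<lambda>x y. E x y \<and> x \<in> pverts G \<and> y \<in> pverts G) x y" if "E x y" for x y
      using that E_less verts by simp
    consider "u = c" | "E c u" | "far E c u"
      unfolding far_def by blast
    then show ?thesis
    proof cases
      case 2
      then show ?thesis
        by (intro r_into_rtranclp step)
    next
      case 3
      show ?thesis
        by (rule converse_rtranclp_into_rtranclp[of _ c "par u"], rule step, rule par(1)[OF that 3],
            rule r_into_rtranclp, rule step, rule par(2)[OF that 3])
    qed simp
  qed
  have "conn E (pverts G)"
    by (rule connI[of E _ c]) (use reach verts E_sym in \<open>auto simp: symp_def\<close>)
  then show conn: "Digraph_Component.connected (with_proj G)"
    unfolding connected_iff_conn[OF wf_digraph_graph[OF graph_G] symp_adj[OF graph_G]] adj_E
    using verts c(1) by simp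
  show "bridgeless (with_proj G)"
    using every_edge_in_triangle_imp_bridgeless[OF graph_G conn] tri unfolding adj_E .
  show "rc (with_proj G) = k"
    using rainbow_colorable_iff_sat[of k \<sigma>] rainbow_colorable_iff_sat[of "k - 1" \<sigma>]
      rc_le_iff_colorable[OF conn, of k] rc_le_iff_colorable[OF conn, of "k - 1"] s assms(2,3)
    by simp
qed

end

lemma length_adjacency_matrix: "length (adjacency_matrix G) = card (pverts G) * card (pverts G)"
  by (simp add: adjacency_matrix_def Let_def)

lemma matrix_adjacency_matrix:
  assumes "n = card (pverts G)" "i < n" "j < n"
  shows "matrix (adjacency_matrix G) n i j \<longleftrightarrow> (i, j) \<in> parcs G"
proof -
  have "i * n + j < (i + 1) * n"
    using assms(3) by simp
  also have "\<dots> \<le> n * n"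
    using assms(2) by (intro mult_le_mono1) simp
  finally have "i * n + j < n * n" .
  moreover have "(i * n + j) div n = i" "(i * n + j) mod n = j"
    using assms(3) by auto
  ultimately show ?thesis
    using assms by (simp add: matrix_def adjacency_matrix_def Let_def product_nth)
qed

lemma rc_problem_eq:
  assumes "1 \<le> k" "k \<le> 4"
  shows "rc_problem k = adjacency_language (\<lambda>E n. sat E n (\<lambda>_. 0) (Exact k))"
proof (intro set_eqI iffI)
  fix x
  assume "x \<in> rc_problem k"
  then obtain G n where G: "x = adjacency_matrix G" "pverts G = {0..<n}" "pair_graph G"
    "Digraph_Component.connected (with_proj G)" "bridgeless (with_proj G)" "block_graph (with_proj G)"
    "rc (with_proj G) = k"
    unfolding rc_problem_def by blast
  interpret pair_graph G
    by (rule G(3))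
  interpret adjacency G n
    by unfold_locales (rule G(2))
  have n: "n = card (pverts G)"
    using G(2) by simp
  \<comment> \<open>Connectedness here includes having a vertex, which excludes the empty input on
    this side as well.\<close>
  have "0 < n"
    using G(2,4) connected_iff_conn[OF wf_digraph_graph[OF graph_G] symp_adj[OF graph_G]]
    by (cases n) auto
  then have "sat E n (\<lambda>_. 0) (Exact k)"
    using sat_Exact_if_rc[OF G(4-7) assms, of "\<lambda>_. 0"] by simp
  moreover have "sat (matrix x n) n (\<lambda>_. 0) (Exact k) = sat E n (\<lambda>_. 0) (Exact k)"
    by (rule sat_cong) (use matrix_adjacency_matrix[OF n] G(1) \<open>0 < n\<close> in \<open>auto simp: E_def\<close>)
  ultimately show "x \<in> adjacency_language (\<lambda>E n. sat E n (\<lambda>_. 0) (Exact k))"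
    using \<open>0 < n\<close> length_adjacency_matrix[of G] n G(1) by (auto simp: adjacency_language_def)
next
  fix x
  assume "x \<in> adjacency_language (\<lambda>E n. sat E n (\<lambda>_. 0) (Exact k))"
  then obtain n where n: "0 < n" "length x = n * n" "sat (matrix x n) n (\<lambda>_. 0) (Exact k)"
    by (auto simp: adjacency_language_def)
  define G where "G = \<lparr>pverts = {0..<n}, parcs = {(i, j). i < n \<and> j < n \<and> matrix x n i j}\<rparr>"
  have "sat (matrix x n) n (\<lambda>_. 0) Block_Graph"
    using n(3) by (simp add: Exact_def)
  then have sym: "\<And>i j. i < n \<Longrightarrow> j < n \<Longrightarrow> matrix x n i j \<Longrightarrow> matrix x n j i"
    and irrefl: "\<And>i. i < n \<Longrightarrow> \<not> matrix x n i i"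
    unfolding sat_Block_Graph by blast+
  have fin: "finite {(i, j). i < n \<and> j < n \<and> matrix x n i j}"
    by (rule finite_subset[of _ "{..<n} \<times> {..<n}"]) auto
  have "pair_graph G"
  proof
    have "sym (parcs G)"
      unfolding G_def by (rule symI) (simp add: sym)
    then show "symmetric G"
      by (simp add: symmetric_def)
    show "fst e \<noteq> snd e" if "e \<in> parcs G" for e
    proof
      assume "fst e = snd e"
      moreover from that have "fst e < n" "matrix x n (fst e) (snd e)"
        by (auto simp: G_def)
      ultimately show False
        using irrefl[of "fst e"] by simp
    qed
  qed (use fin in \<open>auto simp: G_def\<close>)
  then interpret pair_graph G .
  interpret adjacency G n
    by unfold_locales (simp add: G_def)
  have arcs: "(i, j) \<in> parcs G \<longleftrightarrow> i < n \<and> j < n \<and> matrix x n i j" for i j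
    by (simp add: G_def)
  have "sat (matrix x n) n (\<lambda>_. 0) (Exact k) = sat E n (\<lambda>_. 0) (Exact k)"
    by (rule sat_cong) (use n(1) arcs in \<open>auto simp: E_def\<close>)
  then have "sat E n (\<lambda>_. 0) (Exact k)"
    using n(3) by simp
  note rc = rc_if_sat_Exact[OF this assms]
  have "x = adjacency_matrix G"
  proof (rule nth_equalityI)
    show "length x = length (adjacency_matrix G)"
      by (simp add: length_adjacency_matrix n(2) G_def)
    fix p
    assume p: "p < length x"
    then have ij: "p div n < n" "p mod n < n" "p = p div n * n + p mod n"
      using n(1,2) by (auto simp: less_mult_imp_div_less)
    have "matrix (adjacency_matrix G) n (p div n) (p mod n) \<longleftrightarrow> matrix x n (p div n) (p mod n)"
      using ij by (subst matrix_adjacency_matrix) (auto simp: G_def)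
    then show "x ! p = adjacency_matrix G ! p"
      using ij(3) by (simp add: matrix_def)
  qed
  then show "x \<in> rc_problem k"
    unfolding rc_problem_def using rc verts \<open>pair_graph G\<close> by blast
qed

theorem theorem14:
  fixes k :: nat
  assumes "k \<in> {1, 2, 3, 4}"
  shows "rc_problem k \<in> class_P"
proof -
  have k: "1 \<le> k" "k \<le> 4"
    using assms by auto
  show ?thesis
    unfolding rc_problem_eq[OF k] by (rule adjacency_language_in_P[OF wf_Exact[OF k(2)]]) simp_all
qed

end
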